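(* Let $\gamma:\mathbb{R}\to\mathbb{R}^2$ be a monomial curve with exponent vector $\beta$, let $p,q\in(1,\infty)$, let $\mu\in A^\gamma_{p,p}(\mathbb{R}^2)$ and $\lambda\in A^\gamma_{q,q}(\mathbb{R}^2)$, set $$\alpha/|\beta|=1/p-1/q,\qquad \nu=(\mu/\lambda)^{(1+\alpha/|\beta|)^{-1}},$$ and let $b:\mathbb{R}^2\to\mathbb{C}$ be locally integrable. If $[b,H_\gamma]$ is a compact operator from $L^p_\mu(\mathbb{R}^2)$ to $L^q_\lambda(\mathbb{R}^2)$, then $b\in\mathrm{VMO}^{\gamma,\alpha}_\nu(\mathbb{R}^2)$.
   Context: A monomial curve $\gamma:\mathbb{R}\to\mathbb{R}^2$ is given by parameters $\beta=(\beta_1,\beta_2)$ with $0<\beta_1<\beta_2$ and $\varepsilon,\delta\in\{-1,1\}^2$ with $\varepsilon_i\neq\delta_i$ for at least one $i$, through $\gamma(t)=(\varepsilon_1|t|^{\beta_1},\varepsilon_2|t|^{\beta_2})$ for $t>0$ and $\gamma(t)=(\delta_1|t|^{\beta_1},\delta_2|t|^{\beta_2})$ for $t\le 0$. Denote $|\beta|=\beta_1+\beta_2$. The Hilbert transform along $\gamma$ is $H_\gamma f(x)=\mathrm{p.v.}\int_{\mathbb{R}}f(x-\gamma(t))\frac{dt}{t}$, and the commutator is $[b,H_\gamma]f=bH_\gamma f-H_\gamma(bf)$. A $\gamma$-cube is a rectangle $Q=I_1\times I_2$ parallel to the coordinate axes with $\ell(Q):=\ell(I_1)^{1/\beta_1}=\ell(I_2)^{1/\beta_2}$,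 where $\ell(I_j)$ is the length of $I_j$; their collection is $\mathcal{R}^\gamma$. A weight is a positive locally integrable function, treated as a multiplier: $\|f\|_{L^s_w}=\big(\int|fw|^s\big)^{1/s}$. The class $A^\gamma_{p,p}$ consists of the weights $w$ with $[w]_{A^\gamma_{p,p}}=\sup_{Q\in\mathcal{R}^\gamma}\langle w^p\rangle_Q^{1/p}\langle w^{-p'}\rangle_Q^{1/p'}<\infty$, where $p'$ is the Hölder conjugate and $\langle f\rangle_Q=\frac1{|Q|}\int_Q f$. For a weight $w$ and $\alpha\in\mathbb{R}$, with $w(Q)=\int_Q w$, put $\mathcal{O}^{\alpha}_w(b;Q)=w(Q)^{-\alpha/|\beta|}\big(\frac1{w(Q)}\int_Q|b-\langle b\rangle_Q|\big)$. $\mathrm{BMO}^{\gamma,\alpha}_w$ consists of $b$ with $\sup_{Q\in\mathcal{R}^\gamma}\mathcal{O}^{\alpha}_w(b;Q)<\infty$, and $\mathrm{VMO}^{\gamma,\alpha}_w$ consists of those $b\in\mathrm{BMO}^{\gamma,\alpha}_w$ that satisfy all three conditions $$\lim_{r\to0}\sup_{Q\in\mathcal{R}^\gamma,\ \ell(Q)\le r}\mathcal{O}^{\alpha}_w(b;Q)=0,\quad \lim_{r\to\infty}\sup_{Q\in\mathcal{R}^\gamma,\ \ell(Q)\ge r}\mathcal{O}^{\alpha}_w(b;Q)=0,\quad \sup_{Q\in\mathcal{R}^\gamma}\lim_{|x|\to\infty}\mathcal{O}^{\alpha}_w(b;Q+x)=0.$$ *)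

theory Defs
  imports "HOL-Analysis.Analysis"
begin

section \<open>Monomial curves and the Hilbert transform\<close>

definition is_monomial_curve :: "real \<times> real \<Rightarrow> (real \<Rightarrow> real \<times> real) \<Rightarrow> bool" where
  "is_monomial_curve \<beta> \<gamma> \<longleftrightarrow> 0 < fst \<beta> \<and> fst \<beta> < snd \<beta> \<and>
     (\<exists>\<epsilon>\<in>{-1, 1} \<times> {-1, 1}. \<exists>\<delta>\<in>{-1, 1} \<times> {-1, 1}. \<epsilon> \<noteq> \<delta> \<and>
       \<gamma> = (\<lambda>t. if 0 < t
                then (fst \<epsilon> * \<bar>t\<bar> powr fst \<beta>, snd \<epsilon> * \<bar>t\<bar> powr snd \<beta>)
                else (fst \<delta> * \<bar>t\<bar> powr fst \<beta>, snd \<delta> * \<bar>t\<bar> powr snd \<beta>)))"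

definition exponent_size :: "real \<times> real \<Rightarrow> real" where
  "exponent_size \<beta> = fst \<beta> + snd \<beta>"

definition truncated_hilbert ::
    "(real \<Rightarrow> real \<times> real) \<Rightarrow> real \<Rightarrow> (real \<times> real \<Rightarrow> complex) \<Rightarrow> real \<times> real \<Rightarrow> complex" where
  "truncated_hilbert \<gamma> r f x =
     set_lebesgue_integral lebesgue {t. r < \<bar>t\<bar>} (\<lambda>t. f (x - \<gamma> t) / of_real t)"

text \<open>Existence of the principal value at a point. The total function below carries no information
  where this predicate fails.\<close>

definition hilbert_exists ::
    "(real \<Rightarrow> real \<times> real) \<Rightarrow> (real \<times> real \<Rightarrow> complex) \<Rightarrow> real \<times> real \<Rightarrow> bool" where
  "hilbert_exists \<gamma> f x \<longleftrightarrow>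
     (\<forall>r>0. (\<lambda>t. f (x - \<gamma> t) / of_real t) absolutely_integrable_on {t. r < \<bar>t\<bar>}) \<and>
     (\<exists>l. ((\<lambda>r. truncated_hilbert \<gamma> r f x) \<longlongrightarrow> l) (at_right 0))"

definition hilbert ::
    "(real \<Rightarrow> real \<times> real) \<Rightarrow> (real \<times> real \<Rightarrow> complex) \<Rightarrow> real \<times> real \<Rightarrow> complex" where
  "hilbert \<gamma> f x = Lim (at_right 0) (\<lambda>r. truncated_hilbert \<gamma> r f x)"

definition commutator ::
    "('a \<Rightarrow> complex) \<Rightarrow> (('a \<Rightarrow> complex) \<Rightarrow> 'a \<Rightarrow> complex) \<Rightarrow> ('a \<Rightarrow> complex) \<Rightarrow> 'a \<Rightarrow> complex" where
  "commutator b H f x = b x * H f x - H (\<lambda>y. b y * f y) x"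


section \<open>Cubes adapted to the curve, weights\<close>

definition gamma_cubes :: "real \<times> real \<Rightarrow> (real \<times> real) set set" where
  "gamma_cubes \<beta> = {{a..a'} \<times> {b..b'} | a a' b b'.
     a < a' \<and> b < b' \<and> (a' - a) powr (1 / fst \<beta>) = (b' - b) powr (1 / snd \<beta>)}"

text \<open>For a cube \<^term>\<open>I \<times> J\<close>, the projection \<^term>\<open>fst ` (I \<times> J)\<close> is the interval \<^term>\<open>I\<close>.\<close>

definition side :: "real \<times> real \<Rightarrow> (real \<times> real) set \<Rightarrow> real" where
  "side \<beta> Q = measure lebesgue (fst ` Q) powr (1 / fst \<beta>)"

definition average :: "'a::euclidean_space set \<Rightarrow> ('a \<Rightarrow> 'b::{banach, second_countable_topology}) \<Rightarrow> 'b" where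
  "average Q f = (1 / measure lebesgue Q) *\<^sub>R set_lebesgue_integral lebesgue Q f"

definition locally_integrable ::
    "('a::euclidean_space \<Rightarrow> 'b::euclidean_space) \<Rightarrow> bool" where
  "locally_integrable f \<longleftrightarrow> (\<forall>K. compact K \<longrightarrow> f absolutely_integrable_on K)"

definition is_weight :: "('a::euclidean_space \<Rightarrow> real) \<Rightarrow> bool" where
  "is_weight w \<longleftrightarrow> (AE x in lebesgue. 0 < w x) \<and> locally_integrable w"

definition conj_exp :: "real \<Rightarrow> real" where
  "conj_exp p = p / (p - 1)"

text \<open>Both averages of a weight are strictly positive, so finiteness of the supremum of the product
  forces each of them to be finite. The integrability conditions state this explicitly, as the
  Bochner integral of a non-integrable function is \<^term>\<open>0\<close>.\<close>

definition A_class :: "real \<times> real \<Rightarrow> real \<Rightarrow> (real \<times> real \<Rightarrow> real) set" where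
  "A_class \<beta> p = {w. is_weight w \<and>
     (\<forall>Q\<in>gamma_cubes \<beta>. (\<lambda>x. w x powr p) absolutely_integrable_on Q \<and>
                        (\<lambda>x. w x powr - conj_exp p) absolutely_integrable_on Q) \<and>
     bdd_above ((\<lambda>Q. average Q (\<lambda>x. w x powr p) powr (1 / p) *
                     average Q (\<lambda>x. w x powr - conj_exp p) powr (1 / conj_exp p)) ` gamma_cubes \<beta>)}"


section \<open>Weighted Lebesgue spaces and compact operators\<close>

text \<open>The weight acts as a multiplier. Elements are functions rather than equivalence classes, so
  \<^term>\<open>Lp_norm\<close> below is a seminorm, and identities between elements are stated almost everywhere.\<close>

definition Lp_space :: "real \<Rightarrow> ('a::euclidean_space \<Rightarrow> real) \<Rightarrow> ('a \<Rightarrow> complex) set" where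
  "Lp_space p w = {f. f \<in> borel_measurable lebesgue \<and>
                      integrable lebesgue (\<lambda>x. (cmod (f x) * w x) powr p)}"

definition Lp_norm :: "real \<Rightarrow> ('a::euclidean_space \<Rightarrow> real) \<Rightarrow> ('a \<Rightarrow> complex) \<Rightarrow> real" where
  "Lp_norm p w f = (LINT x|lebesgue. (cmod (f x) * w x) powr p) powr (1 / p)"

text \<open>Linear operators for which the image of every bounded sequence has a norm-convergent
  subsequence. Such operators are bounded, hence well defined on classes modulo null sets.\<close>

definition compact_operator ::
    "real \<Rightarrow> ('a::euclidean_space \<Rightarrow> real) \<Rightarrow> real \<Rightarrow> ('a \<Rightarrow> real) \<Rightarrow>
     (('a \<Rightarrow> complex) \<Rightarrow> ('a \<Rightarrow> complex)) \<Rightarrow> bool" where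
  "compact_operator p \<mu> q \<kappa> T \<longleftrightarrow>
     (\<forall>f\<in>Lp_space p \<mu>. T f \<in> Lp_space q \<kappa>) \<and>
     (\<forall>f\<in>Lp_space p \<mu>. \<forall>g\<in>Lp_space p \<mu>.
        AE x in lebesgue. T (\<lambda>y. f y + g y) x = T f x + T g x) \<and>
     (\<forall>c. \<forall>f\<in>Lp_space p \<mu>. AE x in lebesgue. T (\<lambda>y. c * f y) x = c * T f x) \<and>
     (\<forall>F C. (\<forall>n::nat. F n \<in> Lp_space p \<mu> \<and> Lp_norm p \<mu> (F n) \<le> C) \<longrightarrow>
        (\<exists>s g. strict_mono s \<and> g \<in> Lp_space q \<kappa> \<and>
           (\<lambda>n. Lp_norm q \<kappa> (\<lambda>x. T (F (s n)) x - g x)) \<longlonglongrightarrow> 0))"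

definition bounded_compact_support :: "('a::euclidean_space \<Rightarrow> complex) set" where
  "bounded_compact_support = {f. f \<in> borel_measurable lebesgue \<and> bounded (range f) \<and>
                                 (\<exists>K. compact K \<and> (\<forall>x. x \<notin> K \<longrightarrow> f x = 0))}"

text \<open>The defining formula of the commutator is imposed on bounded functions of compact support,
  which are dense in the domain for the weights considered here. For a general element
  \<open>f\<close> of the domain and a locally integrable \<open>b\<close>, the product \<open>b f\<close> need not be locally
  integrable, and the operator is the continuous extension.\<close>

definition commutator_compact ::
    "(real \<Rightarrow> real \<times> real) \<Rightarrow> (real \<times> real \<Rightarrow> complex) \<Rightarrow>
     real \<Rightarrow> (real \<times> real \<Rightarrow> real) \<Rightarrow> real \<Rightarrow> (real \<times> real \<Rightarrow> real) \<Rightarrow> bool" where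
  "commutator_compact \<gamma> b p \<mu> q \<kappa> \<longleftrightarrow>
     (\<exists>T. compact_operator p \<mu> q \<kappa> T \<and>
        (\<forall>f\<in>bounded_compact_support. AE x in lebesgue.
           hilbert_exists \<gamma> f x \<and> hilbert_exists \<gamma> (\<lambda>y. b y * f y) x \<and>
           T f x = commutator b (hilbert \<gamma>) f x))"


section \<open>Weighted fractional oscillation spaces\<close>

definition oscillation ::
    "real \<times> real \<Rightarrow> real \<Rightarrow> (real \<times> real \<Rightarrow> real) \<Rightarrow> (real \<times> real \<Rightarrow> complex) \<Rightarrow>
     (real \<times> real) set \<Rightarrow> real" where
  "oscillation \<beta> \<alpha> w b Q =
     (let wQ = set_lebesgue_integral lebesgue Q w in
      wQ powr (- \<alpha> / exponent_size \<beta>) *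
      (1 / wQ * set_lebesgue_integral lebesgue Q (\<lambda>x. cmod (b x - average Q b))))"

definition BMO ::
    "real \<times> real \<Rightarrow> real \<Rightarrow> (real \<times> real \<Rightarrow> real) \<Rightarrow> (real \<times> real \<Rightarrow> complex) set" where
  "BMO \<beta> \<alpha> w = {b. locally_integrable b \<and> bdd_above (oscillation \<beta> \<alpha> w b ` gamma_cubes \<beta>)}"

text \<open>Oscillations are nonnegative, so in the third condition the supremum of the limits vanishes
  exactly when each limit does.\<close>

definition VMO ::
    "real \<times> real \<Rightarrow> real \<Rightarrow> (real \<times> real \<Rightarrow> real) \<Rightarrow> (real \<times> real \<Rightarrow> complex) set" where
  "VMO \<beta> \<alpha> w = {b. b \<in> BMO \<beta> \<alpha> w \<and>
     ((\<lambda>r. SUP Q\<in>{Q\<in>gamma_cubes \<beta>. side \<beta> Q \<le> r}. oscillation \<beta> \<alpha> w b Q) \<longlongrightarrow> 0) (at_right 0) \<and>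
     ((\<lambda>r. SUP Q\<in>{Q\<in>gamma_cubes \<beta>. r \<le> side \<beta> Q}. oscillation \<beta> \<alpha> w b Q) \<longlongrightarrow> 0) at_top \<and>
     (\<forall>Q\<in>gamma_cubes \<beta>. ((\<lambda>x. oscillation \<beta> \<alpha> w b ((+) x ` Q)) \<longlongrightarrow> 0) at_infinity)}"

end

(* For y = x - gamma(t) and z = y - gamma(s), the identity
   b(x) - b(z) = (b(x) - b(y)) + (b(y) - b(z)) says that the commutator of b with the composition
   1_Q H 1_Y H 1_R is a sum of two pairings of [b, H] with bounded functions. Although H integrates
   over a curve, this composition integrates over an open set: if Y and R are suitable boxes at a
   distance comparable to the side of Q, its kernel is positive and bounded below by c / |Q| on
   Q x R. Testing with the indicators of {b <= m} in R and {b >= m} in Q (and conversely), where m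
   is a median of b on R, bounds the integral of |b - m| over Q by pairings <g, [b, H] f> with
   |f|, |g| bounded and supported in a dilate Q* of Q. The A_p conditions and Hoelder's inequality
   turn this into: the oscillation of b on Q is at most a constant times the integral of |T f| over
   Q*, divided by the L^{q'} norm of 1/kappa on Q*, for some f in the unit ball.
   By compactness, along a sequence of cubes T f may be replaced by a fixed h in L^q_kappa. For that
   h the normalized integrals are bounded, and they tend to 0 if the cubes shrink or escape to
   infinity, by integrability of |h kappa|^q, and if they grow, because the kappa^{-q'} mass of
   growing cubes that meet a fixed box tends to infinity. *)

theory Submission
  imports Defs
begin

section \<open>Commutator forms and their composition\<close>

text \<open>Two steps along the curve fill an open set because the ratio \<open>k\<close> of the
  exponents exceeds 1. In units of L^\<beta>1 and L^\<beta>2 they move by (u + v, u^k + v^k), and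
  the Jacobian k (v^(k-1) - u^(k-1)) keeps its sign while u <= 6 <= v. It vanishes at u = v, so the
  two steps must differ in size; hence Y lies near Q and R far away. A lower bound must not suffer
  from cancellation in the principal value. Only the branch t > 0 is used: \<epsilon> and \<delta>
  differ in some coordinate, so a displacement with both signs of \<epsilon> cannot come from t <=
  0. Between the separated boxes the transform is then integration against dt/t on [L, D L], a
  finite positive measure whose mass is bounded uniformly in L. This is why \<open>comm_form\<close>
  takes a measure. In the weights everything rests on \<theta> = 1 + \<alpha>/|\<beta>| = 1/p +
  1/q': the oscillation is normalized by \<nu>(Q)^\<theta>, and \<nu>^\<theta> = \<mu>/\<kappa>. The
  curve is a null set of the plane, so almost everywhere identities reach integrals along it only
  through Tonelli over all its translates.\<close>

lemma lborel_integral_shift: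
  fixes f :: "'a::euclidean_space \<Rightarrow> real"
  assumes [measurable]: "f \<in> borel_measurable borel"
  shows "(LINT x|lborel. f (x + c)) = (LINT x|lborel. f x)"
proof -
  have "(LINT x|lborel. f x) = (LINT x|distr lborel borel ((+) c). f x)"
    by (simp add: lborel_distr_plus)
  also have "\<dots> = (LINT x|lborel. f (c + x))"
    by (rule integral_distr) auto
  finally show ?thesis by (simp add: add.commute)
qed

lemma nn_integral_lborel_shift:
  fixes f :: "'a::euclidean_space \<Rightarrow> ennreal"
  assumes [measurable]: "f \<in> borel_measurable borel"
  shows "(\<integral>\<^sup>+x. f (x + c) \<partial>lborel) = (\<integral>\<^sup>+x. f x \<partial>lborel)"
proof -
  have "(\<integral>\<^sup>+x. f x \<partial>lborel) = (\<integral>\<^sup>+x. f x \<partial>distr lborel borel ((+) c))"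
    by (simp add: lborel_distr_plus)
  also have "\<dots> = (\<integral>\<^sup>+x. f (c + x) \<partial>lborel)"
    by (rule nn_integral_distr) auto
  finally show ?thesis by (simp add: add.commute)
qed

text \<open>A shift preserves the L^1 norm of \<open>b\<close> for each fixed parameter, so over a
  finite parameter measure Tonelli gives integrability although \<open>b\<close> may be unbounded.
  The integrands of the composition argument are sums of such terms.\<close>

lemma integrable_bounded_mult_shift:
  fixes b :: "'a::euclidean_space \<Rightarrow> real" and k :: "'c \<times> 'a \<Rightarrow> real"
  assumes "finite_measure N" and \<tau>[measurable]: "\<tau> \<in> borel_measurable N"
    and b: "integrable lborel b"
    and k[measurable]: "k \<in> borel_measurable (N \<Otimes>\<^sub>M lborel)" and kB: "\<And>z. \<bar>k z\<bar> \<le> B"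
  shows "integrable (N \<Otimes>\<^sub>M lborel) (\<lambda>z. k z * b (snd z - \<tau> (fst z)))"
proof -
  interpret N: finite_measure N by fact
  interpret P: pair_sigma_finite N lborel ..
  have [measurable]: "b \<in> borel_measurable borel" using b by auto
  have "(\<integral>\<^sup>+z. ennreal (norm (b (snd z - \<tau> (fst z)))) \<partial>(N \<Otimes>\<^sub>M lborel)) =
      (\<integral>\<^sup>+w. \<integral>\<^sup>+x. ennreal (norm (b (x - \<tau> w))) \<partial>lborel \<partial>N)"
    by (subst lborel.nn_integral_fst[symmetric]) auto
  also have "\<dots> = (\<integral>\<^sup>+w. \<integral>\<^sup>+x. ennreal (norm (b x)) \<partial>lborel \<partial>N)"
  proof (rule nn_integral_cong)
    show "(\<integral>\<^sup>+x. ennreal (norm (b (x - \<tau> w))) \<partial>lborel) = (\<integral>\<^sup>+x. ennreal (norm (b x)) \<partial>lborel)" for w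
      using nn_integral_lborel_shift[of "\<lambda>x. ennreal (norm (b x))" "- \<tau> w"] by simp
  qed
  also have "\<dots> < \<infinity>"
    using b by (auto simp: integrable_iff_bounded ennreal_mult_eq_top_iff N.emeasure_eq_measure less_top[symmetric])
  finally have "integrable (N \<Otimes>\<^sub>M lborel) (\<lambda>z. b (snd z - \<tau> (fst z)))"
    by (intro integrableI_bounded) auto
  then have "integrable (N \<Otimes>\<^sub>M lborel) (\<lambda>z. B * b (snd z - \<tau> (fst z)))" by simp
  then show ?thesis
  proof (rule Bochner_Integration.integrable_bound)
    show "AE z in N \<Otimes>\<^sub>M lborel. norm (k z * b (snd z - \<tau> (fst z))) \<le> norm (B * b (snd z - \<tau> (fst z)))"
      using kB by (auto simp: abs_mult intro!: mult_right_mono order_trans[OF kB abs_ge_self])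
  qed measurable
qed

text \<open>All three orders occur below: the pair (t, s) outermost for a substitution in x at fixed
  parameters, and the two inner orders according to whether the average over s or the one over t
  becomes part of a test function.\<close>

lemma integral_triple_iterated:
  fixes F :: "(real \<times> real) \<times> 'a::euclidean_space \<Rightarrow> real"
  assumes "finite_measure M" and F: "integrable ((M \<Otimes>\<^sub>M M) \<Otimes>\<^sub>M lborel) F"
  shows "(LINT z|((M \<Otimes>\<^sub>M M) \<Otimes>\<^sub>M lborel). F z) = (LINT x|lborel. LINT t|M. LINT s|M. F ((t, s), x))"
    and "(LINT z|((M \<Otimes>\<^sub>M M) \<Otimes>\<^sub>M lborel). F z) = (LINT x|lborel. LINT s|M. LINT t|M. F ((t, s), x))"
    and "(LINT z|((M \<Otimes>\<^sub>M M) \<Otimes>\<^sub>M lborel). F z) = (LINT w|(M \<Otimes>\<^sub>M M). LINT x|lborel. F (w, x))"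
proof -
  interpret M: finite_measure M by fact
  interpret MM: pair_sigma_finite M M ..
  have "finite_measure (M \<Otimes>\<^sub>M M)" 
    by (intro finite_measure_pair_measure) fact+
  then interpret M2: finite_measure "M \<Otimes>\<^sub>M M" .
  interpret P: pair_sigma_finite "M \<Otimes>\<^sub>M M" "lborel :: 'a measure" ..
  have F': "integrable ((M \<Otimes>\<^sub>M M) \<Otimes>\<^sub>M lborel) (case_prod (\<lambda>w x. F (w, x)))"
    using F by (simp add: split_beta)
  have [measurable]: "F \<in> borel_measurable ((M \<Otimes>\<^sub>M M) \<Otimes>\<^sub>M lborel)" using F by auto
  have eq: "(LINT z|((M \<Otimes>\<^sub>M M) \<Otimes>\<^sub>M lborel). F z) = (LINT x|lborel. LINT w|(M \<Otimes>\<^sub>M M). F (w, x))"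
    using P.integral_snd[OF F'] by (simp add: split_beta)
  have "AE x in lborel. integrable (M \<Otimes>\<^sub>M M) (\<lambda>w. F (w, x))"
    using P.AE_integrable_snd[OF F'] by simp
  then have ae: "AE x in lborel. (LINT w|(M \<Otimes>\<^sub>M M). F (w, x)) = (LINT t|M. LINT s|M. F ((t, s), x))
     \<and> (LINT w|(M \<Otimes>\<^sub>M M). F (w, x)) = (LINT s|M. LINT t|M. F ((t, s), x))"
  proof eventually_elim
    case (elim x)
    then have "integrable (M \<Otimes>\<^sub>M M) (case_prod (\<lambda>t s. F ((t, s), x)))" by (simp add: case_prod_unfold)
    from MM.integral_fst[OF this] MM.integral_snd[OF this] show ?case by (simp add: case_prod_unfold)
  qed
  show "(LINT z|((M \<Otimes>\<^sub>M M) \<Otimes>\<^sub>M lborel). F z) = (LINT x|lborel. LINT t|M. LINT s|M. F ((t, s), x))"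
    unfolding eq by (rule integral_cong_AE) (use ae in \<open>auto elim: eventually_mono\<close>)
  show "(LINT z|((M \<Otimes>\<^sub>M M) \<Otimes>\<^sub>M lborel). F z) = (LINT x|lborel. LINT s|M. LINT t|M. F ((t, s), x))"
    unfolding eq by (rule integral_cong_AE) (use ae in \<open>auto elim: eventually_mono\<close>)
  show "(LINT z|((M \<Otimes>\<^sub>M M) \<Otimes>\<^sub>M lborel). F z) = (LINT w|(M \<Otimes>\<^sub>M M). LINT x|lborel. F (w, x))"
    using P.integral_fst[OF F'] by (simp add: split_beta)
qed

text \<open>The pairing of \<open>g\<close> with the commutator of \<open>b\<close> and the
  averaging operator that sends f to the integral of f(x - \<gamma> t) over t in
  \<open>M\<close>.\<close>

definition comm_form ::
    "real measure \<Rightarrow> (real \<Rightarrow> 'a::euclidean_space) \<Rightarrow> ('a \<Rightarrow> real) \<Rightarrow> ('a \<Rightarrow> real) \<Rightarrow> ('a \<Rightarrow> real) \<Rightarrow> real" where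
  "comm_form M \<gamma> b f g = (LINT x|lborel. g x * (LINT t|M. f (x - \<gamma> t) * (b x - b (x - \<gamma> t))))"

text \<open>The two summands come from splitting $b(x)-b(z)$ at the intermediate point
  $y = x - \gamma(t)$ with $z = y - \gamma(s)$.\<close>

lemma comm_form_composition:
  fixes b f g h :: "'a::euclidean_space \<Rightarrow> real" and \<gamma> :: "real \<Rightarrow> 'a"
  assumes fin: "finite_measure M" and sM[measurable_cong]: "sets M = sets borel"
    and [measurable]: "\<gamma> \<in> borel_measurable borel"
    and b: "integrable lborel b"
    and [measurable]: "f \<in> borel_measurable borel" "g \<in> borel_measurable borel" "h \<in> borel_measurable borel"
    and f01: "\<And>x. f x \<in> {0..1}" and g01: "\<And>x. g x \<in> {0..1}" and h01: "\<And>x. h x \<in> {0..1}"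
    and gi: "integrable lborel g"
    and gm: "\<And>x. g x \<noteq> 0 \<Longrightarrow> m \<le> b x" and fm: "\<And>x. f x \<noteq> 0 \<Longrightarrow> b x \<le> m"
    and c: "\<And>x. g x \<noteq> 0 \<Longrightarrow> c \<le> (LINT t|M. LINT s|M. h (x - \<gamma> t) * f (x - \<gamma> t - \<gamma> s))"
  shows "c * (LINT x|lborel. g x * (b x - m)) \<le>
      comm_form M \<gamma> b (\<lambda>y. h y * (LINT s|M. f (y - \<gamma> s))) g +
      comm_form M \<gamma> b f (\<lambda>y. h y * (LINT t|M. g (y + \<gamma> t)))"
proof -
  interpret M: finite_measure M by fact
  interpret MM: pair_sigma_finite M M ..
  have fin2: "finite_measure (M \<Otimes>\<^sub>M M)" by (intro finite_measure_pair_measure) fact+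
  then interpret M2: finite_measure "M \<Otimes>\<^sub>M M" .
  interpret P: pair_sigma_finite "M \<Otimes>\<^sub>M M" "lborel :: 'a measure" ..
  have [measurable]: "b \<in> borel_measurable borel" using b by auto
  let ?W = "(M \<Otimes>\<^sub>M M) \<Otimes>\<^sub>M (lborel :: 'a measure)"
  have prod_le: "\<bar>u * v * w\<bar> \<le> 1" if "u \<in> {0..1}" "v \<in> {0..1}" "w \<in> {0..1}" for u v w :: real
  proof -
    have "u * v * w \<le> 1 * 1 * 1" using that by (intro mult_mono) auto
    moreover have "0 \<le> u * v * w" using that by auto
    ultimately show ?thesis by simp
  qed
  define k where "k = (\<lambda>z::(real\<times>real)\<times>'a. g (snd z) * h (snd z - \<gamma> (fst (fst z))) * f (snd z - \<gamma> (fst (fst z)) - \<gamma> (snd (fst z))))"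
  \<comment> \<open>\<open>k'\<close> is \<open>k\<close> with x + \<gamma>(t) in place of x: the
    intermediate point y becomes the variable of integration, which gives the second summand the
    shape of a commutator form.\<close>
  define k' where "k' = (\<lambda>z::(real\<times>real)\<times>'a. g (snd z + \<gamma> (fst (fst z))) * h (snd z) * f (snd z - \<gamma> (snd (fst z))))"
  have [measurable]: "k \<in> borel_measurable ?W" "k' \<in> borel_measurable ?W"
    unfolding k_def k'_def by measurable
  have kB: "\<bar>k z\<bar> \<le> 1" "\<bar>k' z\<bar> \<le> 1" for z
    unfolding k_def k'_def using prod_le f01 g01 h01 by blast+
  define T1 where "T1 = (\<lambda>z. k z * (b (snd z) - b (snd z - \<gamma> (fst (fst z)))))"
  define T2 where "T2 = (\<lambda>z. k z * (b (snd z - \<gamma> (fst (fst z))) - b (snd z - \<gamma> (fst (fst z)) - \<gamma> (snd (fst z)))))"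
  define T2' where "T2' = (\<lambda>z. k' z * (b (snd z) - b (snd z - \<gamma> (snd (fst z)))))"
  define T3 where "T3 = (\<lambda>z. k z * (b (snd z) - m))"
  have i0: "integrable ?W (\<lambda>z. k z * b (snd z))" "integrable ?W (\<lambda>z. k' z * b (snd z))"
    using integrable_bounded_mult_shift[OF fin2, of "\<lambda>_. 0" b k 1]
      integrable_bounded_mult_shift[OF fin2, of "\<lambda>_. 0" b k' 1] b kB by simp_all
  have i1: "integrable ?W (\<lambda>z. k z * b (snd z - \<gamma> (fst (fst z))))"
    by (rule integrable_bounded_mult_shift[OF fin2 _ b _ kB(1), of "\<lambda>w. \<gamma> (fst w)"]) measurable
  have i2: "integrable ?W (\<lambda>z. k z * b (snd z - (\<gamma> (fst (fst z)) + \<gamma> (snd (fst z)))))"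
    by (rule integrable_bounded_mult_shift[OF fin2 _ b _ kB(1), of "\<lambda>w. \<gamma> (fst w) + \<gamma> (snd w)"]) measurable
  have i3: "integrable ?W (\<lambda>z. k' z * b (snd z - \<gamma> (snd (fst z))))"
    by (rule integrable_bounded_mult_shift[OF fin2 _ b _ kB(2), of "\<lambda>w. \<gamma> (snd w)"]) measurable
  have i4: "integrable ?W k"
  proof -
    have "integrable ?W (\<lambda>z. (h (snd z - \<gamma> (fst (fst z))) * f (snd z - \<gamma> (fst (fst z)) - \<gamma> (snd (fst z)))) * g (snd z - 0))"
      by (rule integrable_bounded_mult_shift[OF fin2 _ gi, of "\<lambda>_. 0" _ 1])
         (use prod_le[OF _ _ ] f01 h01 prod_le[of 1 "h x" "f y" for x y] in auto)
    then show ?thesis by (simp add: k_def mult.assoc mult.commute mult.left_commute)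
  qed
  have iT: "integrable ?W T1" "integrable ?W T2" "integrable ?W T2'" "integrable ?W T3"
    unfolding T1_def T2_def T2'_def T3_def right_diff_distrib
    using i0 i1 i2 i3 i4 by (simp_all add: diff_diff_eq)
  have "(LINT z|?W. T1 z) = (LINT x|lborel. LINT t|M. LINT s|M. T1 ((t, s), x))"
    by (rule integral_triple_iterated(1)[OF fin iT(1)])
  also have "\<dots> = comm_form M \<gamma> b (\<lambda>y. h y * (LINT s|M. f (y - \<gamma> s))) g"
    unfolding comm_form_def T1_def k_def
    by (simp add: mult.assoc mult.left_commute mult.commute flip: integral_mult_right_zero integral_mult_left_zero)
  finally have e1: "(LINT z|?W. T1 z) = comm_form M \<gamma> b (\<lambda>y. h y * (LINT s|M. f (y - \<gamma> s))) g" .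
  have "(LINT z|?W. T2 z) = (LINT w|(M \<Otimes>\<^sub>M M). LINT x|lborel. T2 (w, x))"
    by (rule integral_triple_iterated(3)[OF fin iT(2)])
  also have "\<dots> = (LINT w|(M \<Otimes>\<^sub>M M). LINT x|lborel. T2' (w, x))"
  proof (rule Bochner_Integration.integral_cong[OF refl])
    fix w :: "real \<times> real"
    have [measurable]: "(\<lambda>x. T2 (w, x)) \<in> borel_measurable borel"
      unfolding T2_def k_def by simp
    show "(LINT x|lborel. T2 (w, x)) = (LINT x|lborel. T2' (w, x))"
      unfolding lborel_integral_shift[of "\<lambda>x. T2 (w, x)" "\<gamma> (fst w)", symmetric, simplified]
      by (simp add: T2_def T2'_def k_def k'_def)
  qed
  also have "\<dots> = (LINT z|?W. T2' z)"
    by (rule integral_triple_iterated(3)[OF fin iT(3), symmetric])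
  also have "\<dots> = (LINT x|lborel. LINT s|M. LINT t|M. T2' ((t, s), x))"
    by (rule integral_triple_iterated(2)[OF fin iT(3)])
  also have "\<dots> = comm_form M \<gamma> b f (\<lambda>y. h y * (LINT t|M. g (y + \<gamma> t)))"
    unfolding comm_form_def T2'_def k'_def
    by (simp add: mult.assoc mult.left_commute mult.commute flip: integral_mult_right_zero integral_mult_left_zero)
  finally have e2: "(LINT z|?W. T2 z) = comm_form M \<gamma> b f (\<lambda>y. h y * (LINT t|M. g (y + \<gamma> t)))" .
  \<comment> \<open>\<open>T1\<close> + \<open>T2\<close> telescopes to k (b(x) - b(z)), and where
    \<open>k\<close> does not vanish, z lies in the support of \<open>f\<close>, so b(z) is at most
    m.\<close>
  have mono: "T3 z \<le> T1 z + T2 z" for z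
  proof -
    have "0 \<le> k z" using f01 g01 h01 by (auto simp: k_def)
    moreover have "k z \<noteq> 0 \<Longrightarrow> b (snd z - \<gamma> (fst (fst z)) - \<gamma> (snd (fst z))) \<le> m"
      by (rule fm) (auto simp: k_def)
    ultimately have "k z * b (snd z - \<gamma> (fst (fst z)) - \<gamma> (snd (fst z))) \<le> k z * m"
      by (cases "k z = 0") auto
    then show ?thesis by (simp add: T1_def T2_def T3_def algebra_simps)
  qed
  have "(LINT z|?W. T3 z) \<le> (LINT z|?W. T1 z + T2 z)"
    by (intro integral_mono iT Bochner_Integration.integrable_add mono)
  also have "\<dots> = (LINT z|?W. T1 z) + (LINT z|?W. T2 z)"
    by (rule Bochner_Integration.integral_add[OF iT(1,2)])
  finally have up: "(LINT z|?W. T3 z) \<le> (LINT z|?W. T1 z) + (LINT z|?W. T2 z)" .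
  define J where "J = (\<lambda>x. LINT t|M. LINT s|M. h (x - \<gamma> t) * f (x - \<gamma> t - \<gamma> s))"
  have "(LINT z|?W. T3 z) = (LINT x|lborel. LINT t|M. LINT s|M. T3 ((t, s), x))"
    by (rule integral_triple_iterated(1)[OF fin iT(4)])
  also have "\<dots> = (LINT x|lborel. (g x * (b x - m)) * J x)"
    unfolding T3_def k_def J_def
    by (simp add: mult.assoc mult.left_commute mult.commute flip: integral_mult_right_zero integral_mult_left_zero)
  finally have T3J: "(LINT z|?W. T3 z) = (LINT x|lborel. (g x * (b x - m)) * J x)" .
  have gb: "integrable lborel (\<lambda>x. g x * (b x - m))"
    unfolding right_diff_distrib
  proof (intro Bochner_Integration.integrable_diff integrable_mult_left gi)
    show "integrable lborel (\<lambda>x. g x * b x)"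
      by (rule Bochner_Integration.integrable_bound[OF b])
         (use g01 in \<open>auto simp: abs_mult intro!: mult_left_le_one_le\<close>)
  qed
  have [measurable]: "J \<in> borel_measurable borel" unfolding J_def by measurable
  have Jle: "\<bar>J x\<bar> \<le> measure M UNIV * measure M UNIV" for x
  proof -
    have sp: "space M = UNIV" using sets_eq_imp_space_eq[OF sM] by simp
    have in1: "integrable M (\<lambda>s. h (x - \<gamma> t) * f (x - \<gamma> t - \<gamma> s))" for t
      by (rule M.integrable_const_bound[of _ 1]) (use prod_le[of 1 "h y" "f z" for y z] f01 h01 in auto)
    have a1: "\<bar>LINT s|M. h (x - \<gamma> t) * f (x - \<gamma> t - \<gamma> s)\<bar> \<le> measure M UNIV" for t
    proof -
      have "\<bar>LINT s|M. h (x - \<gamma> t) * f (x - \<gamma> t - \<gamma> s)\<bar> \<le> (LINT s|M. \<bar>h (x - \<gamma> t) * f (x - \<gamma> t - \<gamma> s)\<bar>)"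
        by (rule integral_abs_bound)
      also have "\<dots> \<le> (LINT s|M. 1)"
        by (intro integral_mono integrable_abs in1)
           (use prod_le[of 1 "h y" "f z" for y z] f01 h01 in auto)
      also have "\<dots> = measure M UNIV" by (simp add: sp)
      finally show ?thesis .
    qed
    have "\<bar>J x\<bar> \<le> (LINT t|M. \<bar>LINT s|M. h (x - \<gamma> t) * f (x - \<gamma> t - \<gamma> s)\<bar>)"
      unfolding J_def by (rule integral_abs_bound)
    also have "\<dots> \<le> (LINT t|M. measure M UNIV)"
      by (intro integral_mono integrable_abs M.integrable_const_bound[of _ "measure M UNIV"]) (use a1 in auto)
    also have "\<dots> = measure M UNIV * measure M UNIV" by (simp add: sp)
    finally show ?thesis .
  qed
  have "c * (LINT x|lborel. g x * (b x - m)) = (LINT x|lborel. (g x * (b x - m)) * c)" by simp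
  also have "\<dots> \<le> (LINT x|lborel. (g x * (b x - m)) * J x)"
  proof (rule integral_mono)
    show "integrable lborel (\<lambda>x. (g x * (b x - m)) * c)" using gb by simp
    show "integrable lborel (\<lambda>x. (g x * (b x - m)) * J x)"
    proof (rule Bochner_Integration.integrable_bound)
      show "integrable lborel (\<lambda>x. (measure M UNIV * measure M UNIV) * (g x * (b x - m)))" using gb by simp
    qed (use Jle in \<open>auto simp: abs_mult mult.commute intro!: mult_mono AE_I2\<close>)
    \<comment> \<open>The pointwise lower bound for the kernel may be inserted because g (b - m) is
      nonnegative: this is the reason for testing on {b >= m} only.\<close>
    show "(g x * (b x - m)) * c \<le> (g x * (b x - m)) * J x" for x
    proof (cases "g x = 0")
      case False
      have "c \<le> J x" using c[OF False] unfolding J_def .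
      with gm[OF False] g01[of x] show ?thesis by (intro mult_left_mono) auto
    qed simp
  qed
  also have "\<dots> \<le> (LINT z|?W. T1 z) + (LINT z|?W. T2 z)" using up T3J by simp
  finally show ?thesis unfolding e1 e2 .
qed


section \<open>The kernel of two curve averages\<close>

definition log_measure :: "real \<Rightarrow> real \<Rightarrow> real measure" where
  "log_measure a d = density lborel (\<lambda>t. ennreal (indicator {a..d} t / t))"

lemma sets_log_measure [measurable_cong, simp]: "sets (log_measure a d) = sets borel"
  and space_log_measure [simp]: "space (log_measure a d) = UNIV"
  by (simp_all add: log_measure_def)

lemma emeasure_log_measure_le:
  assumes "0 < a" "a \<le> d"
  shows "emeasure (log_measure a d) UNIV \<le> ennreal ((d - a) / a)"
proof -
  have "emeasure (log_measure a d) UNIV = (\<integral>\<^sup>+t. ennreal (indicator {a..d} t / t) \<partial>lborel)"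
    by (simp add: log_measure_def emeasure_density)
  also have "\<dots> \<le> (\<integral>\<^sup>+t. ennreal (1 / a) * indicator {a..d} t \<partial>lborel)"
    by (intro nn_integral_mono)
       (use assms in \<open>auto simp: indicator_def frac_le intro!: ennreal_leI\<close>)
  also have "\<dots> = ennreal ((d - a) / a)"
    using assms by (simp add: nn_integral_cmult flip: ennreal_mult)
  finally show ?thesis .
qed

lemma finite_measure_log_measure:
  assumes "0 < a" "a \<le> d"
  shows "finite_measure (log_measure a d)"
  using emeasure_log_measure_le[OF assms]
  by (intro finite_measureI) (auto simp: top_unique)

lemma measure_log_measure_le:
  assumes "0 < a" "a \<le> d"
  shows "measure (log_measure a d) UNIV \<le> (d - a) / a"
  unfolding measure_def
  by (rule enn2real_leI) (use emeasure_log_measure_le[OF assms] assms in auto)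

text \<open>Under t = (l u)^(1/\<beta>) the measure dt/t becomes du/(\<beta> u), and 1/u is at least
  1/b on [a, b]. The new variable u is t^\<beta> measured in units of l.\<close>

lemma nn_integral_log_measure_ge:
  fixes F :: "real \<Rightarrow> ennreal"
  assumes [measurable]: "F \<in> borel_measurable borel"
    and "0 < \<beta>" "0 < l" "0 < a" "a < b" "0 < \<tau>"
    and lo: "\<tau> \<le> (l * a) powr (1 / \<beta>)" and up: "(l * b) powr (1 / \<beta>) \<le> T"
  shows "ennreal (1 / (\<beta> * b)) * (\<integral>\<^sup>+u. F ((l * u) powr (1 / \<beta>)) * indicator {a..b} u \<partial>lborel)
      \<le> (\<integral>\<^sup>+t. F t \<partial>log_measure \<tau> T)"
proof -
  define g where "g u = (l * u) powr (1 / \<beta>)" for u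
  define g' where "g' u = g u / (\<beta> * u)" for u
  have gpos: "0 < g u" if "u \<in> {a..b}" for u using that assms by (simp add: g_def)
  have der: "(g has_real_derivative g' u) (at u)" if "u \<in> {a..b}" for u
  proof -
    have "0 < u" using that assms by simp
    then have "(g has_real_derivative (1 / \<beta>) * (l * u) powr (1 / \<beta> - 1) * l) (at u)"
      unfolding g_def using \<open>0 < l\<close> by (auto intro!: derivative_eq_intros)
    moreover have "(1 / \<beta>) * (l * u) powr (1 / \<beta> - 1) * l = g' u"
      unfolding g_def g'_def powr_diff using \<open>0 < l\<close> \<open>0 < u\<close> \<open>0 < \<beta>\<close> by simp
    ultimately show ?thesis by simp
  qed
  have contg': "continuous_on {a..b} g'"
    unfolding g'_def g_def using assms by (auto intro!: continuous_intros)
  have "ennreal (1 / (\<beta> * b)) * (\<integral>\<^sup>+u. F (g u) * indicator {a..b} u \<partial>lborel)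
      = (\<integral>\<^sup>+u. ennreal (1 / (\<beta> * b)) * (F (g u) * indicator {a..b} u) \<partial>lborel)"
    by (subst nn_integral_cmult) (auto simp: g_def)
  also have "\<dots> \<le> (\<integral>\<^sup>+u. (F (g u) * ennreal (1 / g u)) * ennreal (g' u) * indicator {a..b} u \<partial>lborel)"
  proof (rule nn_integral_mono)
    fix u
    show "ennreal (1 / (\<beta> * b)) * (F (g u) * indicator {a..b} u)
      \<le> (F (g u) * ennreal (1 / g u)) * ennreal (g' u) * indicator {a..b} u"
    proof (cases "u \<in> {a..b}")
      case True
      have "1 / (\<beta> * b) \<le> (1 / g u) * g' u"
        using True gpos[OF True] assms by (auto simp: g'_def field_simps)
      then have "ennreal (1 / (\<beta> * b)) \<le> ennreal (1 / g u) * ennreal (g' u)"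
        using gpos[OF True] by (simp add: ennreal_leI flip: ennreal_mult')
      from mult_left_mono[OF this, of "F (g u)"] show ?thesis using True by (simp add: mult_ac)
    qed simp
  qed
  also have "\<dots> = (\<integral>\<^sup>+t. F t * ennreal (1 / t) * indicator {g a..g b} t \<partial>lborel)"
  proof (rule nn_integral_substitution_aux[symmetric])
    show "(\<lambda>t. F t * ennreal (1 / t)) \<in> borel_measurable borel" by measurable
    show "0 \<le> g' u" if "u \<in> {a..b}" for u using gpos[OF that] that assms by (simp add: g'_def)
  qed (use der contg' assms in auto)
  also have "\<dots> \<le> (\<integral>\<^sup>+t. ennreal (indicator {\<tau>..T} t / t) * F t \<partial>lborel)"
    using lo up by (intro nn_integral_mono) (auto simp: indicator_def g_def mult.commute)
  also have "\<dots> = (\<integral>\<^sup>+t. F t \<partial>log_measure \<tau> T)"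
    unfolding log_measure_def by (subst nn_integral_density) auto
  finally show ?thesis by (simp add: g_def)
qed

text \<open>With $B = (A-4)^k + 6^k$, this choice of $A$ makes the second coordinate $u^k + (A'-u)^k$ sweep
  $[B, B+2]$ as $u$ runs through $[2,6]$, for every $A'$ in $[A, A+2]$. It is possible because $k > 1$.\<close>

lemma exists_spread:
  fixes k :: real
  assumes "1 < k"
  shows "\<exists>A\<ge>12. (A - 4) powr k + 6 powr k + 2 \<le> 2 powr k + (A - 2) powr k"
proof -
  \<comment> \<open>With x = A - 4 the claim follows once t^k grows by 6^k + 2 on [x, x + 2]. By the
    mean value theorem the growth is 2 k z^(k-1) with z > x, which is unbounded in x because k >
    1.\<close>
  obtain x where x: "8 \<le> x" "6 powr k + 2 \<le> x powr (k - 1)"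
  proof
    have "6 powr k + 2 = ((6 powr k + 2) powr (1 / (k - 1))) powr (k - 1)"
      using assms by (simp add: powr_powr add_nonneg_nonneg)
    also have "\<dots> \<le> (max 8 ((6 powr k + 2) powr (1 / (k - 1)))) powr (k - 1)"
      using assms by (intro powr_mono2) auto
    finally show "6 powr k + 2 \<le> (max 8 ((6 powr k + 2) powr (1 / (k - 1)))) powr (k - 1)" .
  qed simp
  have "\<exists>z. x < z \<and> z < x + 2 \<and> (x + 2) powr k - x powr k = (x + 2 - x) * (k * z powr (k - 1))"
    by (rule MVT2) (use x in \<open>auto intro!: derivative_eq_intros\<close>)
  then obtain z where z: "x < z" "(x + 2) powr k - x powr k = 2 * (k * z powr (k - 1))" by auto
  have "x powr (k - 1) \<le> z powr (k - 1)" using z x assms by (intro powr_mono2) auto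
  also have "\<dots> \<le> 2 * (k * z powr (k - 1))"
    using assms mult_right_mono[of 1 "2 * k" "z powr (k - 1)"] by simp
  finally have "6 powr k + 2 \<le> (x + 2) powr k - x powr k" using x z by simp
  moreover have "0 < (2::real) powr k" by simp
  ultimately have "x powr k + 6 powr k + 2 \<le> 2 powr k + (x + 2) powr k" by linarith
  then show ?thesis using x by (intro exI[of _ "x + 4"]) (simp add: add.commute)
qed

text \<open>The sum $A = u + v$ replaces $v$; at fixed $A$, the second coordinate
  $u^k + (A-u)^k$ is strictly monotone in $u < A/2$.\<close>

lemma nn_integral_curve_sum_ge:
  fixes F :: "real \<times> real \<Rightarrow> ennreal" and k A0 :: real
  assumes F[measurable]: "F \<in> borel_measurable borel"
    and k: "1 < k" and A0: "12 \<le> A0"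
    and spread: "(A0 - 4) powr k + 6 powr k + 2 \<le> 2 powr k + (A0 - 2) powr k"
  defines "B0 \<equiv> (A0 - 4) powr k + 6 powr k"
  shows "ennreal (1 / (k * (A0 + 2) powr (k - 1))) *
     (\<integral>\<^sup>+A. (\<integral>\<^sup>+w. F (A, w) * indicator {B0..B0+2} w \<partial>lborel) * indicator {A0..A0+2} A \<partial>lborel)
   \<le> (\<integral>\<^sup>+u. (\<integral>\<^sup>+v. F (u + v, u powr k + v powr k) * indicator {A0-6..A0} v \<partial>lborel) * indicator {2..6} u \<partial>lborel)"
    (is "ennreal (1 / ?D) * _ \<le> _")
proof -
  have D: "0 < ?D" using k A0 by simp
  have inner: "ennreal (1 / ?D) * (\<integral>\<^sup>+w. F (A, w) * indicator {B0..B0+2} w \<partial>lborel)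
      \<le> (\<integral>\<^sup>+u. F (A, u powr k + (A - u) powr k) * indicator {2..6} u \<partial>lborel)"
    if A: "A \<in> {A0..A0+2}" for A
  proof -
    \<comment> \<open>The minus sign makes \<open>g\<close> increasing on [2, 6], where A - u >= 6
      >= u; the substitution rule wants a nonnegative derivative.\<close>
    define g where "g u = - (u powr k + (A - u) powr k)" for u
    define g' where "g' u = k * ((A - u) powr (k - 1) - u powr (k - 1))" for u
    have der: "(g has_real_derivative g' u) (at u)" if "u \<in> {2..6}" for u
      unfolding g_def g'_def using that A A0 k
      by (auto intro!: derivative_eq_intros simp: field_simps)
    have g'0: "0 \<le> g' u" if "u \<in> {2..6}" for u
      unfolding g'_def using that A A0 k
      by (intro mult_nonneg_nonneg) (auto intro!: powr_mono2)
    have g'D: "g' u \<le> ?D" if "u \<in> {2..6}" for u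
    proof -
      have "(A - u) powr (k - 1) \<le> (A0 + 2) powr (k - 1)"
        using that A A0 k by (intro powr_mono2) auto
      moreover have "0 \<le> u powr (k - 1)" by simp
      ultimately have "(A - u) powr (k - 1) - u powr (k - 1) \<le> (A0 + 2) powr (k - 1)" by linarith
      then show ?thesis unfolding g'_def using k by (intro mult_left_mono) auto
    qed
    have cont: "continuous_on {2..6} g'"
      unfolding g'_def using A A0 by (auto intro!: continuous_intros)
    \<comment> \<open>The two endpoint estimates say that the sweep covers [B0, B0 + 2] for every A
      in [A0, A0 + 2]. The worst case is A = A0 at u = 2 and A = A0 + 2 at u = 6.\<close>
    have g2: "g 2 \<le> - B0 - 2"
    proof -
      have "(A0 - 2) powr k \<le> (A - 2) powr k" using A A0 k by (intro powr_mono2) auto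
      then show ?thesis using spread unfolding g_def B0_def by simp
    qed
    have g6: "- B0 \<le> g 6"
    proof -
      have "(A - 6) powr k \<le> (A0 - 4) powr k" using A A0 k by (intro powr_mono2) auto
      then show ?thesis unfolding g_def B0_def by simp
    qed
    have "(\<integral>\<^sup>+w. F (A, w) * indicator {B0..B0+2} w \<partial>lborel)
        = (\<integral>\<^sup>+w. F (A, - w) * indicator {B0..B0+2} (- w) \<partial>lborel)"
      using nn_integral_real_affine[of "\<lambda>w. F (A, w) * indicator {B0..B0+2} w" "-1" 0] by simp
    also have "\<dots> \<le> (\<integral>\<^sup>+w. F (A, - w) * indicator {g 2..g 6} w \<partial>lborel)"
      using g2 g6 by (intro nn_integral_mono) (auto simp: indicator_def)
    also have "\<dots> = (\<integral>\<^sup>+u. F (A, - g u) * ennreal (g' u) * indicator {2..6} u \<partial>lborel)"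
      by (rule nn_integral_substitution_aux) (use der g'0 cont in auto)
    also have "\<dots> \<le> (\<integral>\<^sup>+u. ennreal ?D * (F (A, - g u) * indicator {2..6} u) \<partial>lborel)"
    proof (rule nn_integral_mono)
      fix u
      show "F (A, - g u) * ennreal (g' u) * indicator {2..6} u \<le> ennreal ?D * (F (A, - g u) * indicator {2..6} u)"
      proof (cases "u \<in> {2..6}")
        case True
        have "F (A, - g u) * ennreal (g' u) \<le> F (A, - g u) * ennreal ?D"
          by (intro mult_left_mono ennreal_leI g'D True) simp
        with True show ?thesis by (simp add: mult.commute)
      qed simp
    qed
    also have "\<dots> = ennreal ?D * (\<integral>\<^sup>+u. F (A, - g u) * indicator {2..6} u \<partial>lborel)"
      by (rule nn_integral_cmult) (simp add: g_def)
    finally have "ennreal (1 / ?D) * (\<integral>\<^sup>+w. F (A, w) * indicator {B0..B0+2} w \<partial>lborel)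
      \<le> ennreal (1 / ?D) * (ennreal ?D * (\<integral>\<^sup>+u. F (A, - g u) * indicator {2..6} u \<partial>lborel))"
      by (intro mult_left_mono) auto
    also have "\<dots> = (\<integral>\<^sup>+u. F (A, - g u) * indicator {2..6} u \<partial>lborel)"
      using k A0 by (simp flip: mult.assoc ennreal_mult')
    finally show ?thesis by (simp add: g_def add.commute)
  qed
  have "ennreal (1 / ?D) *
     (\<integral>\<^sup>+A. (\<integral>\<^sup>+w. F (A, w) * indicator {B0..B0+2} w \<partial>lborel) * indicator {A0..A0+2} A \<partial>lborel)
     = (\<integral>\<^sup>+A. ennreal (1 / ?D) *
     ((\<integral>\<^sup>+w. F (A, w) * indicator {B0..B0+2} w \<partial>lborel) * indicator {A0..A0+2} A) \<partial>lborel)"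
    by (rule nn_integral_cmult[symmetric]) measurable
  also have "\<dots> \<le> (\<integral>\<^sup>+A. (\<integral>\<^sup>+u. F (A, u powr k + (A - u) powr k) * indicator {2..6} u \<partial>lborel) * indicator {A0..A0+2} A \<partial>lborel)"
    using inner by (intro nn_integral_mono) (auto simp: indicator_def)
  also have "\<dots> = (\<integral>\<^sup>+A. (\<integral>\<^sup>+u. F (A, u powr k + (A - u) powr k) * indicator {2..6} u * indicator {A0..A0+2} A \<partial>lborel) \<partial>lborel)"
    by (subst nn_integral_multc) auto
  also have "\<dots> = (\<integral>\<^sup>+u. (\<integral>\<^sup>+A. F (A, u powr k + (A - u) powr k) * indicator {2..6} u * indicator {A0..A0+2} A \<partial>lborel) \<partial>lborel)"
    by (rule lborel_pair.Fubini') measurable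
  also have "\<dots> = (\<integral>\<^sup>+u. (\<integral>\<^sup>+v. F (u + v, u powr k + v powr k) * indicator {2..6} u * indicator {A0..A0+2} (u + v) \<partial>lborel) \<partial>lborel)"
  proof (rule nn_integral_cong)
    fix u :: real
    show "(\<integral>\<^sup>+A. F (A, u powr k + (A - u) powr k) * indicator {2..6} u * indicator {A0..A0+2} A \<partial>lborel)
      = (\<integral>\<^sup>+v. F (u + v, u powr k + v powr k) * indicator {2..6} u * indicator {A0..A0+2} (u + v) \<partial>lborel)"
      by (subst nn_integral_real_affine[where c=1 and t=u]) auto
  qed
  \<comment> \<open>If u is in [2, 6] and u + v in [A0, A0 + 2], then v is in [A0 - 6, A0].\<close>
  also have "\<dots> \<le> (\<integral>\<^sup>+u. (\<integral>\<^sup>+v. F (u + v, u powr k + v powr k) * indicator {A0-6..A0} v * indicator {2..6} u \<partial>lborel) \<partial>lborel)"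
    by (intro nn_integral_mono) (auto simp: indicator_def)
  also have "\<dots> = (\<integral>\<^sup>+u. (\<integral>\<^sup>+v. F (u + v, u powr k + v powr k) * indicator {A0-6..A0} v \<partial>lborel) * indicator {2..6} u \<partial>lborel)"
    by (subst nn_integral_multc) auto
  finally show ?thesis .
qed

lemma emeasure_affine_image_coords:
  fixes E :: "(real \<times> real) set"
  assumes [measurable]: "E \<in> sets borel" and "a \<noteq> 0" "b \<noteq> 0"
  shows "emeasure lborel E = ennreal (\<bar>a\<bar> * \<bar>b\<bar>) *
    (\<integral>\<^sup>+A. \<integral>\<^sup>+w. indicator E (c + a * A, d + b * w) \<partial>lborel \<partial>lborel)"
proof -
  have [measurable]: "E \<in> sets (borel \<Otimes>\<^sub>M borel)" by (subst borel_prod) fact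
  have "emeasure lborel E = emeasure (lborel \<Otimes>\<^sub>M lborel) E" by (simp add: lborel_prod)
  also have "\<dots> = (\<integral>\<^sup>+z. indicator E z \<partial>(lborel \<Otimes>\<^sub>M lborel))" by simp
  also have "\<dots> = (\<integral>\<^sup>+x. \<integral>\<^sup>+y. indicator E (x, y) \<partial>lborel \<partial>lborel)"
    by (subst lborel.nn_integral_fst[symmetric]) auto
  also have "\<dots> = (\<integral>\<^sup>+x. ennreal \<bar>b\<bar> * (\<integral>\<^sup>+w. indicator E (x, d + b * w) \<partial>lborel) \<partial>lborel)"
  proof (rule nn_integral_cong)
    show "(\<integral>\<^sup>+y. indicator E (x, y) \<partial>lborel) = ennreal \<bar>b\<bar> * (\<integral>\<^sup>+w. indicator E (x, d + b * w) \<partial>lborel)" for x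
      by (rule nn_integral_real_affine) (use assms in auto)
  qed
  also have "\<dots> = ennreal \<bar>b\<bar> * (\<integral>\<^sup>+x. (\<integral>\<^sup>+w. indicator E (x, d + b * w) \<partial>lborel) \<partial>lborel)"
    by (rule nn_integral_cmult) measurable
  also have "(\<integral>\<^sup>+x. (\<integral>\<^sup>+w. indicator E (x, d + b * w) \<partial>lborel) \<partial>lborel) =
     ennreal \<bar>a\<bar> * (\<integral>\<^sup>+A. (\<integral>\<^sup>+w. indicator E (c + a * A, d + b * w) \<partial>lborel) \<partial>lborel)"
    by (rule nn_integral_real_affine) (use assms in \<open>measurable\<close>)
  finally show ?thesis by (simp add: ennreal_mult mult_ac)
qed

text \<open>With t^\<beta>1 = L^\<beta>1 u and s^\<beta>1 = L^\<beta>1 v, the two steps add up to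
  the point (u + v, u^k + v^k) in units of L^\<beta>1 and L^\<beta>2, up to the signs
  \<open>e1\<close>, \<open>e2\<close>. The kernel thus dominates Lebesgue measure in these units,
  which bounds its integral over \<open>E\<close> below by a multiple of the normalized area,
  uniformly in L.\<close>

lemma curve_sum_kernel_ge:
  fixes \<gamma> :: "real \<Rightarrow> real \<times> real" and h :: "real \<times> real \<Rightarrow> real"
  assumes [measurable]: "\<gamma> \<in> borel_measurable borel" and b1: "0 < \<beta>1" and b12: "\<beta>1 < \<beta>2"
    and \<gamma>: "\<And>t. 0 < t \<Longrightarrow> \<gamma> t = (e1 * t powr \<beta>1, e2 * t powr \<beta>2)"
    and e: "\<bar>e1\<bar> = 1" "\<bar>e2\<bar> = 1"
    and A0: "12 \<le> A0"
    and k: "k = \<beta>2 / \<beta>1"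
    and spread: "(A0 - 4) powr k + 6 powr k + 2 \<le> 2 powr k + (A0 - 2) powr k"
    and B0: "B0 = (A0 - 4) powr k + 6 powr k"
    and L: "0 < L" and D: "A0 \<le> D powr \<beta>1" "1 \<le> D"
    and [measurable]: "h \<in> borel_measurable borel" "E \<in> sets borel"
    and h01: "\<And>y. h y \<in> {0..1}"
    and h: "\<And>u. u \<in> {2..6} \<Longrightarrow> h (x - (e1 * (L powr \<beta>1 * u), e2 * (L powr \<beta>2 * u powr k))) = 1"
    and E1: "\<And>z. z \<in> E \<Longrightarrow> e1 * (fst x - fst z) \<in> {L powr \<beta>1 * A0..L powr \<beta>1 * (A0 + 2)}"
    and E2: "\<And>z. z \<in> E \<Longrightarrow> e2 * (snd x - snd z) \<in> {L powr \<beta>2 * B0..L powr \<beta>2 * (B0 + 2)}"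
  shows "1 / (\<beta>1 * 6) * (1 / (\<beta>1 * A0)) * (1 / (k * (A0 + 2) powr (k - 1))) * (measure lborel E / (L powr \<beta>1 * L powr \<beta>2))
     \<le> (LINT t|log_measure L (D * L). LINT s|log_measure L (D * L).
          h (x - \<gamma> t) * indicator E (x - \<gamma> t - \<gamma> s))"
proof -
  define M where "M = log_measure L (D * L)"
  have [measurable_cong, simp]: "sets M = sets borel" by (simp add: M_def)
  have LD: "L \<le> D * L" using L D by simp
  interpret M: finite_measure M unfolding M_def by (rule finite_measure_log_measure[OF L LD])
  have b2: "0 < \<beta>2" and k1: "1 < k" using b1 b12 by (auto simp: k)
  define l1 where "l1 = L powr \<beta>1"
  define l2 where "l2 = L powr \<beta>2"
  have l: "0 < l1" "0 < l2" using L by (auto simp: l1_def l2_def)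
  have l1k: "l1 powr k = l2" using b1 by (simp add: l1_def l2_def powr_powr k)
  \<comment> \<open>\<open>c1\<close> and \<open>c2\<close> are the densities of dt/t at the far
    ends u = 6 and v = A0, and \<open>c3\<close> is the reciprocal of the bound for the
    Jacobian.\<close>
  define c1 where "c1 = 1 / (\<beta>1 * 6)"
  define c2 where "c2 = 1 / (\<beta>1 * A0)"
  define c3 where "c3 = 1 / (k * (A0 + 2) powr (k - 1))"
  have c: "0 < c1" "0 < c2" "0 < c3" using b1 A0 k1 by (auto simp: c1_def c2_def c3_def)
  define G where "G u = (l1 * u) powr (1 / \<beta>1)" for u
  have \<gamma>G: "\<gamma> (G u) = (e1 * (l1 * u), e2 * (l2 * u powr k))" if "0 < u" for u
  proof -
    have "(G u) powr \<beta>1 = l1 * u" using that l b1 by (simp add: G_def powr_powr)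
    moreover have "(G u) powr \<beta>2 = l2 * u powr k"
      using that l b1 by (simp add: G_def powr_powr powr_mult l1k flip: k)
    ultimately show ?thesis using \<gamma>[of "G u"] that l by (simp add: G_def)
  qed
  have Glo: "L \<le> G u" if "1 \<le> u" for u
  proof -
    have "L = l1 powr (1 / \<beta>1)" using b1 L by (simp add: l1_def powr_powr)
    also have "\<dots> \<le> G u" unfolding G_def using l that b1 by (intro powr_mono2) auto
    finally show ?thesis .
  qed
  have Gup: "G u \<le> D * L" if "0 \<le> u" "u \<le> A0" for u
  proof -
    have "G u \<le> (l1 * D powr \<beta>1) powr (1 / \<beta>1)" unfolding G_def
      using l that b1 D by (intro powr_mono2) (auto intro: mult_left_mono)
    also have "\<dots> = D * L" using b1 L D by (simp add: l1_def powr_powr powr_mult)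
    finally show ?thesis .
  qed
  define H where "H t s = h (x - \<gamma> t) * indicator E (x - \<gamma> t - \<gamma> s)" for t s
  have H01: "0 \<le> H t s" "H t s \<le> 1" for t s using h01[of "x - \<gamma> t"] by (auto simp: H_def indicator_def)
  have [measurable]: "(\<lambda>(t, s). H t s) \<in> borel_measurable (borel \<Otimes>\<^sub>M borel)"
    unfolding H_def by measurable
  have intH: "integrable M (H t)" for t
    by (rule M.integrable_const_bound[of _ 1]) (use H01 in \<open>auto simp: H_def\<close>)
  define K where "K t = (LINT s|M. H t s)" for t
  have [measurable]: "K \<in> borel_measurable borel" unfolding K_def by measurable
  have K0: "0 \<le> K t" for t unfolding K_def by (intro integral_nonneg_AE) (use H01 in auto)
  have spM: "space M = UNIV" by (simp add: M_def)
  have K1: "K t \<le> measure M UNIV" for t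
  proof -
    have "K t \<le> (LINT s|M. 1)" unfolding K_def by (intro integral_mono intH) (use H01 in auto)
    then show ?thesis by (simp add: spM)
  qed
  have intK: "integrable M K"
    by (rule M.integrable_const_bound[of _ "measure M UNIV"]) (use K0 K1 in auto)
  define X where "X A w = (indicator E (fst x - e1 * l1 * A, snd x - e2 * l2 * w) :: ennreal)" for A w
  have [measurable]: "(\<lambda>(A, w). X A w) \<in> borel_measurable (borel \<Otimes>\<^sub>M borel)"
    unfolding X_def by measurable
  \<comment> \<open>In normalized coordinates \<open>E\<close> lies in the square covered by the
    sweep, so inserting both cutoffs loses nothing.\<close>
  have X0: "X A w = X A w * indicator {B0..B0+2} w * indicator {A0..A0+2} A" for A w
  proof (cases "(fst x - e1 * l1 * A, snd x - e2 * l2 * w) \<in> E")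
    case True
    have ee: "e1 * (e1 * y) = y" "e2 * (e2 * y) = y" for y using e by (auto simp: abs_if split: if_splits)
    from E1[OF True] have "A \<in> {A0..A0+2}" using l unfolding l1_def[symmetric] by (simp add: ee mult.assoc)
    moreover from E2[OF True] have "w \<in> {B0..B0+2}" using l unfolding l2_def[symmetric] by (simp add: ee mult.assoc)
    ultimately show ?thesis by simp
  qed (simp add: X_def)
  have mE: "emeasure lborel E = ennreal (l1 * l2) * (\<integral>\<^sup>+A. \<integral>\<^sup>+w. X A w \<partial>lborel \<partial>lborel)"
    using emeasure_affine_image_coords[of E "- e1 * l1" "- e2 * l2" "fst x" "snd x"] e l
    by (simp add: X_def abs_mult)
  have XX: "(\<integral>\<^sup>+A. \<integral>\<^sup>+w. X A w \<partial>lborel \<partial>lborel) =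
     (\<integral>\<^sup>+A. (\<integral>\<^sup>+w. X A w * indicator {B0..B0+2} w \<partial>lborel) * indicator {A0..A0+2} A \<partial>lborel)"
    by (subst X0, subst nn_integral_multc) auto
  have inner: "ennreal c2 * (\<integral>\<^sup>+v. X (u + v) (u powr k + v powr k) * indicator {A0-6..A0} v \<partial>lborel)
     \<le> (\<integral>\<^sup>+s. ennreal (H (G u) s) \<partial>M)" if u: "u \<in> {2..6}" for u
  proof -
    have "(\<integral>\<^sup>+v. X (u + v) (u powr k + v powr k) * indicator {A0-6..A0} v \<partial>lborel)
      = (\<integral>\<^sup>+v. ennreal (H (G u) (G v)) * indicator {A0-6..A0} v \<partial>lborel)"
    proof (rule nn_integral_cong)
      fix v
      show "X (u + v) (u powr k + v powr k) * indicator {A0-6..A0} v = ennreal (H (G u) (G v)) * indicator {A0-6..A0} v"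
      proof (cases "v \<in> {A0-6..A0}")
        case True
        then have "0 < u" "0 < v" using u A0 by auto
        moreover have "h (x - \<gamma> (G u)) = 1" using h[OF u] \<gamma>G[of u] u by (simp add: l1_def l2_def)
        ultimately show ?thesis
          by (simp add: H_def X_def \<gamma>G minus_prod_def algebra_simps indicator_def)
      qed simp
    qed
    then show ?thesis
      unfolding c2_def G_def M_def
      using nn_integral_log_measure_ge[of "\<lambda>s. ennreal (H (G u) s)" \<beta>1 l1 "A0 - 6" A0 L "D * L"]
        Glo[of "A0 - 6"] Gup[of A0] b1 l A0 L
      by (simp add: G_def)
  qed
  have "ennreal (c1 * c2 * c3 * (measure lborel E / (l1 * l2))) \<le> ennreal (c1 * c2 * c3) * (\<integral>\<^sup>+A. \<integral>\<^sup>+w. X A w \<partial>lborel \<partial>lborel)"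
  \<comment> \<open>For a set of infinite area \<open>measure\<close> returns 0 and the bound is
    trivial.\<close>
  proof (cases "emeasure lborel E = \<infinity>")
    case True
    then show ?thesis by (simp add: measure_def)
  next
    case False
    then have "emeasure lborel E = ennreal (measure lborel E)"
      by (intro emeasure_eq_ennreal_measure) auto
    with mE have "ennreal (measure lborel E) = ennreal (l1 * l2) * (\<integral>\<^sup>+A. \<integral>\<^sup>+w. X A w \<partial>lborel \<partial>lborel)"
      by metis
    then have "ennreal (1 / (l1 * l2)) * ennreal (measure lborel E) = (ennreal (1 / (l1 * l2)) * ennreal (l1 * l2)) * (\<integral>\<^sup>+A. \<integral>\<^sup>+w. X A w \<partial>lborel \<partial>lborel)"
      by (simp add: mult.assoc)
    also have "ennreal (1 / (l1 * l2)) * ennreal (l1 * l2) = 1"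
      using l by (simp flip: ennreal_mult')
    finally have "ennreal (measure lborel E / (l1 * l2)) = (\<integral>\<^sup>+A. \<integral>\<^sup>+w. X A w \<partial>lborel \<partial>lborel)"
      using l by (simp flip: ennreal_mult')
    moreover have "ennreal (c1 * c2 * c3 * (measure lborel E / (l1 * l2))) =
        ennreal (c1 * c2 * c3) * ennreal (measure lborel E / (l1 * l2))"
      using c by (intro ennreal_mult') auto
    ultimately show ?thesis by simp
  qed
  also have "\<dots> = ennreal c1 * (ennreal c2 * (ennreal c3 * (\<integral>\<^sup>+A. (\<integral>\<^sup>+w. X A w * indicator {B0..B0+2} w \<partial>lborel) * indicator {A0..A0+2} A \<partial>lborel)))"
    unfolding XX using c by (simp add: ennreal_mult mult.assoc)
  also have "\<dots> \<le> ennreal c1 * (ennreal c2 * (\<integral>\<^sup>+u. (\<integral>\<^sup>+v. X (u + v) (u powr k + v powr k) * indicator {A0-6..A0} v \<partial>lborel) * indicator {2..6} u \<partial>lborel))"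
    using nn_integral_curve_sum_ge[of "\<lambda>(A, w). X A w" k A0] k1 A0 spread
    unfolding c3_def B0
    by (intro mult_left_mono) (auto simp flip: borel_prod)
  also have "\<dots> = ennreal c1 * (\<integral>\<^sup>+u. ennreal c2 * ((\<integral>\<^sup>+v. X (u + v) (u powr k + v powr k) * indicator {A0-6..A0} v \<partial>lborel) * indicator {2..6} u) \<partial>lborel)"
    by (subst nn_integral_cmult) auto
  also have "\<dots> \<le> ennreal c1 * (\<integral>\<^sup>+u. (\<integral>\<^sup>+s. ennreal (H (G u) s) \<partial>M) * indicator {2..6} u \<partial>lborel)"
    using inner by (intro mult_left_mono nn_integral_mono) (auto simp: indicator_def)
  also have "\<dots> \<le> (\<integral>\<^sup>+t. (\<integral>\<^sup>+s. ennreal (H t s) \<partial>M) \<partial>M)"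
    unfolding c1_def M_def G_def
    using Glo[of 2] Gup[of 6] b1 l A0 L
    by (intro nn_integral_log_measure_ge) (auto simp: G_def M_def[symmetric])
  also have "\<dots> = (\<integral>\<^sup>+t. ennreal (K t) \<partial>M)"
    unfolding K_def using intH H01 by (intro nn_integral_cong nn_integral_eq_integral) auto
  also have "\<dots> = ennreal (LINT t|M. K t)"
    using intK K0 by (intro nn_integral_eq_integral) auto
  finally have "c1 * c2 * c3 * (measure lborel E / (l1 * l2)) \<le> (LINT t|M. K t)"
    using K0 by (subst (asm) ennreal_le_iff) (auto intro!: integral_nonneg_AE)
  then show ?thesis
    unfolding K_def H_def M_def c1_def c2_def c3_def l1_def l2_def .
qed


section \<open>Medians and boxes\<close>

text \<open>A median is the infimum of the points where the distribution function reaches half of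
  the mass. Continuity from the right at this point gives the first inequality, the limit from the
  left the second.\<close>

lemma finite_borel_measure_median:
  assumes "finite_measure N" and sN: "sets N = sets (borel :: real measure)"
  shows "\<exists>m. measure N UNIV / 2 \<le> measure N {..m} \<and> measure N UNIV / 2 \<le> measure N {m..}"
proof (cases "measure N UNIV = 0")
  case True
  then show ?thesis by simp
next
  case False
  interpret finite_measure N by fact
  have meas[simp]: "{..a} \<in> sets N" "{..<a} \<in> sets N" "{a..} \<in> sets N" "UNIV \<in> sets N" for a
    by (simp_all add: sN)
  define F where "F a = measure N {..a}" for a
  define h where "h = measure N UNIV / 2"
  have h: "0 < h" using False by (simp add: h_def zero_less_measure_iff)
  have mono: "F a \<le> F b" if "a \<le> b" for a b
    unfolding F_def by (rule finite_measure_mono) (use that in auto)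
  define S where "S = {a. h \<le> F a}"
  have "(\<lambda>n. measure N {..real n}) \<longlonglongrightarrow> measure N (\<Union>n. {..real n})"
    by (rule finite_Lim_measure_incseq) (auto simp: incseq_def)
  moreover have "(\<Union>n. {..real n}) = UNIV" by (auto intro: real_arch_simple)
  ultimately have "(\<lambda>n. F (real n)) \<longlonglongrightarrow> measure N UNIV" by (simp add: F_def)
  then have "eventually (\<lambda>n. h < F (real n)) sequentially"
    by (rule order_tendstoD) (use h in \<open>simp add: h_def\<close>)
  then obtain n where "h < F (real n)" by (auto simp: eventually_sequentially)
  then have S: "S \<noteq> {}" by (auto simp: S_def intro: less_imp_le)
  have "(\<lambda>n. measure N {..- real n}) \<longlonglongrightarrow> measure N (\<Inter>n. {..- real n})"
    by (rule finite_Lim_measure_decseq) (auto simp: decseq_def)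
  moreover have "(\<Inter>n. {..- real n}) = {}"
  proof -
    have "\<exists>n. \<not> x \<le> - real n" for x
      using reals_Archimedean2[of "- x"] by (metis linorder_not_le minus_less_iff)
    then show ?thesis by auto
  qed
  ultimately have "(\<lambda>n. F (- real n)) \<longlonglongrightarrow> 0" by (simp add: F_def)
  then have "eventually (\<lambda>n. F (- real n) < h) sequentially"
    by (rule order_tendstoD) (use h in simp)
  then obtain n' where n': "F (- real n') < h" by (auto simp: eventually_sequentially)
  have "- real n' \<le> a" if "a \<in> S" for a
    using that n' mono[of a "- real n'"] unfolding S_def by fastforce
  then have bdd: "bdd_below S" by (auto simp: bdd_below_def)
  define m where "m = Inf S"
  have inS: "h \<le> F a" if "m < a" for a
  proof -
    have "\<exists>s\<in>S. s < a" using cInf_less_iff[OF S bdd, of a] that by (simp add: m_def)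
    then obtain s where "s \<in> S" "s < a" by blast
    then show ?thesis using mono[of s a] by (simp add: S_def)
  qed
  have notS: "F a \<le> h" if "a < m" for a
  proof (rule ccontr)
    assume "\<not> F a \<le> h"
    then have "a \<in> S" by (simp add: S_def)
    then have "m \<le> a" unfolding m_def using bdd by (rule cInf_lower)
    with that show False by simp
  qed
  have "(\<lambda>n. measure N {..m + 1 / real (Suc n)}) \<longlonglongrightarrow> measure N (\<Inter>n. {..m + 1 / real (Suc n)})"
    by (rule finite_Lim_measure_decseq) (auto simp: decseq_def field_simps)
  moreover have "(\<Inter>n. {..m + 1 / real (Suc n)}) = {..m}"
  proof (intro set_eqI iffI)
    fix x assume "x \<in> (\<Inter>n. {..m + 1 / real (Suc n)})"
    then have *: "x \<le> m + 1 / real (Suc n)" for n by auto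
    show "x \<in> {..m}"
    proof (rule ccontr)
      assume "x \<notin> {..m}"
      then obtain n where "1 / real (Suc n) < x - m" using nat_approx_posE[of "x - m"] by auto
      with *[of n] show False by simp
    qed
  next
    fix x assume "x \<in> {..m}"
    then show "x \<in> (\<Inter>n. {..m + 1 / real (Suc n)})"
      by (auto intro: order_trans[of x m])
  qed
  ultimately have "(\<lambda>n. F (m + 1 / real (Suc n))) \<longlonglongrightarrow> F m" by (simp add: F_def)
  then have 1: "h \<le> F m"
    by (rule LIMSEQ_le_const) (use inS in auto)
  have "(\<lambda>n. measure N {..m - 1 / real (Suc n)}) \<longlonglongrightarrow> measure N (\<Union>n. {..m - 1 / real (Suc n)})"
    by (rule finite_Lim_measure_incseq) (auto simp: incseq_def field_simps)
  moreover have "(\<Union>n. {..m - 1 / real (Suc n)}) = {..<m}"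
  proof (intro set_eqI iffI)
    fix x assume "x \<in> {..<m}"
    then obtain n where "1 / real (Suc n) < m - x" using nat_approx_posE[of "m - x"] by auto
    then show "x \<in> (\<Union>n. {..m - 1 / real (Suc n)})" by (intro UN_I[of n]) auto
  next
    fix x assume "x \<in> (\<Union>n. {..m - 1 / real (Suc n)})"
    then obtain n where "x \<le> m - 1 / real (Suc n)" by auto
    moreover have "0 < 1 / real (Suc n)" by simp
    ultimately show "x \<in> {..<m}" unfolding lessThan_iff by linarith
  qed
  ultimately have "(\<lambda>n. F (m - 1 / real (Suc n))) \<longlonglongrightarrow> measure N {..<m}" by (simp add: F_def)
  then have "measure N {..<m} \<le> h"
    by (rule LIMSEQ_le_const2) (use notS in auto)
  moreover have "measure N {m..} = measure N UNIV - measure N {..<m}"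
  proof -
    have "{m..} = UNIV - {..<m}" by auto
    then show ?thesis by (simp add: finite_measure_Diff)
  qed
  ultimately have 2: "h \<le> measure N {m..}" by (simp add: h_def)
  show ?thesis using 1 2 by (auto simp: F_def h_def)
qed

lemma median_on:
  fixes b :: "'a \<Rightarrow> real"
  assumes [measurable]: "b \<in> borel_measurable M" "R \<in> sets M" and fin: "emeasure M R \<noteq> \<infinity>"
  shows "\<exists>m. measure M R / 2 \<le> measure M {x\<in>R. b x \<le> m} \<and> measure M R / 2 \<le> measure M {x\<in>R. m \<le> b x}"
proof -
  have sub: "R \<subseteq> space M" by (rule sets.sets_into_space) fact
  define N where "N = distr (restrict_space M R) borel b"
  have bR: "b \<in> restrict_space M R \<rightarrow>\<^sub>M borel" by (rule measurable_restrict_space1) simp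
  have spR: "space (restrict_space M R) = R" using sub by (auto simp: space_restrict_space)
  have finR: "finite_measure (restrict_space M R)"
    by (intro finite_measureI) (use fin sub in \<open>simp add: spR emeasure_restrict_space\<close>)
  then interpret RR: finite_measure "restrict_space M R" .
  have "finite_measure N" unfolding N_def by (rule RR.finite_measure_distr[OF bR])
  moreover have "sets N = sets borel" by (simp add: N_def)
  moreover have mN: "measure N A = measure M {x\<in>R. b x \<in> A}" if "A \<in> sets borel" for A
  proof -
    have "measure N A = measure (restrict_space M R) (b -` A \<inter> R)"
      unfolding N_def by (subst measure_distr[OF bR that]) (simp add: spR)
    also have "\<dots> = measure M (b -` A \<inter> R)"
      by (rule measure_restrict_space) (use sub in auto)
    also have "b -` A \<inter> R = {x\<in>R. b x \<in> A}" by auto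
    finally show ?thesis .
  qed
  ultimately show ?thesis
    using finite_borel_measure_median[of N] mN[of UNIV] mN[of "{..m}" for m] mN[of "{m..}" for m] by auto
qed

text \<open>The \<gamma>-cubes parametrized by centre and side length l(Q) = L; a dilate is then
  \<open>gbox \<beta> c (N * L)\<close>, again a \<gamma>-cube.\<close>

definition gbox :: "real \<times> real \<Rightarrow> real \<times> real \<Rightarrow> real \<Rightarrow> (real \<times> real) set" where
  "gbox \<beta> c L = {fst c - L powr fst \<beta> / 2..fst c + L powr fst \<beta> / 2} \<times>
                {snd c - L powr snd \<beta> / 2..snd c + L powr snd \<beta> / 2}"

lemma mem_gbox: "x \<in> gbox \<beta> c L \<longleftrightarrow>
    \<bar>fst x - fst c\<bar> \<le> L powr fst \<beta> / 2 \<and> \<bar>snd x - snd c\<bar> \<le> L powr snd \<beta> / 2"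
  by (cases x) (auto simp: gbox_def abs_if)

lemma gbox_eq_cbox: "gbox \<beta> c L =
    cbox (fst c - L powr fst \<beta> / 2, snd c - L powr snd \<beta> / 2) (fst c + L powr fst \<beta> / 2, snd c + L powr snd \<beta> / 2)"
  by (simp add: gbox_def cbox_Pair_eq)

lemma compact_gbox [simp]: "compact (gbox \<beta> c L)"
  and gbox_borel [measurable, simp]: "gbox \<beta> c L \<in> sets borel"
  by (simp_all add: gbox_eq_cbox)

lemma measure_real_rectangle:
  fixes a b c d :: real
  assumes "a \<le> b" "c \<le> d"
  shows "measure lborel ({a..b} \<times> {c..d}) = (b - a) * (d - c)"
  using content_Pair[of a c b d] assms by (simp add: cbox_Pair_eq)

lemma measure_gbox: "0 < L \<Longrightarrow> measure lborel (gbox \<beta> c L) = L powr fst \<beta> * L powr snd \<beta>"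
  unfolding gbox_def by (subst measure_real_rectangle) auto

section \<open>Signs, branches of the curve and separated test functions\<close>

lemma signed_interval:
  fixes e c a b :: real
  assumes "\<bar>e\<bar> = 1"
  shows "{y. e * (c - y) \<in> {a..b}} = (if e = 1 then {c - b..c - a} else {c + a..c + b})"
  using assms by (auto simp: abs_if split: if_splits)

lemma monomial_curve_measurable:
  assumes "is_monomial_curve \<beta> \<gamma>"
  shows "\<gamma> \<in> borel_measurable borel"
  using assms unfolding is_monomial_curve_def by (auto simp: split_beta)

text \<open>For signs, \<epsilon> and \<delta> being different means that their product is -1 in
  some coordinate; in this form the hypothesis separates the two branches.\<close>

lemma monomial_curveE:
  assumes "is_monomial_curve \<beta> \<gamma>"
  obtains e1 e2 d1 d2 :: real where "0 < fst \<beta>" "fst \<beta> < snd \<beta>" "\<bar>e1\<bar> = 1" "\<bar>e2\<bar> = 1" "\<bar>d1\<bar> = 1" "\<bar>d2\<bar> = 1"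
    "e1 * d1 = -1 \<or> e2 * d2 = -1"
    "\<And>t. 0 < t \<Longrightarrow> \<gamma> t = (e1 * t powr fst \<beta>, e2 * t powr snd \<beta>)"
    "\<And>t. t \<le> 0 \<Longrightarrow> \<gamma> t = (d1 * \<bar>t\<bar> powr fst \<beta>, d2 * \<bar>t\<bar> powr snd \<beta>)"
proof -
  from assms obtain \<epsilon> \<delta> :: "real \<times> real" where "\<epsilon> \<in> {-1, 1} \<times> {-1, 1}" "\<delta> \<in> {-1, 1} \<times> {-1, 1}" "\<epsilon> \<noteq> \<delta>"
    and g: "\<gamma> = (\<lambda>t. if 0 < t
                then (fst \<epsilon> * \<bar>t\<bar> powr fst \<beta>, snd \<epsilon> * \<bar>t\<bar> powr snd \<beta>)
                else (fst \<delta> * \<bar>t\<bar> powr fst \<beta>, snd \<delta> * \<bar>t\<bar> powr snd \<beta>))"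
    and "0 < fst \<beta>" "fst \<beta> < snd \<beta>"
    unfolding is_monomial_curve_def by blast
  then show ?thesis
    by (intro that[of "fst \<epsilon>" "snd \<epsilon>" "fst \<delta>" "snd \<delta>"]) (auto simp: prod_eq_iff)
qed

text \<open>The last clause says that the curve joins the support of \<open>g\<close> to that of
  \<open>f\<close> with parameters in [L, D L] only. It removes the singularity of dt/t and the
  branch t <= 0 from the pairing.\<close>

definition test_pair ::
    "real \<times> real \<Rightarrow> (real \<Rightarrow> real \<times> real) \<Rightarrow> real \<Rightarrow> real \<Rightarrow> real \<times> real \<Rightarrow> real \<Rightarrow>
      (real \<times> real \<Rightarrow> real) \<Rightarrow> (real \<times> real \<Rightarrow> real) \<Rightarrow> bool" where
  "test_pair \<beta> \<gamma> N D c L f g \<longleftrightarrow>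
     f \<in> borel_measurable borel \<and> g \<in> borel_measurable borel \<and>
     (\<forall>x. \<bar>f x\<bar> \<le> D) \<and> (\<forall>x. \<bar>g x\<bar> \<le> D) \<and>
     (\<forall>x. f x \<noteq> 0 \<longrightarrow> x \<in> gbox \<beta> c (N * L)) \<and> (\<forall>x. g x \<noteq> 0 \<longrightarrow> x \<in> gbox \<beta> c (N * L)) \<and>
     (\<forall>x t. g x \<noteq> 0 \<longrightarrow> f (x - \<gamma> t) \<noteq> 0 \<longrightarrow> L \<le> t \<and> t \<le> D * L)"

text \<open>This allows a locally integrable \<open>b\<close> to be cut off outside a box, as the
  composition lemma wants an integrable one.\<close>

lemma comm_form_cong_support:
  assumes "\<And>x. g x \<noteq> 0 \<Longrightarrow> b x = b' x" "\<And>x. f x \<noteq> 0 \<Longrightarrow> b x = b' x"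
  shows "comm_form M \<gamma> b f g = comm_form M \<gamma> b' f g"
  unfolding comm_form_def
proof (rule Bochner_Integration.integral_cong[OF refl])
  fix x
  show "g x * (LINT t|M. f (x - \<gamma> t) * (b x - b (x - \<gamma> t))) = g x * (LINT t|M. f (x - \<gamma> t) * (b' x - b' (x - \<gamma> t)))"
  proof (cases "g x = 0")
    case False
    have "(\<lambda>t. f (x - \<gamma> t) * (b x - b (x - \<gamma> t))) = (\<lambda>t. f (x - \<gamma> t) * (b' x - b' (x - \<gamma> t)))"
      using assms(1)[OF False] assms(2) by (auto simp: fun_eq_iff)
    then show ?thesis by simp
  qed simp
qed

lemma comm_form_uminus: "comm_form M \<gamma> (\<lambda>x. - b x) f g = - comm_form M \<gamma> b f g"
proof -
  have eq: "f (x - \<gamma> t) * (- b x - - b (x - \<gamma> t)) = - (f (x - \<gamma> t) * (b x - b (x - \<gamma> t)))" for x t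
    by (simp add: algebra_simps)
  show ?thesis unfolding comm_form_def eq by simp
qed


section \<open>Lower bounds for the commutator form\<close>

text \<open>The crude bound (D L - L)/L for the mass of dt/t on [L, D L] is already free of
  L.\<close>

lemma log_average_bounds:
  fixes E :: "(real \<times> real) set"
  assumes "0 < L" "1 \<le> D" and [measurable]: "E \<in> sets borel" "\<sigma> \<in> borel_measurable borel"
  shows "0 \<le> (LINT t|log_measure L (D * L). indicator E (\<sigma> t) :: real)"
    and "(LINT t|log_measure L (D * L). indicator E (\<sigma> t) :: real) \<le> D"
proof -
  have LD: "L \<le> D * L" using assms by simp
  interpret finite_measure "log_measure L (D * L)"
    by (rule finite_measure_log_measure[OF \<open>0 < L\<close> LD])
  show "0 \<le> (LINT t|log_measure L (D * L). indicator E (\<sigma> t) :: real)"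
    by (intro integral_nonneg_AE) auto
  have "(LINT t|log_measure L (D * L). indicator E (\<sigma> t) :: real) \<le> (LINT t|log_measure L (D * L). 1)"
    by (intro integral_mono integrable_const_bound[of _ 1]) (auto simp: indicator_def)
  also have "\<dots> = measure (log_measure L (D * L)) UNIV" by simp
  also have "\<dots> \<le> (D * L - L) / L" by (rule measure_log_measure_le[OF \<open>0 < L\<close> LD])
  also have "\<dots> \<le> D" using assms by (simp add: field_simps)
  finally show "(LINT t|log_measure L (D * L). indicator E (\<sigma> t) :: real) \<le> D" .
qed

text \<open>On the branch t <= 0 one of the two signed coordinates is nonpositive, so their
  positivity forces t > 0. There the first coordinate alone determines t.\<close>

lemma monomial_curve_parameter_bounds:
  assumes "0 < \<beta>1" and L: "0 < L" and "\<bar>e1\<bar> = 1" "\<bar>e2\<bar> = 1" "\<bar>d1\<bar> = 1" "\<bar>d2\<bar> = (1::real)"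
    and opp: "e1 * d1 = -1 \<or> e2 * d2 = -1"
    and pos: "\<And>t. 0 < t \<Longrightarrow> \<gamma> t = (e1 * t powr \<beta>1, e2 * t powr \<beta>2)"
    and neg: "\<And>t. t \<le> 0 \<Longrightarrow> \<gamma> t = (d1 * \<bar>t\<bar> powr \<beta>1, d2 * \<bar>t\<bar> powr \<beta>2)"
    and 1: "L powr \<beta>1 \<le> e1 * fst (\<gamma> t)" "e1 * fst (\<gamma> t) \<le> A0 * L powr \<beta>1"
    and 2: "0 < e2 * snd (\<gamma> t)"
  shows "L \<le> t \<and> t \<le> A0 powr (1 / \<beta>1) * L"
proof -
  have t: "0 < t"
  proof (rule ccontr)
    assume "\<not> 0 < t"
    then have g: "\<gamma> t = (d1 * \<bar>t\<bar> powr \<beta>1, d2 * \<bar>t\<bar> powr \<beta>2)" by (intro neg) simp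
    have p: "0 < L powr \<beta>1" using L by simp
    from opp show False
    proof
      assume "e1 * d1 = -1"
      then have "e1 * fst (\<gamma> t) = - (\<bar>t\<bar> powr \<beta>1)" by (simp add: g flip: mult.assoc)
      moreover have "0 \<le> \<bar>t\<bar> powr \<beta>1" by simp
      ultimately show False using 1(1) p by linarith
    next
      assume "e2 * d2 = -1"
      then have "e2 * snd (\<gamma> t) = - (\<bar>t\<bar> powr \<beta>2)" by (simp add: g flip: mult.assoc)
      moreover have "0 \<le> \<bar>t\<bar> powr \<beta>2" by simp
      ultimately show False using 2 by linarith
    qed
  qed
  have "e1 * e1 = 1" using assms(3) by (auto simp: abs_if split: if_splits)
  then have e: "e1 * fst (\<gamma> t) = t powr \<beta>1" using pos[OF t] by (simp flip: mult.assoc)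
  have tt: "(t powr \<beta>1) powr (1 / \<beta>1) = t" "(L powr \<beta>1) powr (1 / \<beta>1) = L"
    using t L \<open>0 < \<beta>1\<close> by (simp_all add: powr_powr)
  have p: "0 < L powr \<beta>1" "0 < t powr \<beta>1" using L t by simp_all
  have A0: "0 < A0" using 1(2) p unfolding e by (metis less_le_trans zero_less_mult_pos2)
  have "(L powr \<beta>1) powr (1 / \<beta>1) \<le> (t powr \<beta>1) powr (1 / \<beta>1)"
    by (rule powr_mono2[OF _ _ 1(1)[unfolded e]]) (use \<open>0 < \<beta>1\<close> in auto)
  moreover have "(t powr \<beta>1) powr (1 / \<beta>1) \<le> (A0 * L powr \<beta>1) powr (1 / \<beta>1)"
    by (rule powr_mono2[OF _ _ 1(2)[unfolded e]]) (use \<open>0 < \<beta>1\<close> in auto)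
  moreover have "(A0 * L powr \<beta>1) powr (1 / \<beta>1) = A0 powr (1 / \<beta>1) * L"
    using A0 p by (simp add: powr_mult tt)
  ultimately show ?thesis unfolding tt by metis
qed

lemma signed_bounds:
  fixes e u w :: real
  assumes "\<bar>e\<bar> = 1" "\<bar>u\<bar> \<le> w"
  shows "- w \<le> e * u" "e * u \<le> w"
  using assms by (auto simp: abs_if split: if_splits)

lemma measure_signed_rectangle:
  fixes a b c d e1 e2 c1 c2 :: real
  assumes "\<bar>e1\<bar> = 1" "\<bar>e2\<bar> = 1" "a \<le> b" "c \<le> d"
  shows "{z. e1 * (c1 - fst z) \<in> {a..b} \<and> e2 * (c2 - snd z) \<in> {c..d}} \<in> sets borel"
    and "emeasure lborel {z. e1 * (c1 - fst z) \<in> {a..b} \<and> e2 * (c2 - snd z) \<in> {c..d}} \<noteq> \<infinity>"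
    and "measure lborel {z. e1 * (c1 - fst z) \<in> {a..b} \<and> e2 * (c2 - snd z) \<in> {c..d}} = (b - a) * (d - c)"
proof -
  define a' b' where "a' = (if e1 = 1 then c1 - b else c1 + a)" and "b' = (if e1 = 1 then c1 - a else c1 + b)"
  have 1: "{y. e1 * (c1 - y) \<in> {a..b}} = {a'..b'}" "b' - a' = b - a"
    unfolding signed_interval[OF assms(1)] a'_def b'_def by auto
  define c' d' where "c' = (if e2 = 1 then c2 - d else c2 + c)" and "d' = (if e2 = 1 then c2 - c else c2 + d)"
  have 2: "{y. e2 * (c2 - y) \<in> {c..d}} = {c'..d'}" "d' - c' = d - c"
    unfolding signed_interval[OF assms(2)] c'_def d'_def by auto
  have eq: "{z. e1 * (c1 - fst z) \<in> {a..b} \<and> e2 * (c2 - snd z) \<in> {c..d}} = {a'..b'} \<times> {c'..d'}"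
    unfolding 1(1)[symmetric] 2(1)[symmetric] by auto
  have cb: "{a'..b'} \<times> {c'..d'} = cbox (a', c') (b', d')" by (simp add: cbox_Pair_eq)
  show "{z. e1 * (c1 - fst z) \<in> {a..b} \<and> e2 * (c2 - snd z) \<in> {c..d}} \<in> sets borel"
    unfolding eq cb by simp
  show "emeasure lborel {z. e1 * (c1 - fst z) \<in> {a..b} \<and> e2 * (c2 - snd z) \<in> {c..d}} \<noteq> \<infinity>"
    unfolding eq cb by (simp add: emeasure_lborel_cbox_eq)
  show "measure lborel {z. e1 * (c1 - fst z) \<in> {a..b} \<and> e2 * (c2 - snd z) \<in> {c..d}} = (b - a) * (d - c)"
    unfolding eq using assms 1(2) 2(2) by (subst measure_real_rectangle) auto
qed

text \<open>\<open>R\<close> is fixed before \<open>b\<close> and \<open>m\<close>: later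
  \<open>m\<close> is a median of \<open>b\<close> on \<open>R\<close>, and the same
  \<open>R\<close> has to serve both \<open>b\<close> and -\<open>b\<close>.\<close>

lemma upper_oscillation_le_comm_form:
  assumes curve: "is_monomial_curve \<beta> \<gamma>"
  shows "\<exists>C N D. 0 < C \<and> 1 \<le> N \<and> 1 \<le> D \<and>
    (\<forall>c L. 0 < L \<longrightarrow> (\<exists>R. R \<in> sets borel \<and> emeasure lborel R \<noteq> \<infinity> \<and>
      (\<forall>b m. b \<in> borel_measurable borel \<longrightarrow> set_integrable lborel (gbox \<beta> c (N * L)) b \<longrightarrow>
        measure lborel R / 2 \<le> measure lborel {x\<in>R. b x \<le> m} \<longrightarrow>
        (\<exists>f g. test_pair \<beta> \<gamma> N D c L f g \<and>
          (LINT x:gbox \<beta> c L|lborel. max (b x - m) 0) \<le> C * \<bar>comm_form (log_measure L (D * L)) \<gamma> b f g\<bar>))))"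
proof -
  define \<beta>1 where "\<beta>1 = fst \<beta>"
  define \<beta>2 where "\<beta>2 = snd \<beta>"
  from monomial_curveE[OF curve] obtain e1 e2 d1 d2 :: real where b1: "0 < \<beta>1" and b12: "\<beta>1 < \<beta>2"
    and e: "\<bar>e1\<bar> = 1" "\<bar>e2\<bar> = 1" "\<bar>d1\<bar> = 1" "\<bar>d2\<bar> = 1" and opp: "e1 * d1 = -1 \<or> e2 * d2 = -1"
    and pos: "\<And>t. 0 < t \<Longrightarrow> \<gamma> t = (e1 * t powr \<beta>1, e2 * t powr \<beta>2)"
    and neg: "\<And>t. t \<le> 0 \<Longrightarrow> \<gamma> t = (d1 * \<bar>t\<bar> powr \<beta>1, d2 * \<bar>t\<bar> powr \<beta>2)"
    unfolding \<beta>1_def \<beta>2_def by blast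
  have ee: "e1 * (e1 * y) = y" "e2 * (e2 * y) = y" for y using e by (auto simp: abs_if split: if_splits)
  have \<gamma>m[measurable]: "\<gamma> \<in> borel_measurable borel" by (rule monomial_curve_measurable[OF curve])
  define k where "k = \<beta>2 / \<beta>1"
  have k: "1 < k" using b1 b12 by (simp add: k_def)
  obtain A0 where A0: "12 \<le> A0" and spread: "(A0 - 4) powr k + 6 powr k + 2 \<le> 2 powr k + (A0 - 2) powr k"
    using exists_spread[OF k] by blast
  define B0 where "B0 = (A0 - 4) powr k + 6 powr k"
  have p2: "2 \<le> (2::real) powr k" using powr_mono[of 1 k "2::real"] k by simp
  have p6: "0 < (6::real) powr k" by simp
  have p26: "(2::real) powr k \<le> 6 powr k" using k by (intro powr_mono2) auto
  have pA: "2 \<le> (A0 - 4) powr k"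
    using powr_mono2[of k 2 "A0 - 4"] p2 A0 k by simp
  have b2: "0 < \<beta>2" using b1 b12 by simp
  \<comment> \<open>\<open>D\<close> turns t^\<beta>1 <= A0 L^\<beta>1 into t <= D L.
    \<open>N\<close> is large enough for the half sides of the dilate to reach A0 + 3/2 and B0 + 3/2
    units, the far edges of the box R.\<close>
  define D where "D = A0 powr (1 / \<beta>1)"
  define N where "N = (2 * A0 + 3) powr (1 / \<beta>1) + (2 * B0 + 3) powr (1 / \<beta>2) + 1"
  have D1: "1 \<le> D" using A0 b1 by (simp add: D_def ge_one_powr_ge_zero)
  have Dp: "D powr \<beta>1 = A0" using A0 b1 by (simp add: D_def powr_powr)
  have B0: "0 < B0" "6 powr k \<le> B0 - 2" using pA p6 unfolding B0_def by linarith+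
  have N1: "1 \<le> N" by (simp add: N_def)
  have NA: "2 * A0 + 3 \<le> N powr \<beta>1"
  proof -
    have "2 * A0 + 3 = ((2 * A0 + 3) powr (1 / \<beta>1)) powr \<beta>1" using A0 b1 by (simp add: powr_powr)
    also have "\<dots> \<le> N powr \<beta>1" using b1 by (intro powr_mono2) (auto simp: N_def)
    finally show ?thesis .
  qed
  have NB: "2 * B0 + 3 \<le> N powr \<beta>2"
  proof -
    have "2 * B0 + 3 = ((2 * B0 + 3) powr (1 / \<beta>2)) powr \<beta>2" using B0 b2 by (simp add: powr_powr)
    also have "\<dots> \<le> N powr \<beta>2" using b2 by (intro powr_mono2) (auto simp: N_def)
    finally show ?thesis .
  qed
  \<comment> \<open>The final factor 1/2 is there because {b <= m} fills at least half of R, whose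
    normalized area is 1.\<close>
  define c0 where "c0 = 1 / (\<beta>1 * 6) * (1 / (\<beta>1 * A0)) * (1 / (k * (A0 + 2) powr (k - 1))) / 2"
  have c0: "0 < c0" using b1 A0 k by (simp add: c0_def)
  have main: "\<exists>R. R \<in> sets borel \<and> emeasure lborel R \<noteq> \<infinity> \<and>
      (\<forall>b m. b \<in> borel_measurable borel \<longrightarrow> set_integrable lborel (gbox \<beta> c (N * L)) b \<longrightarrow>
        measure lborel R / 2 \<le> measure lborel {x\<in>R. b x \<le> m} \<longrightarrow>
        (\<exists>f g. test_pair \<beta> \<gamma> N D c L f g \<and>
          (LINT x:gbox \<beta> c L|lborel. max (b x - m) 0) \<le> (2 / c0) * \<bar>comm_form (log_measure L (D * L)) \<gamma> b f g\<bar>))"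
    if L: "0 < L" for c L
  proof -
    define l1 where "l1 = L powr \<beta>1"
    define l2 where "l2 = L powr \<beta>2"
    have l: "0 < l1" "0 < l2" using L by (auto simp: l1_def l2_def)
    define Q where "Q = gbox \<beta> c L"
    define K where "K = gbox \<beta> c (N * L)"
    (* The middle box Y contains x - gamma(t) for x in Q and t^beta1 in [2 l1, 6 l1]. The box R is so
       far from Y, and Y from Q, that the curve joins them only with t between L and D L. *)
    define Y where "Y = {y. e1 * (fst c - fst y) \<in> {3 / 2 * l1..13 / 2 * l1} \<and>
        e2 * (snd c - snd y) \<in> {(2 powr k - 1 / 2) * l2..(6 powr k + 1 / 2) * l2}}"
    define R where "R = {z. e1 * (fst c - fst z) \<in> {(A0 + 1 / 2) * l1..(A0 + 3 / 2) * l1} \<and>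
        e2 * (snd c - snd z) \<in> {(B0 + 1 / 2) * l2..(B0 + 3 / 2) * l2}}"
    have R_le: "(A0 + 1 / 2) * l1 \<le> (A0 + 3 / 2) * l1" "(B0 + 1 / 2) * l2 \<le> (B0 + 3 / 2) * l2"
      using l by (intro mult_right_mono; simp)+
    have Rm[measurable]: "R \<in> sets borel" and Rfin: "emeasure lborel R \<noteq> \<infinity>"
      unfolding R_def by (rule measure_signed_rectangle(1,2)[OF e(1,2) R_le])+
    have "measure lborel R = ((A0 + 3 / 2) * l1 - (A0 + 1 / 2) * l1) * ((B0 + 3 / 2) * l2 - (B0 + 1 / 2) * l2)"
      unfolding R_def by (rule measure_signed_rectangle(3)[OF e(1,2) R_le])
    also have "(A0 + 3 / 2) * l1 - (A0 + 1 / 2) * l1 = l1" by (simp add: algebra_simps)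
    also have "(B0 + 3 / 2) * l2 - (B0 + 1 / 2) * l2 = l2" by (simp add: algebra_simps)
    finally have Rmeas: "measure lborel R = l1 * l2" .
    have Ym[measurable]: "Y \<in> sets borel"
      unfolding Y_def
      by (rule measure_signed_rectangle(1)[OF e(1,2)]; rule mult_right_mono) (use l p26 in auto)
    have Qm[measurable]: "Q \<in> sets borel" and Km[measurable]: "K \<in> sets borel" by (auto simp: Q_def K_def)
    have Qx: "- (l1 / 2) \<le> e1 * (fst x - fst c)" "e1 * (fst x - fst c) \<le> l1 / 2"
        "- (l2 / 2) \<le> e2 * (snd x - snd c)" "e2 * (snd x - snd c) \<le> l2 / 2" if "x \<in> Q" for x
    proof -
      have a: "\<bar>fst x - fst c\<bar> \<le> l1 / 2" "\<bar>snd x - snd c\<bar> \<le> l2 / 2"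
        using that unfolding Q_def mem_gbox l1_def l2_def \<beta>1_def \<beta>2_def by auto
      show "- (l1 / 2) \<le> e1 * (fst x - fst c)" "e1 * (fst x - fst c) \<le> l1 / 2"
        "- (l2 / 2) \<le> e2 * (snd x - snd c)" "e2 * (snd x - snd c) \<le> l2 / 2"
        using signed_bounds[OF e(1) a(1)] signed_bounds[OF e(2) a(2)] by auto
    qed
    have Kx: "x \<in> K" if "\<bar>e1 * (fst c - fst x)\<bar> \<le> (A0 + 3 / 2) * l1" "\<bar>e2 * (snd c - snd x)\<bar> \<le> (B0 + 3 / 2) * l2" for x
    proof -
      have "(N * L) powr \<beta>1 = N powr \<beta>1 * l1" "(N * L) powr \<beta>2 = N powr \<beta>2 * l2"
        using N1 L by (auto simp: powr_mult l1_def l2_def)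
      moreover have "(2 * A0 + 3) * l1 \<le> N powr \<beta>1 * l1" "(2 * B0 + 3) * l2 \<le> N powr \<beta>2 * l2"
        using NA NB l by (auto intro!: mult_right_mono)
      ultimately have "(A0 + 3 / 2) * l1 \<le> (N * L) powr \<beta>1 / 2" "(B0 + 3 / 2) * l2 \<le> (N * L) powr \<beta>2 / 2"
        by (simp_all add: algebra_simps)
      moreover have "\<bar>fst c - fst x\<bar> \<le> (A0 + 3 / 2) * l1" "\<bar>snd c - snd x\<bar> \<le> (B0 + 3 / 2) * l2"
        using that e by (auto simp: abs_mult)
      ultimately show ?thesis unfolding K_def mem_gbox \<beta>1_def \<beta>2_def by (simp add: abs_minus_commute)
    qed
    have QK: "x \<in> K" if "x \<in> Q" for x
    proof (rule Kx)
      have "1 / 2 * l1 \<le> (A0 + 3 / 2) * l1" using A0 l by (intro mult_right_mono) auto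
      then show "\<bar>e1 * (fst c - fst x)\<bar> \<le> (A0 + 3 / 2) * l1" using Qx(1,2)[OF that] by (simp add: algebra_simps abs_le_iff)
      have "1 / 2 * l2 \<le> (B0 + 3 / 2) * l2" using B0 l by (intro mult_right_mono) auto
      then show "\<bar>e2 * (snd c - snd x)\<bar> \<le> (B0 + 3 / 2) * l2" using Qx(3,4)[OF that] by (simp add: algebra_simps abs_le_iff)
    qed
    have YK: "x \<in> K" if "x \<in> Y" for x
    proof (rule Kx)
      have "13 / 2 * l1 \<le> (A0 + 3 / 2) * l1" using A0 l by (intro mult_right_mono) auto
      moreover have "0 \<le> 3 / 2 * l1" using l by simp
      ultimately show "\<bar>e1 * (fst c - fst x)\<bar> \<le> (A0 + 3 / 2) * l1" using that unfolding Y_def by (auto simp: abs_le_iff)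
      have "(6 powr k + 1 / 2) * l2 \<le> (B0 + 3 / 2) * l2" using B0 l by (intro mult_right_mono) auto
      moreover have "0 \<le> (2 powr k - 1 / 2) * l2" using p2 l by (intro mult_nonneg_nonneg) auto
      ultimately show "\<bar>e2 * (snd c - snd x)\<bar> \<le> (B0 + 3 / 2) * l2" using that unfolding Y_def by (auto simp: abs_le_iff)
    qed
    have RK: "x \<in> K" if "x \<in> R" for x
    proof (rule Kx)
      have "0 \<le> (A0 + 1 / 2) * l1" using A0 l by simp
      then show "\<bar>e1 * (fst c - fst x)\<bar> \<le> (A0 + 3 / 2) * l1" using that unfolding R_def by (auto simp: abs_le_iff)
      have "0 \<le> (B0 + 1 / 2) * l2" using B0 l by simp
      then show "\<bar>e2 * (snd c - snd x)\<bar> \<le> (B0 + 3 / 2) * l2" using that unfolding R_def by (auto simp: abs_le_iff)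
    qed
    have sep: "L \<le> t \<and> t \<le> D * L"
      if "l1 \<le> e1 * fst (\<gamma> t)" "e1 * fst (\<gamma> t) \<le> A0 * l1" "0 < e2 * snd (\<gamma> t)" for t
      unfolding D_def
      by (rule monomial_curve_parameter_bounds[OF b1 L e opp pos neg])
         (use that in \<open>auto simp: l1_def\<close>)
    \<comment> \<open>In units of \<open>l1\<close> the first offset lies in [1, 7] from Q to Y and
      in [A0 - 6, A0] from Y to R, both inside [1, A0]. The second offsets are positive as 2^k >= 2
      and B0 >= 6^k + 2.\<close>
    have sepQY: "L \<le> t \<and> t \<le> D * L" if "x \<in> Q" "x - \<gamma> t \<in> Y" for x t
    proof (rule sep)
      have Y: "3 / 2 * l1 \<le> e1 * (fst c - fst x + fst (\<gamma> t))" "e1 * (fst c - fst x + fst (\<gamma> t)) \<le> 13 / 2 * l1"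
        "(2 powr k - 1 / 2) * l2 \<le> e2 * (snd c - snd x + snd (\<gamma> t))"
        using that(2) by (auto simp: Y_def algebra_simps)
      note q = Qx[OF that(1)]
      show "l1 \<le> e1 * fst (\<gamma> t)" using Y(1) q(1) l unfolding ring_distribs by linarith
      have "7 * l1 \<le> A0 * l1" using A0 l by (intro mult_right_mono) auto
      then show "e1 * fst (\<gamma> t) \<le> A0 * l1" using Y(2) q(2) unfolding ring_distribs by linarith
      have "1 * l2 \<le> (2 powr k - 1) * l2" using p2 l by (intro mult_right_mono) auto
      then show "0 < e2 * snd (\<gamma> t)" using Y(3) q(3) l unfolding ring_distribs by linarith
    qed
    have sepYR: "L \<le> t \<and> t \<le> D * L" if "y \<in> Y" "y - \<gamma> t \<in> R" for y t
    proof (rule sep)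
      have Y: "3 / 2 * l1 \<le> e1 * (fst c - fst y)" "e1 * (fst c - fst y) \<le> 13 / 2 * l1"
        "e2 * (snd c - snd y) \<le> (6 powr k + 1 / 2) * l2"
        using that(1) by (auto simp: Y_def algebra_simps)
      have R: "(A0 + 1 / 2) * l1 \<le> e1 * (fst c - fst y + fst (\<gamma> t))" "e1 * (fst c - fst y + fst (\<gamma> t)) \<le> (A0 + 3 / 2) * l1"
        "(B0 + 1 / 2) * l2 \<le> e2 * (snd c - snd y + snd (\<gamma> t))"
        using that(2) by (auto simp: R_def algebra_simps)
      have "7 * l1 \<le> A0 * l1" using A0 l by (intro mult_right_mono) auto
      then show "l1 \<le> e1 * fst (\<gamma> t)" using Y(2) R(1) l unfolding ring_distribs by linarith
      show "e1 * fst (\<gamma> t) \<le> A0 * l1" using Y(1) R(2) unfolding ring_distribs by linarith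
      have "(6 powr k + 2) * l2 \<le> B0 * l2" using B0 l by (intro mult_right_mono) auto
      then show "0 < e2 * snd (\<gamma> t)" using Y(3) R(3) l unfolding ring_distribs by linarith
    qed
    have LD: "L \<le> D * L" using D1 L by simp
    define M where "M = log_measure L (D * L)"
    have [measurable_cong, simp]: "sets M = sets borel" by (simp add: M_def)
    have finM: "finite_measure M" unfolding M_def by (rule finite_measure_log_measure[OF L LD])
    interpret M: finite_measure M by fact
    have step: "\<exists>f g. test_pair \<beta> \<gamma> N D c L f g \<and> (LINT x:Q|lborel. max (b x - m) 0) \<le> (2 / c0) * \<bar>comm_form M \<gamma> b f g\<bar>"
      if bm[measurable]: "b \<in> borel_measurable borel" and bK: "set_integrable lborel K b"
        and med: "measure lborel R / 2 \<le> measure lborel {x\<in>R. b x \<le> m}" for b m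
    proof -
      define E where "E = {z\<in>R. b z \<le> m}"
      define F where "F = {x\<in>Q. m \<le> b x}"
      have [measurable]: "E \<in> sets borel" "F \<in> sets borel" unfolding E_def F_def by measurable
      \<comment> \<open>The cutoff makes the symbol integrable without changing it on
        \<open>Q\<close>, \<open>Y\<close> and \<open>R\<close>.\<close>
      define b' where "b' x = indicator K x * b x" for x
      have b'i: "integrable lborel b'"
        using bK by (simp add: set_integrable_def b'_def[abs_def])
      have b'b: "b' x = b x" if "x \<in> K" for x using that by (simp add: b'_def)
      \<comment> \<open>\<open>f1\<close> averages the indicator of \<open>E\<close> along the curve
        and \<open>g2\<close> applies the adjoint average to the indicator of \<open>F\<close>, both
        cut off to the middle box. They are the intermediate functions that the composition
        produces.\<close>
      define f1 where "f1 y = indicator Y y * (LINT s|M. indicator E (y - \<gamma> s) :: real)" for y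
      define g2 where "g2 y = indicator Y y * (LINT t|M. indicator F (y + \<gamma> t) :: real)" for y
      have [measurable]: "f1 \<in> borel_measurable borel" "g2 \<in> borel_measurable borel"
        unfolding f1_def g2_def by measurable
      have f1b: "\<bar>f1 y\<bar> \<le> D" for y
        using log_average_bounds[OF L D1, of E "\<lambda>s. y - \<gamma> s"] D1
        unfolding f1_def M_def by (auto simp: indicator_def)
      have g2b: "\<bar>g2 y\<bar> \<le> D" for y
        using log_average_bounds[OF L D1, of F "\<lambda>s. y + \<gamma> s"] D1
        unfolding g2_def M_def by (auto simp: indicator_def)
      have f1Y: "y \<in> Y" if "f1 y \<noteq> 0" for y using that by (auto simp: f1_def indicator_def split: if_splits)
      have g2Y: "y \<in> Y" if "g2 y \<noteq> 0" for y using that by (auto simp: g2_def indicator_def split: if_splits)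
      have tp1: "test_pair \<beta> \<gamma> N D c L f1 (indicator F)"
        unfolding test_pair_def
      proof (intro conjI allI impI)
        fix x t assume "indicator F x \<noteq> (0::real)" "f1 (x - \<gamma> t) \<noteq> 0"
        then have "x \<in> Q" "x - \<gamma> t \<in> Y" using f1Y by (auto simp: F_def indicator_def split: if_splits)
        from sepQY[OF this] show "L \<le> t" "t \<le> D * L" by auto
      qed (use f1b f1Y YK QK D1 in \<open>auto simp: K_def F_def indicator_def split: if_splits\<close>)
      have tp2: "test_pair \<beta> \<gamma> N D c L (indicator E) g2"
        unfolding test_pair_def
      proof (intro conjI allI impI)
        fix x t assume "g2 x \<noteq> 0" "indicator E (x - \<gamma> t) \<noteq> (0::real)"
        then have "x \<in> Y" "x - \<gamma> t \<in> R" using g2Y by (auto simp: E_def indicator_def split: if_splits)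
        from sepYR[OF this] show "L \<le> t" "t \<le> D * L" by auto
      qed (use g2b g2Y YK RK D1 in \<open>auto simp: K_def E_def indicator_def split: if_splits\<close>)
      \<comment> \<open>The margins of 1/2 unit in \<open>Y\<close> and \<open>R\<close> absorb the
        half side of \<open>Q\<close>: for every x in \<open>Q\<close> a step with u in [2, 6] ends
        in \<open>Y\<close>, and the offsets from x to \<open>R\<close> lie in [A0, A0 + 2] and
        [B0, B0 + 2] units.\<close>
      have kern: "c0 \<le> (LINT t|M. LINT s|M. indicator Y (x - \<gamma> t) * indicator E (x - \<gamma> t - \<gamma> s))"
        if x: "x \<in> Q" for x
      proof -
        note q = Qx[OF x]
        have "1 / (\<beta>1 * 6) * (1 / (\<beta>1 * A0)) * (1 / (k * (A0 + 2) powr (k - 1))) * (measure lborel E / (L powr \<beta>1 * L powr \<beta>2))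
          \<le> (LINT t|log_measure L (D * L). LINT s|log_measure L (D * L).
              indicator Y (x - \<gamma> t) * indicator E (x - \<gamma> t - \<gamma> s))"
        proof (rule curve_sum_kernel_ge[OF \<gamma>m b1 b12 pos e(1,2) A0 k_def spread B0_def L])
          fix u :: real assume u: "u \<in> {2..6}"
          have uk: "2 powr k \<le> u powr k" "u powr k \<le> 6 powr k" using u k by (auto intro!: powr_mono2)
          have m1: "2 * l1 \<le> l1 * u" "l1 * u \<le> 6 * l1" using u l by auto
          have m2: "2 powr k * l2 \<le> l2 * u powr k" "l2 * u powr k \<le> 6 powr k * l2" using uk l by auto
          have "x - (e1 * (l1 * u), e2 * (l2 * u powr k)) \<in> Y"
          proof -
            have i1: "e1 * (fst c - (fst x - e1 * (l1 * u))) = l1 * u - e1 * (fst x - fst c)"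
              by (simp add: right_diff_distrib ee)
            have i2: "e2 * (snd c - (snd x - e2 * (l2 * u powr k))) = l2 * u powr k - e2 * (snd x - snd c)"
              by (simp add: right_diff_distrib ee)
            have i3: "(2 powr k - 1 / 2) * l2 = 2 powr k * l2 - 1 / 2 * l2" "(6 powr k + 1 / 2) * l2 = 6 powr k * l2 + 1 / 2 * l2"
              by (simp_all add: left_diff_distrib distrib_right)
            show ?thesis
              unfolding Y_def mem_Collect_eq fst_diff snd_diff fst_conv snd_conv i1 i2 i3 atLeastAtMost_iff
              using q m1 m2 by linarith
          qed
          then show "indicator Y (x - (e1 * (L powr \<beta>1 * u), e2 * (L powr \<beta>2 * u powr k))) = (1::real)"
            by (simp add: l1_def l2_def)
        next
          fix z assume "z \<in> E"
          then have "z \<in> R" by (simp add: E_def)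
          then show "e1 * (fst x - fst z) \<in> {L powr \<beta>1 * A0..L powr \<beta>1 * (A0 + 2)}"
            "e2 * (snd x - snd z) \<in> {L powr \<beta>2 * B0..L powr \<beta>2 * (B0 + 2)}"
            unfolding R_def mem_Collect_eq atLeastAtMost_iff l1_def[symmetric] l2_def[symmetric]
            using q unfolding ring_distribs mult.commute[of l1] mult.commute[of l2] by linarith+
        qed (use Dp D1 in auto)
        moreover have half: "1 / 2 \<le> measure lborel E / (L powr \<beta>1 * L powr \<beta>2)"
          using med l unfolding Rmeas E_def by (simp add: field_simps flip: l1_def l2_def)
        have c2: "1 / (\<beta>1 * 6) * (1 / (\<beta>1 * A0)) * (1 / (k * (A0 + 2) powr (k - 1))) = 2 * c0"
          unfolding c0_def by simp
        have "c0 \<le> 1 / (\<beta>1 * 6) * (1 / (\<beta>1 * A0)) * (1 / (k * (A0 + 2) powr (k - 1))) * (measure lborel E / (L powr \<beta>1 * L powr \<beta>2))"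
          unfolding c2 using mult_left_mono[OF half, of "2 * c0"] c0 by linarith
        ultimately show ?thesis unfolding M_def by linarith
      qed
      have Fb: "F \<subseteq> K" using QK by (auto simp: F_def)
      have Ffin: "emeasure lborel F < \<infinity>"
      proof -
        have "emeasure lborel F \<le> emeasure lborel K" by (rule emeasure_mono[OF Fb]) simp
        also have "\<dots> < \<infinity>" unfolding K_def by (intro emeasure_compact_finite) simp
        finally show ?thesis .
      qed
      have "c0 * (LINT x|lborel. indicator F x * (b' x - m)) \<le>
        comm_form M \<gamma> b' f1 (indicator F) + comm_form M \<gamma> b' (indicator E) g2"
        unfolding f1_def g2_def
      proof (rule comm_form_composition[OF finM])
        show "integrable lborel (indicator F :: real \<times> real \<Rightarrow> real)" using Ffin by (simp add: integrable_indicator_iff)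
        show "m \<le> b' x" if "indicator F x \<noteq> (0::real)" for x
          using that Fb b'b[of x] by (auto simp: F_def indicator_def split: if_splits)
        show "b' x \<le> m" if "indicator E x \<noteq> (0::real)" for x
          using that RK b'b[of x] by (auto simp: E_def indicator_def split: if_splits)
        show "c0 \<le> (LINT t|M. LINT s|M. indicator Y (x - \<gamma> t) * indicator E (x - \<gamma> t - \<gamma> s))"
          if "indicator F x \<noteq> (0::real)" for x
          using that by (intro kern) (auto simp: F_def indicator_def split: if_splits)
      qed (auto simp: b'i indicator_def)
      also have "comm_form M \<gamma> b' f1 (indicator F) = comm_form M \<gamma> b f1 (indicator F)"
        by (rule comm_form_cong_support) (use Fb f1Y YK b'b in \<open>auto simp: indicator_def split: if_splits\<close>)
      also have "comm_form M \<gamma> b' (indicator E) g2 = comm_form M \<gamma> b (indicator E) g2"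
        by (rule comm_form_cong_support) (use g2Y YK RK b'b in \<open>auto simp: E_def indicator_def split: if_splits\<close>)
      also have "(LINT x|lborel. indicator F x * (b' x - m)) = (LINT x:Q|lborel. max (b x - m) 0)"
        unfolding set_lebesgue_integral_def
        by (rule Bochner_Integration.integral_cong[OF refl]) (use QK b'b in \<open>auto simp: F_def indicator_def max_def\<close>)
      finally have "c0 * (LINT x:Q|lborel. max (b x - m) 0) \<le>
         comm_form M \<gamma> b f1 (indicator F) + comm_form M \<gamma> b (indicator E) g2" .
      then have le: "(LINT x:Q|lborel. max (b x - m) 0) \<le>
         (1 / c0) * (\<bar>comm_form M \<gamma> b f1 (indicator F)\<bar> + \<bar>comm_form M \<gamma> b (indicator E) g2\<bar>)"
        using c0 by (simp add: field_simps)
      show ?thesis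
      \<comment> \<open>A single pair is wanted, so the larger of the two forms is kept; hence 2 /
        c0.\<close>
      proof (cases "\<bar>comm_form M \<gamma> b f1 (indicator F)\<bar> \<le> \<bar>comm_form M \<gamma> b (indicator E) g2\<bar>")
        case True
        then have "(1 / c0) * (\<bar>comm_form M \<gamma> b f1 (indicator F)\<bar> + \<bar>comm_form M \<gamma> b (indicator E) g2\<bar>)
          \<le> (1 / c0) * (2 * \<bar>comm_form M \<gamma> b (indicator E) g2\<bar>)" using c0 by (intro mult_left_mono) auto
        with le tp2 show ?thesis by (intro exI[of _ "indicator E"] exI[of _ g2]) auto
      next
        case False
        then have "(1 / c0) * (\<bar>comm_form M \<gamma> b f1 (indicator F)\<bar> + \<bar>comm_form M \<gamma> b (indicator E) g2\<bar>)
          \<le> (1 / c0) * (2 * \<bar>comm_form M \<gamma> b f1 (indicator F)\<bar>)" using c0 by (intro mult_left_mono) auto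
        with le tp1 show ?thesis by (intro exI[of _ f1] exI[of _ "indicator F"]) auto
      qed
    qed
    show ?thesis
      unfolding Q_def[symmetric] K_def[symmetric] M_def[symmetric]
    proof (intro exI[of _ R] conjI allI impI)
      fix b :: "real \<times> real \<Rightarrow> real" and m assume "b \<in> borel_measurable borel" "set_integrable lborel K b"
        "measure lborel R / 2 \<le> measure lborel {x\<in>R. b x \<le> m}"
      then show "\<exists>f g. test_pair \<beta> \<gamma> N D c L f g \<and> (LINT x:Q|lborel. max (b x - m) 0) \<le> (2 / c0) * \<bar>comm_form M \<gamma> b f g\<bar>"
        by (rule step)
    qed (rule Rm Rfin)+
  qed
  have "0 < 2 / c0" using c0 by simp
  then show ?thesis using N1 D1 main by blast
qed

text \<open>The part of \<open>b\<close> below the median \<open>m\<close> is the part of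
  -\<open>b\<close> above -\<open>m\<close>, and \<open>comm_form\<close> is odd in the
  symbol.\<close>

lemma oscillation_le_comm_form:
  assumes curve: "is_monomial_curve \<beta> \<gamma>"
  obtains C N D where "0 < C" "1 \<le> N" "1 \<le> D"
    "\<And>c L b. 0 < L \<Longrightarrow> b \<in> borel_measurable borel \<Longrightarrow> set_integrable lborel (gbox \<beta> c (N * L)) b \<Longrightarrow>
       \<exists>m f g. test_pair \<beta> \<gamma> N D c L f g \<and>
          (LINT x:gbox \<beta> c L|lborel. \<bar>b x - m\<bar>) \<le> C * \<bar>comm_form (log_measure L (D * L)) \<gamma> b f g\<bar>"
proof -
  from upper_oscillation_le_comm_form[OF curve] obtain C N D where C: "0 < C" "1 \<le> N" "1 \<le> D" and
    *: "\<And>c L. 0 < L \<Longrightarrow> (\<exists>R. R \<in> sets borel \<and> emeasure lborel R \<noteq> \<infinity> \<and>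
      (\<forall>b m. b \<in> borel_measurable borel \<longrightarrow> set_integrable lborel (gbox \<beta> c (N * L)) b \<longrightarrow>
        measure lborel R / 2 \<le> measure lborel {x\<in>R. b x \<le> m} \<longrightarrow>
        (\<exists>f g. test_pair \<beta> \<gamma> N D c L f g \<and>
          (LINT x:gbox \<beta> c L|lborel. max (b x - m) 0) \<le> C * \<bar>comm_form (log_measure L (D * L)) \<gamma> b f g\<bar>)))"
    by blast
  have "\<exists>m f g. test_pair \<beta> \<gamma> N D c L f g \<and>
          (LINT x:gbox \<beta> c L|lborel. \<bar>b x - m\<bar>) \<le> (2 * C) * \<bar>comm_form (log_measure L (D * L)) \<gamma> b f g\<bar>"
    if L: "0 < L" and bm[measurable]: "b \<in> borel_measurable borel" and bi: "set_integrable lborel (gbox \<beta> c (N * L)) b" for c L b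
  proof -
    define M where "M = log_measure L (D * L)"
    define Q where "Q = gbox \<beta> c L"
    have [measurable]: "Q \<in> sets borel" by (simp add: Q_def)
    obtain R where R: "R \<in> sets borel" "emeasure lborel R \<noteq> \<infinity>" and
      R': "\<And>b m. b \<in> borel_measurable borel \<Longrightarrow> set_integrable lborel (gbox \<beta> c (N * L)) b \<Longrightarrow>
        measure lborel R / 2 \<le> measure lborel {x\<in>R. b x \<le> m} \<Longrightarrow>
        (\<exists>f g. test_pair \<beta> \<gamma> N D c L f g \<and>
          (LINT x:Q|lborel. max (b x - m) 0) \<le> C * \<bar>comm_form M \<gamma> b f g\<bar>)"
      using *[OF L, of c] unfolding M_def Q_def by blast
    obtain m where m: "measure lborel R / 2 \<le> measure lborel {x\<in>R. b x \<le> m}" "measure lborel R / 2 \<le> measure lborel {x\<in>R. m \<le> b x}"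
      using median_on[of b lborel R] R by auto
    from R'[OF bm bi m(1)] obtain f g where 1: "test_pair \<beta> \<gamma> N D c L f g"
      "(LINT x:Q|lborel. max (b x - m) 0) \<le> C * \<bar>comm_form M \<gamma> b f g\<bar>" by blast
    have "\<exists>f g. test_pair \<beta> \<gamma> N D c L f g \<and>
          (LINT x:Q|lborel. max (- b x - (- m)) 0) \<le> C * \<bar>comm_form M \<gamma> (\<lambda>x. - b x) f g\<bar>"
      by (rule R') (use bi m(2) in \<open>auto simp: set_integrable_def\<close>)
    then obtain f' g' where 2: "test_pair \<beta> \<gamma> N D c L f' g'"
      "(LINT x:Q|lborel. max (m - b x) 0) \<le> C * \<bar>comm_form M \<gamma> b f' g'\<bar>"
      by (auto simp: comm_form_uminus)
    have "Q \<subseteq> gbox \<beta> c (N * L)"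
    proof -
      have "0 < fst \<beta>" "0 < snd \<beta>" using curve by (auto simp: is_monomial_curve_def)
      then have "L powr fst \<beta> \<le> (N * L) powr fst \<beta>" "L powr snd \<beta> \<le> (N * L) powr snd \<beta>"
        using C L by (auto intro!: powr_mono2)
      then show ?thesis by (auto simp: Q_def mem_gbox)
    qed
    then have bQ: "set_integrable lborel Q b" by (rule set_integrable_subset[OF bi, rotated]) simp
    have cQ: "set_integrable lborel Q (\<lambda>_. m)" unfolding set_integrable_def Q_def
      using emeasure_compact_finite[of "gbox \<beta> c L"] by (simp add: integrable_indicator_iff)
    have dQ: "set_integrable lborel Q (\<lambda>x. b x - m)" using bQ cQ by (rule set_integral_diff(1))
    have mQ: "set_integrable lborel Q (\<lambda>x. max (b x - m) 0)" "set_integrable lborel Q (\<lambda>x. max (m - b x) 0)"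
      by (rule set_integrable_bound[OF dQ]; auto simp: set_borel_measurable_def)+
    have "(LINT x:Q|lborel. \<bar>b x - m\<bar>) = (LINT x:Q|lborel. max (b x - m) 0 + max (m - b x) 0)"
      by (rule set_lebesgue_integral_cong) auto
    also have "\<dots> = (LINT x:Q|lborel. max (b x - m) 0) + (LINT x:Q|lborel. max (m - b x) 0)"
      by (rule set_integral_add(2)[OF mQ])
    finally have eq: "(LINT x:Q|lborel. \<bar>b x - m\<bar>) = (LINT x:Q|lborel. max (b x - m) 0) + (LINT x:Q|lborel. max (m - b x) 0)" .
    show ?thesis
    proof (cases "\<bar>comm_form M \<gamma> b f g\<bar> \<le> \<bar>comm_form M \<gamma> b f' g'\<bar>")
      case True
      then have "C * \<bar>comm_form M \<gamma> b f g\<bar> \<le> C * \<bar>comm_form M \<gamma> b f' g'\<bar>" using C by (intro mult_left_mono) auto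
      with eq 1 2 show ?thesis unfolding M_def Q_def
        by (intro exI[of _ m] exI[of _ f'] exI[of _ g']) auto
    next
      case False
      then have "C * \<bar>comm_form M \<gamma> b f' g'\<bar> \<le> C * \<bar>comm_form M \<gamma> b f g\<bar>" using C by (intro mult_left_mono) auto
      with eq 1 2 show ?thesis unfolding M_def Q_def
        by (intro exI[of _ m] exI[of _ f] exI[of _ g]) auto
    qed
  qed
  then show ?thesis using that[of "2 * C" N D] C by auto
qed


section \<open>The commutator form as a pairing with the Hilbert transform\<close>

text \<open>For each t the exceptional x form a translate of a null set, and Tonelli exchanges the
  quantifiers. No such statement holds along one given translate of the curve, which is itself a
  null set of the plane.\<close>

lemma AE_shift_curve:
  fixes \<gamma> :: "real \<Rightarrow> 'a::euclidean_space"
  assumes [measurable]: "\<gamma> \<in> borel_measurable borel" and "AE x in lebesgue. P x"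
  shows "AE x in lebesgue. AE t in lebesgue. P (x - \<gamma> t)"
proof -
  have "AE x in lborel. P x" using assms(2) by (simp add: AE_completion_iff)
  then obtain N where N: "{x. \<not> P x} \<subseteq> N" "N \<in> null_sets lborel"
    by (auto elim!: AE_E simp: null_sets_def)
  then have [measurable]: "N \<in> sets borel" by (auto simp: null_sets_def)
  have "AE t in lborel. AE x in lborel. x - \<gamma> t \<notin> N"
  proof (rule AE_I2)
    fix t
    have "emeasure lborel {x. x - \<gamma> t \<in> N} = (\<integral>\<^sup>+x. indicator {x. x - \<gamma> t \<in> N} x \<partial>lborel)"
      by (rule nn_integral_indicator[symmetric]) simp
    also have "\<dots> = (\<integral>\<^sup>+x. indicator N (x + (- \<gamma> t)) \<partial>lborel)"
      by (intro nn_integral_cong) (simp add: indicator_def)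
    also have "\<dots> = emeasure lborel N"
      by (subst nn_integral_lborel_shift) auto
    also have "\<dots> = 0" using N by (auto simp: null_sets_def)
    finally show "AE x in lborel. x - \<gamma> t \<notin> N"
      by (intro AE_I[of _ _ "{x. x - \<gamma> t \<in> N}"]) auto
  qed
  moreover have "(AE t in lborel. AE x in lborel. x - \<gamma> t \<notin> N) = (AE x in lborel. AE t in lborel. x - \<gamma> t \<notin> N)"
    by (rule lborel_pair.AE_commute) measurable
  ultimately have "AE x in lborel. AE t in lborel. x - \<gamma> t \<notin> N" by simp
  then have "AE x in lborel. AE t in lborel. P (x - \<gamma> t)"
    by (elim eventually_mono) (use N(1) in auto)
  then show ?thesis by (simp add: AE_completion_iff)
qed

text \<open>All truncations at r < L coincide, so the principal value is attained and no limit
  remains. The Borel function \<open>u\<close> stands in for a Lebesgue measurable one restricted to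
  the curve.\<close>

lemma hilbert_eq_log_integral:
  assumes L: "0 < L" and ex: "hilbert_exists \<gamma> F x"
    and supp: "\<And>t. F (x - \<gamma> t) \<noteq> 0 \<Longrightarrow> L \<le> t \<and> t \<le> d"
    and ae: "AE t in lebesgue. F (x - \<gamma> t) = u t" and [measurable]: "u \<in> borel_measurable borel"
  shows "integrable (log_measure L d) u" and "hilbert \<gamma> F x = (LINT t|log_measure L d. u t)"
proof -
  have eq: "indicator {t. r < \<bar>t\<bar>} t *\<^sub>R (F (x - \<gamma> t) / of_real t) = (indicator {L..d} t / t) *\<^sub>R F (x - \<gamma> t)"
    if "0 < r" "r < L" for r t
    using that supp[of t] by (cases "F (x - \<gamma> t) = 0") (auto simp: indicator_def scaleR_conv_of_real divide_inverse mult.commute)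
  \<comment> \<open>Integrability comes from the existence of the transform at some truncation below
    L; L/2 is one choice.\<close>
  have "set_integrable lebesgue {t. L / 2 < \<bar>t\<bar>} (\<lambda>t. F (x - \<gamma> t) / of_real t)"
    using ex half_gt_zero[OF L] unfolding hilbert_exists_def by blast
  then have int: "integrable lebesgue (\<lambda>t. (indicator {L..d} t / t) *\<^sub>R F (x - \<gamma> t))"
    unfolding set_integrable_def using eq[of "L / 2"] L by simp
  have ae': "AE t in lebesgue. (indicator {L..d} t / t) *\<^sub>R F (x - \<gamma> t) = (indicator {L..d} t / t) *\<^sub>R u t"
    using ae by eventually_elim simp
  have um: "(\<lambda>t. (indicator {L..d} t / t) *\<^sub>R u t) \<in> borel_measurable lborel" by measurable
  have "integrable lebesgue (\<lambda>t. (indicator {L..d} t / t) *\<^sub>R u t)"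
    by (rule integrable_cong_AE_imp[OF int]) (use um ae' in \<open>auto simp: measurable_completion elim: eventually_mono\<close>)
  then have "integrable lborel (\<lambda>t. (indicator {L..d} t / t) *\<^sub>R u t)"
    using integrable_completion[OF um] by simp
  then show "integrable (log_measure L d) u"
    unfolding log_measure_def by (subst integrable_density) (use L in \<open>auto simp: indicator_def\<close>)
  have I: "(LINT t|lebesgue. (indicator {L..d} t / t) *\<^sub>R F (x - \<gamma> t)) = (LINT t|log_measure L d. u t)"
  proof -
    have "(LINT t|lebesgue. (indicator {L..d} t / t) *\<^sub>R F (x - \<gamma> t)) = (LINT t|lebesgue. (indicator {L..d} t / t) *\<^sub>R u t)"
      by (rule integral_cong_AE) (use int um ae' in \<open>auto simp: measurable_completion\<close>)
    also have "\<dots> = (LINT t|lborel. (indicator {L..d} t / t) *\<^sub>R u t)"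
      by (rule integral_completion[OF um])
    also have "\<dots> = (LINT t|log_measure L d. u t)"
      unfolding log_measure_def by (subst integral_density) (use L in \<open>auto simp: indicator_def\<close>)
    finally show ?thesis .
  qed
  have "truncated_hilbert \<gamma> r F x = (LINT t|log_measure L d. u t)" if "0 < r" "r < L" for r
    unfolding truncated_hilbert_def set_lebesgue_integral_def eq[OF that] I ..
  then have "eventually (\<lambda>r. truncated_hilbert \<gamma> r F x = (LINT t|log_measure L d. u t)) (at_right 0)"
    using L by (auto simp: eventually_at_right[of 0 1] intro!: exI[of _ L])
  then have "((\<lambda>r. truncated_hilbert \<gamma> r F x) \<longlongrightarrow> (LINT t|log_measure L d. u t)) (at_right 0)"
    by (rule tendsto_eventually)
  then show "hilbert \<gamma> F x = (LINT t|log_measure L d. u t)"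
    unfolding hilbert_def by (intro tendsto_Lim) auto
qed

text \<open>Where \<open>g\<close> does not vanish, both transforms in the commutator are integrals
  against the same finite measure, so b(x) can be moved under the integral to form b(x) - b(x -
  \<gamma> t). Elsewhere both sides carry the factor 0. The form takes real symbols, hence the split
  into real and imaginary part.\<close>

lemma commutator_pairing_eq_comm_form:
  fixes b :: "real \<times> real \<Rightarrow> complex"
  assumes \<gamma>m[measurable]: "\<gamma> \<in> borel_measurable borel"
    and [measurable]: "f \<in> borel_measurable borel" "g \<in> borel_measurable borel"
    and supp: "\<And>x t. g x \<noteq> 0 \<Longrightarrow> f (x - \<gamma> t) \<noteq> 0 \<Longrightarrow> L \<le> t \<and> t \<le> D * L"
    and L: "0 < L" and D: "1 \<le> D"
    and [measurable]: "b1 \<in> borel_measurable borel" "b2 \<in> borel_measurable borel"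
    and b: "AE x in lebesgue. b x = Complex (b1 x) (b2 x)"
    and T: "AE x in lebesgue. hilbert_exists \<gamma> (\<lambda>y. complex_of_real (f y)) x \<and>
        hilbert_exists \<gamma> (\<lambda>y. b y * complex_of_real (f y)) x \<and>
        T x = commutator b (hilbert \<gamma>) (\<lambda>y. complex_of_real (f y)) x"
    and int: "integrable lebesgue (\<lambda>x. complex_of_real (g x) * T x)"
  shows "(LINT x|lebesgue. complex_of_real (g x) * T x) =
     Complex (comm_form (log_measure L (D * L)) \<gamma> b1 f g) (comm_form (log_measure L (D * L)) \<gamma> b2 f g)"
proof -
  define M where "M = log_measure L (D * L)"
  have [measurable_cong, simp]: "sets M = sets borel" by (simp add: M_def)
  have LD: "L \<le> D * L" using D L by simp
  interpret M: finite_measure M unfolding M_def by (rule finite_measure_log_measure[OF L LD])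
  define h where "h bb x = g x * (LINT t|M. f (x - \<gamma> t) * (bb x - bb (x - \<gamma> t)))" for bb :: "real \<times> real \<Rightarrow> real" and x
  have hm[measurable]: "h b1 \<in> borel_measurable borel" "h b2 \<in> borel_measurable borel"
    unfolding h_def by measurable
  have ae: "AE x in lebesgue. complex_of_real (g x) * T x = Complex (h b1 x) (h b2 x)"
    using T b AE_shift_curve[OF \<gamma>m b]
  proof eventually_elim
    case (elim x)
    show ?case
    proof (cases "g x = 0")
      case True
      then show ?thesis by (simp add: h_def complex_eq_iff)
    next
      case False
      let ?F = "\<lambda>y. complex_of_real (f y)" and ?b = "\<lambda>y. Complex (b1 y) (b2 y)"
      have [measurable]: "?b \<in> borel_measurable borel" by (simp add: Complex_eq)
      have aeS: "AE t in lebesgue. b (x - \<gamma> t) * ?F (x - \<gamma> t) = ?b (x - \<gamma> t) * ?F (x - \<gamma> t)"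
        using elim(3) by (auto elim: eventually_mono)
      note H1 = hilbert_eq_log_integral[OF L, of \<gamma> ?F x "D * L" "\<lambda>t. ?F (x - \<gamma> t)"]
      note H2 = hilbert_eq_log_integral[OF L, of \<gamma> "\<lambda>y. b y * ?F y" x "D * L" "\<lambda>t. ?b (x - \<gamma> t) * ?F (x - \<gamma> t)"]
      have i1: "integrable M (\<lambda>t. ?F (x - \<gamma> t))" and e1: "hilbert \<gamma> ?F x = (LINT t|M. ?F (x - \<gamma> t))"
        unfolding M_def by (rule H1; use elim(1) supp[OF False] in auto)+
      have i2: "integrable M (\<lambda>t. ?b (x - \<gamma> t) * ?F (x - \<gamma> t))"
        and e2: "hilbert \<gamma> (\<lambda>y. b y * ?F y) x = (LINT t|M. ?b (x - \<gamma> t) * ?F (x - \<gamma> t))"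
        unfolding M_def by (rule H2; use elim(1) supp[OF False] aeS in auto)+
      have i1': "integrable M (\<lambda>t. f (x - \<gamma> t))" using i1 by (simp add: complex_of_real_integrable_eq)
      have i21: "integrable M (\<lambda>t. f (x - \<gamma> t) * b1 (x - \<gamma> t))" "integrable M (\<lambda>t. f (x - \<gamma> t) * b2 (x - \<gamma> t))"
        using integrable_Re[OF i2] integrable_Im[OF i2] by (simp_all add: mult.commute)
      have T: "T x = ?b x * (LINT t|M. ?F (x - \<gamma> t)) - (LINT t|M. ?b (x - \<gamma> t) * ?F (x - \<gamma> t))"
        using elim e1 e2 by (simp add: commutator_def)
      have "Re (T x) = b1 x * (LINT t|M. f (x - \<gamma> t)) - (LINT t|M. f (x - \<gamma> t) * b1 (x - \<gamma> t))"
        unfolding T using integral_Re[OF i2] by (simp add: mult.commute)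
      also have "\<dots> = (LINT t|M. b1 x * f (x - \<gamma> t) - f (x - \<gamma> t) * b1 (x - \<gamma> t))"
        using i1' i21 by (subst Bochner_Integration.integral_diff) auto
      also have "\<dots> = (LINT t|M. f (x - \<gamma> t) * (b1 x - b1 (x - \<gamma> t)))"
        by (rule Bochner_Integration.integral_cong) (auto simp: algebra_simps)
      finally have R: "Re (T x) = (LINT t|M. f (x - \<gamma> t) * (b1 x - b1 (x - \<gamma> t)))" .
      have "Im (T x) = b2 x * (LINT t|M. f (x - \<gamma> t)) - (LINT t|M. f (x - \<gamma> t) * b2 (x - \<gamma> t))"
        unfolding T using integral_Im[OF i2] by (simp add: mult.commute)
      also have "\<dots> = (LINT t|M. b2 x * f (x - \<gamma> t) - f (x - \<gamma> t) * b2 (x - \<gamma> t))"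
        using i1' i21 by (subst Bochner_Integration.integral_diff) auto
      also have "\<dots> = (LINT t|M. f (x - \<gamma> t) * (b2 x - b2 (x - \<gamma> t)))"
        by (rule Bochner_Integration.integral_cong) (auto simp: algebra_simps)
      finally have I: "Im (T x) = (LINT t|M. f (x - \<gamma> t) * (b2 x - b2 (x - \<gamma> t)))" .
      show ?thesis unfolding complex_eq_iff by (simp add: h_def R I)
    qed
  qed
  have hmL: "h b1 \<in> borel_measurable lebesgue" "h b2 \<in> borel_measurable lebesgue"
    by (rule measurable_completion, simp)+
  have aeR: "AE x in lebesgue. Re (complex_of_real (g x) * T x) = h b1 x"
    using ae by eventually_elim (metis complex.sel(1))
  have aeI: "AE x in lebesgue. Im (complex_of_real (g x) * T x) = h b2 x"
    using ae by eventually_elim (metis complex.sel(2))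
  have "Re (LINT x|lebesgue. complex_of_real (g x) * T x) = (LINT x|lebesgue. Re (complex_of_real (g x) * T x))"
    using integral_Re[OF int] by simp
  also have "\<dots> = (LINT x|lebesgue. h b1 x)"
    by (rule integral_cong_AE) (use aeR borel_measurable_integrable[OF integrable_Re[OF int]] hmL in \<open>simp_all only:\<close>)
  also have "\<dots> = comm_form M \<gamma> b1 f g"
    using hm by (subst integral_completion) (simp_all add: comm_form_def h_def[abs_def])
  finally have R: "Re (LINT x|lebesgue. complex_of_real (g x) * T x) = comm_form M \<gamma> b1 f g" .
  have "Im (LINT x|lebesgue. complex_of_real (g x) * T x) = (LINT x|lebesgue. Im (complex_of_real (g x) * T x))"
    using integral_Im[OF int] by simp
  also have "\<dots> = (LINT x|lebesgue. h b2 x)"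
    by (rule integral_cong_AE) (use aeI borel_measurable_integrable[OF integrable_Im[OF int]] hmL in \<open>simp_all only:\<close>)
  also have "\<dots> = comm_form M \<gamma> b2 f g"
    using hm by (subst integral_completion) (simp_all add: comm_form_def h_def[abs_def])
  finally have I: "Im (LINT x|lebesgue. complex_of_real (g x) * T x) = comm_form M \<gamma> b2 f g" .
  show ?thesis using R I by (simp add: complex_eq_iff M_def)
qed


section \<open>Hoelder inequalities and weights\<close>

lemma conj_exp_gt_1: "1 < p \<Longrightarrow> 1 < conj_exp p"
  and conj_exp_inverse: "1 < p \<Longrightarrow> 1 / p + 1 / conj_exp p = 1"
  by (simp_all add: conj_exp_def field_simps)

lemma Holder_integral:
  fixes f g :: "'a \<Rightarrow> real"
  assumes p: "1 < p" and [measurable]: "f \<in> borel_measurable M" "g \<in> borel_measurable M"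
    and f: "integrable M (\<lambda>x. \<bar>f x\<bar> powr p)" and g: "integrable M (\<lambda>x. \<bar>g x\<bar> powr conj_exp p)"
  shows "integrable M (\<lambda>x. f x * g x)"
    and "(LINT x|M. \<bar>f x * g x\<bar>) \<le> (LINT x|M. \<bar>f x\<bar> powr p) powr (1 / p) * (LINT x|M. \<bar>g x\<bar> powr conj_exp p) powr (1 / conj_exp p)"
proof -
  define q where "q = conj_exp p"
  have q: "1 < q" "1 / p + 1 / q = 1" using conj_exp_gt_1[OF p] conj_exp_inverse[OF p] by (auto simp: q_def)
  have young: "\<bar>x * y\<bar> \<le> \<bar>x\<bar> powr p / p + \<bar>y\<bar> powr q / q" for x y :: real
    using Youngs_inequality[OF p q, of "\<bar>x\<bar>" "\<bar>y\<bar>"] by (simp add: abs_mult)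
  have g': "integrable M (\<lambda>x. \<bar>g x\<bar> powr q)" using g by (simp add: q_def)
  show int: "integrable M (\<lambda>x. f x * g x)"
  proof (rule Bochner_Integration.integrable_bound)
    show "integrable M (\<lambda>x. \<bar>f x\<bar> powr p / p + \<bar>g x\<bar> powr q / q)" using f g' by simp
    show "AE x in M. norm (f x * g x) \<le> norm (\<bar>f x\<bar> powr p / p + \<bar>g x\<bar> powr q / q)"
      unfolding real_norm_def by (intro AE_I2 order_trans[OF young abs_ge_self])
  qed measurable
  define A where "A = (LINT x|M. \<bar>f x\<bar> powr p)"
  define B where "B = (LINT x|M. \<bar>g x\<bar> powr q)"
  have AB: "0 \<le> A" "0 \<le> B" by (auto simp: A_def B_def)
  \<comment> \<open>The normalization by the two norms breaks down when one of them is 0; then the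
    product vanishes almost everywhere.\<close>
  have zero: "(LINT x|M. \<bar>f x * g x\<bar>) = 0" if "A = 0 \<or> B = 0"
  proof -
    from that have "AE x in M. f x * g x = 0"
    proof
      assume "A = 0"
      then have "AE x in M. \<bar>f x\<bar> powr p = 0" using f unfolding A_def by (subst (asm) integral_nonneg_eq_0_iff_AE) auto
      then show ?thesis by eventually_elim auto
    next
      assume "B = 0"
      then have "AE x in M. \<bar>g x\<bar> powr q = 0" using g' unfolding B_def by (subst (asm) integral_nonneg_eq_0_iff_AE) auto
      then show ?thesis by eventually_elim auto
    qed
    then have "(LINT x|M. \<bar>f x * g x\<bar>) = (LINT x|M. 0)" by (intro integral_cong_AE) auto
    then show ?thesis by simp
  qed
  have "(LINT x|M. \<bar>f x * g x\<bar>) \<le> A powr (1 / p) * B powr (1 / q)"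
  proof (cases "A = 0 \<or> B = 0")
    case True
    then show ?thesis using zero by simp
  next
    case False
    then have pos: "0 < A" "0 < B" using AB by auto
    define a where "a = A powr (1 / p)"
    define b where "b = B powr (1 / q)"
    have ab: "0 < a" "0 < b" "a powr p = A" "b powr q = B" using pos p q by (auto simp: a_def b_def powr_powr)
    have pw: "\<bar>f x * g x\<bar> \<le> a * b * (\<bar>f x\<bar> powr p / A / p + \<bar>g x\<bar> powr q / B / q)" for x
    proof -
      have "\<bar>f x / a * (g x / b)\<bar> \<le> \<bar>f x / a\<bar> powr p / p + \<bar>g x / b\<bar> powr q / q" by (rule young)
      also have "\<dots> = \<bar>f x\<bar> powr p / A / p + \<bar>g x\<bar> powr q / B / q"
        using ab by (simp add: powr_divide)
      finally have "a * b * \<bar>f x / a * (g x / b)\<bar> \<le> a * b * (\<bar>f x\<bar> powr p / A / p + \<bar>g x\<bar> powr q / B / q)"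
        using ab by (intro mult_left_mono) auto
      moreover have "a * b * \<bar>f x / a * (g x / b)\<bar> = \<bar>f x * g x\<bar>" using ab by (simp add: abs_mult)
      ultimately show ?thesis by simp
    qed
    have "(LINT x|M. \<bar>f x * g x\<bar>) \<le> (LINT x|M. a * b * (\<bar>f x\<bar> powr p / A / p + \<bar>g x\<bar> powr q / B / q))"
      by (intro integral_mono pw integrable_abs int integrable_mult_right Bochner_Integration.integrable_add integrable_divide f g')
    also have "\<dots> = a * b * (A / A / p + B / B / q)"
      using f g' by (simp add: A_def B_def)
    also have "\<dots> = a * b" using pos q by simp
    finally show ?thesis by (simp add: a_def b_def)
  qed
  then show "(LINT x|M. \<bar>f x * g x\<bar>) \<le> (LINT x|M. \<bar>f x\<bar> powr p) powr (1 / p) * (LINT x|M. \<bar>g x\<bar> powr conj_exp p) powr (1 / conj_exp p)"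
    by (simp add: A_def B_def q_def)
qed

text \<open>Hoelder for the factorization of |u| into |u| w and 1/w on \<open>X\<close>, in the
  convention of weights as multipliers.\<close>

lemma weighted_Holder:
  fixes u :: "'a \<Rightarrow> complex" and w :: "'a \<Rightarrow> real"
  assumes p: "1 < p" and u[measurable]: "u \<in> borel_measurable M" and w[measurable]: "w \<in> borel_measurable M"
    and X[measurable]: "X \<in> sets M" and pos: "AE x in M. 0 < w x"
    and iu: "set_integrable M X (\<lambda>x. (cmod (u x) * w x) powr p)"
    and iw: "set_integrable M X (\<lambda>x. w x powr - conj_exp p)"
  shows "set_integrable M X (\<lambda>x. cmod (u x))"
    and "(LINT x:X|M. cmod (u x)) \<le> (LINT x:X|M. (cmod (u x) * w x) powr p) powr (1 / p) * (LINT x:X|M. w x powr - conj_exp p) powr (1 / conj_exp p)"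
proof -
  define f where "f x = indicator X x * (cmod (u x) * w x)" for x
  define g where "g x = indicator X x * inverse (w x)" for x
  have [measurable]: "f \<in> borel_measurable M" "g \<in> borel_measurable M"
    unfolding f_def g_def by measurable
  have p0: "p \<noteq> 0" "conj_exp p \<noteq> 0" using p conj_exp_gt_1[OF p] by auto
  have f: "AE x in M. \<bar>f x\<bar> powr p = indicator X x *\<^sub>R (cmod (u x) * w x) powr p"
    using pos by eventually_elim (auto simp: f_def indicator_def p0)
  have g: "AE x in M. \<bar>g x\<bar> powr conj_exp p = indicator X x *\<^sub>R w x powr - conj_exp p"
    using pos by eventually_elim (auto simp: g_def indicator_def p0 powr_minus inverse_powr)
  have fg: "AE x in M. f x * g x = indicator X x *\<^sub>R cmod (u x)"
    using pos by eventually_elim (auto simp: f_def g_def indicator_def)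
  have fg': "AE x in M. \<bar>f x * g x\<bar> = indicator X x *\<^sub>R cmod (u x)"
    using fg by eventually_elim (auto simp: indicator_def)
  have fi: "integrable M (\<lambda>x. \<bar>f x\<bar> powr p)"
    using iu f unfolding set_integrable_def by (subst integrable_cong_AE[OF _ _ f]) auto
  have gi: "integrable M (\<lambda>x. \<bar>g x\<bar> powr conj_exp p)"
    using iw unfolding set_integrable_def by (subst integrable_cong_AE[OF _ _ g]) auto
  note H = Holder_integral[OF p _ _ fi gi]
  show "set_integrable M X (\<lambda>x. cmod (u x))"
    using H(1) unfolding set_integrable_def by (subst integrable_cong_AE[OF _ _ fg, symmetric]) auto
  have "(LINT x:X|M. cmod (u x)) = (LINT x|M. \<bar>f x * g x\<bar>)"
    unfolding set_lebesgue_integral_def by (rule integral_cong_AE[OF _ _ fg', symmetric]) auto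
  also have "\<dots> \<le> (LINT x|M. \<bar>f x\<bar> powr p) powr (1 / p) * (LINT x|M. \<bar>g x\<bar> powr conj_exp p) powr (1 / conj_exp p)"
    by (rule H(2)) auto
  also have "(LINT x|M. \<bar>f x\<bar> powr p) = (LINT x:X|M. (cmod (u x) * w x) powr p)"
    unfolding set_lebesgue_integral_def by (rule integral_cong_AE[OF _ _ f]) auto
  also have "(LINT x|M. \<bar>g x\<bar> powr conj_exp p) = (LINT x:X|M. w x powr - conj_exp p)"
    unfolding set_lebesgue_integral_def by (rule integral_cong_AE[OF _ _ g]) auto
  finally show "(LINT x:X|M. cmod (u x)) \<le> (LINT x:X|M. (cmod (u x) * w x) powr p) powr (1 / p) * (LINT x:X|M. w x powr - conj_exp p) powr (1 / conj_exp p)" .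
qed

text \<open>Add ln s <= s - 1 at s = x/S, y/S, z/S with weights a, b, c; the right-hand sides cancel
  because S is the weighted mean. The inequality serves as Young's inequality with three factors in
  the two-weight bound.\<close>

lemma weighted_am_gm3:
  fixes x y z :: real
  assumes "0 < x" "0 < y" "0 < z" "0 \<le> a" "0 \<le> b" "0 \<le> c" "a + b + c = 1"
  shows "x powr a * y powr b * z powr c \<le> a * x + b * y + c * z"
proof -
  define S where "S = a * x + b * y + c * z"
  have nn: "0 \<le> a * x" "0 \<le> b * y" "0 \<le> c * z" using assms by auto
  have S: "0 < S"
  proof (rule ccontr)
    assume "\<not> 0 < S"
    then have "a * x = 0" "b * y = 0" "c * z = 0" using nn unfolding S_def by linarith+
    then show False using assms by auto
  qed
  have l: "e * (ln t - ln S) \<le> e * (t / S - 1)" if "0 < t" "0 \<le> e" for t e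
    using ln_le_minus_one[of "t / S"] that S by (intro mult_left_mono) (auto simp: ln_div)
  have "a * (ln x - ln S) + b * (ln y - ln S) + c * (ln z - ln S) \<le> a * (x / S - 1) + b * (y / S - 1) + c * (z / S - 1)"
    using assms by (intro add_mono l)
  also have "\<dots> = (a * x + b * y + c * z) / S - (a + b + c)" by (simp add: algebra_simps add_divide_distrib)
  also have "\<dots> = S / S - (a + b + c)" by (simp only: S_def)
  also have "\<dots> = 0" using S assms by simp
  finally have "a * ln x + b * ln y + c * ln z \<le> (a + b + c) * ln S" by (simp add: algebra_simps)
  then have "exp (a * ln x + b * ln y + c * ln z) \<le> exp (ln S)" using assms by simp
  then show ?thesis using S assms by (simp add: S_def powr_def exp_add)
qed

lemma set_integral_pos:
  fixes f :: "'a \<Rightarrow> real"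
  assumes "set_integrable M A f" "AE x in M. 0 < f x" and A: "A \<in> sets M" "emeasure M A \<noteq> 0"
  shows "0 < (LINT x:A|M. f x)"
proof -
  have ae: "AE x in M. 0 \<le> indicator A x *\<^sub>R f x" using assms(2) by eventually_elim (auto simp: indicator_def)
  have "0 \<le> (LINT x:A|M. f x)" unfolding set_lebesgue_integral_def by (rule integral_nonneg_AE[OF ae])
  moreover have "(LINT x:A|M. f x) \<noteq> 0"
  proof
    assume "(LINT x:A|M. f x) = 0"
    then have "AE x in M. indicator A x *\<^sub>R f x = 0"
      using integral_nonneg_eq_0_iff_AE[OF assms(1)[unfolded set_integrable_def] ae]
      by (simp add: set_lebesgue_integral_def)
    with assms(2) have "AE x in M. x \<notin> A" by eventually_elim (auto simp: indicator_def)
    then have "A \<in> null_sets M" using AE_iff_null_sets[OF A(1)] by simp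
    then show False using A by (auto simp: null_sets_def)
  qed
  ultimately show ?thesis by simp
qed

lemma locally_integrable_measurable:
  fixes f :: "'a::euclidean_space \<Rightarrow> 'b::euclidean_space"
  assumes "locally_integrable f"
  shows "f \<in> borel_measurable lebesgue"
proof (rule borel_measurable_LIMSEQ_metric)
  fix n :: nat
  have "f absolutely_integrable_on cball 0 (real n)" using assms by (simp add: locally_integrable_def)
  then show "(\<lambda>x. indicator (cball 0 (real n)) x *\<^sub>R f x) \<in> borel_measurable lebesgue"
    unfolding set_integrable_def by (rule borel_measurable_integrable)
next
  fix x :: 'a
  obtain n0 :: nat where n0: "norm x \<le> real n0" using real_arch_simple by blast
  show "(\<lambda>n. indicator (cball 0 (real n)) x *\<^sub>R f x) \<longlonglongrightarrow> f x"
    by (rule tendsto_eventually) (use n0 in \<open>auto simp: eventually_sequentially indicator_def intro!: exI[of _ n0]\<close>)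
qed

lemma gamma_cubes_eq_gbox:
  assumes "0 < fst \<beta>" "0 < snd \<beta>"
  shows "Q \<in> gamma_cubes \<beta> \<longleftrightarrow> (\<exists>c L. 0 < L \<and> Q = gbox \<beta> c L)"
proof
  assume "Q \<in> gamma_cubes \<beta>"
  then obtain a a' b b' where Q: "Q = {a..a'} \<times> {b..b'}" "a < a'" "b < b'"
    and eq: "(a' - a) powr (1 / fst \<beta>) = (b' - b) powr (1 / snd \<beta>)"
    unfolding gamma_cubes_def by blast
  define L where "L = (a' - a) powr (1 / fst \<beta>)"
  have L: "0 < L" "L powr fst \<beta> = a' - a" "L powr snd \<beta> = b' - b"
  proof -
    show "0 < L" using Q by (simp add: L_def)
    show "L powr fst \<beta> = a' - a" using Q assms by (simp add: L_def powr_powr)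
    show "L powr snd \<beta> = b' - b" using Q assms unfolding L_def eq by (simp add: powr_powr)
  qed
  have "Q = gbox \<beta> ((a + a') / 2, (b + b') / 2) L"
    unfolding gbox_def L(2,3) Q by (simp add: field_simps)
  then show "\<exists>c L. 0 < L \<and> Q = gbox \<beta> c L" using L(1) by blast
next
  assume "\<exists>c L. 0 < L \<and> Q = gbox \<beta> c L"
  then obtain c L where L: "0 < L" and Q: "Q = gbox \<beta> c L" by blast
  have p: "0 < L powr fst \<beta>" "0 < L powr snd \<beta>" using L by auto
  have "(L powr fst \<beta>) powr (1 / fst \<beta>) = (L powr snd \<beta>) powr (1 / snd \<beta>)"
    using L assms by (simp add: powr_powr)
  then show "Q \<in> gamma_cubes \<beta>"
    unfolding gamma_cubes_def Q gbox_def using p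
    by (intro CollectI exI[of _ "fst c - L powr fst \<beta> / 2"] exI[of _ "fst c + L powr fst \<beta> / 2"]
        exI[of _ "snd c - L powr snd \<beta> / 2"] exI[of _ "snd c + L powr snd \<beta> / 2"]) auto
qed

lemma gbox_in_gamma_cubes:
  "0 < fst \<beta> \<Longrightarrow> 0 < snd \<beta> \<Longrightarrow> 0 < L \<Longrightarrow> gbox \<beta> c L \<in> gamma_cubes \<beta>"
  using gamma_cubes_eq_gbox by blast

lemma set_integral_mono_subset:
  fixes f :: "'a \<Rightarrow> real"
  assumes "set_integrable M B f" "AE x in M. 0 \<le> f x" "A \<in> sets M" "A \<subseteq> B"
  shows "(LINT x:A|M. f x) \<le> (LINT x:B|M. f x)"
  unfolding set_lebesgue_integral_def
proof (rule integral_mono_AE)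
  show "integrable M (\<lambda>x. indicator A x *\<^sub>R f x)" "integrable M (\<lambda>x. indicator B x *\<^sub>R f x)"
    using set_integrable_subset[OF assms(1,3,4)] assms(1) by (simp_all add: set_integrable_def)
  show "AE x in M. indicator A x *\<^sub>R f x \<le> indicator B x *\<^sub>R f x"
    using assms(2) by eventually_elim (use assms(4) in \<open>auto simp: indicator_def\<close>)
qed

lemma side_gbox:
  assumes "0 < fst \<beta>" "0 < L"
  shows "side \<beta> (gbox \<beta> c L) = L"
proof -
  have "0 \<le> L powr snd \<beta>" by simp
  then have ne: "{snd c - L powr snd \<beta> / 2..snd c + L powr snd \<beta> / 2} \<noteq> {}" by (simp del: powr_ge_zero)
  have "fst ` gbox \<beta> c L = {fst c - L powr fst \<beta> / 2..fst c + L powr fst \<beta> / 2}"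
    unfolding gbox_def fst_image_times using ne by simp
  then show ?thesis using assms by (simp add: side_def powr_powr)
qed

lemma measure_lebesgue_gbox: "0 < L \<Longrightarrow> measure lebesgue (gbox \<beta> c L) = L powr exponent_size \<beta>"
  using measure_gbox[of L \<beta> c] by (simp add: exponent_size_def powr_add)

lemma gbox_lmeasurable [simp]: "gbox \<beta> c L \<in> lmeasurable"
  by (simp add: gbox_eq_cbox)

lemma gbox_mono:
  assumes "0 < fst \<beta>" "0 < snd \<beta>" "0 < L" "1 \<le> N"
  shows "gbox \<beta> c L \<subseteq> gbox \<beta> c (N * L)"
proof -
  have "L powr fst \<beta> \<le> (N * L) powr fst \<beta>" "L powr snd \<beta> \<le> (N * L) powr snd \<beta>"
    using assms by (auto intro!: powr_mono2)
  then show ?thesis by (auto simp: mem_gbox)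
qed

section \<open>Masses of a weight and of its dual on cubes\<close>

locale A_weight =
  fixes \<beta> :: "real \<times> real" and p :: real and w :: "real \<times> real \<Rightarrow> real"
  assumes beta: "0 < fst \<beta>" "0 < snd \<beta>" and p: "1 < p" and w: "w \<in> A_class \<beta> p"
begin

lemma measurable_weight [measurable]: "w \<in> borel_measurable lebesgue"
  using w by (auto simp: A_class_def is_weight_def intro: locally_integrable_measurable)

lemma AE_pos: "AE x in lebesgue. 0 < w x"
  using w by (auto simp: A_class_def is_weight_def)

lemma integrable_powr: "0 < L \<Longrightarrow> set_integrable lebesgue (gbox \<beta> c L) (\<lambda>x. w x powr p)"
  and integrable_dual: "0 < L \<Longrightarrow> set_integrable lebesgue (gbox \<beta> c L) (\<lambda>x. w x powr - conj_exp p)"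
  using w gbox_in_gamma_cubes[OF beta] by (auto simp: A_class_def)

lemma emeasure_gbox_neq_0: "0 < L \<Longrightarrow> emeasure lebesgue (gbox \<beta> c L) \<noteq> 0"
proof
  assume "0 < L" "emeasure lebesgue (gbox \<beta> c L) = 0"
  then show False using measure_lebesgue_gbox[of L \<beta> c] by (simp add: measure_def)
qed

lemma powr_mass_pos: "0 < L \<Longrightarrow> 0 < (LINT x:gbox \<beta> c L|lebesgue. w x powr p)"
  and dual_mass_pos: "0 < L \<Longrightarrow> 0 < (LINT x:gbox \<beta> c L|lebesgue. w x powr - conj_exp p)"
proof -
  have 1: "AE x in lebesgue. 0 < w x powr r" for r using AE_pos by eventually_elim simp
  show "0 < L \<Longrightarrow> 0 < (LINT x:gbox \<beta> c L|lebesgue. w x powr p)"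
    by (intro set_integral_pos integrable_powr 1 emeasure_gbox_neq_0) auto
  show "0 < L \<Longrightarrow> 0 < (LINT x:gbox \<beta> c L|lebesgue. w x powr - conj_exp p)"
    by (intro set_integral_pos integrable_dual 1 emeasure_gbox_neq_0) auto
qed

text \<open>The outer exponents 1/p and 1/p' add up to 1, so passing from averages to integrals
  costs exactly one factor |Q| = L^|\<beta>|.\<close>

lemma A_bound:
  obtains K where "0 < K" "\<And>c L. 0 < L \<Longrightarrow>
    (LINT x:gbox \<beta> c L|lebesgue. w x powr p) powr (1 / p) *
    (LINT x:gbox \<beta> c L|lebesgue. w x powr - conj_exp p) powr (1 / conj_exp p) \<le> K * L powr exponent_size \<beta>"
proof -
  from w obtain K where K: "\<And>Q. Q \<in> gamma_cubes \<beta> \<Longrightarrow>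
     average Q (\<lambda>x. w x powr p) powr (1 / p) * average Q (\<lambda>x. w x powr - conj_exp p) powr (1 / conj_exp p) \<le> K"
    by (auto simp: A_class_def bdd_above_def)
  show ?thesis
  proof (rule that[of "max K 1"])
    fix c L assume L: "0 < (L::real)"
    define Q where "Q = gbox \<beta> c L"
    define m where "m = L powr exponent_size \<beta>"
    have m: "0 < m" "measure lebesgue Q = m" using measure_lebesgue_gbox[OF L] L by (auto simp: m_def Q_def)
    define A where "A = (LINT x:Q|lebesgue. w x powr p)"
    define B where "B = (LINT x:Q|lebesgue. w x powr - conj_exp p)"
    have AB: "0 < A" "0 < B" using powr_mass_pos[OF L] dual_mass_pos[OF L] by (auto simp: A_def B_def Q_def)
    have "Q \<in> gamma_cubes \<beta>" using gbox_in_gamma_cubes[OF beta L] by (simp add: Q_def)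
    from K[OF this] have "(A / m) powr (1 / p) * (B / m) powr (1 / conj_exp p) \<le> K"
      by (simp add: average_def m A_def B_def)
    also have "(A / m) powr (1 / p) * (B / m) powr (1 / conj_exp p) =
       A powr (1 / p) * B powr (1 / conj_exp p) / (m powr (1 / p) * m powr (1 / conj_exp p))"
      using AB m by (simp add: powr_divide)
    also have "m powr (1 / p) * m powr (1 / conj_exp p) = m"
      using m conj_exp_inverse[OF p] by (simp flip: powr_add)
    finally have "A powr (1 / p) * B powr (1 / conj_exp p) \<le> K * m"
      using m by (simp add: field_simps)
    also have "\<dots> \<le> max K 1 * m" using m by (intro mult_right_mono) auto
    finally show "(LINT x:gbox \<beta> c L|lebesgue. w x powr p) powr (1 / p) *
      (LINT x:gbox \<beta> c L|lebesgue. w x powr - conj_exp p) powr (1 / conj_exp p) \<le> max K 1 * L powr exponent_size \<beta>"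
      by (simp add: A_def B_def Q_def m_def)
  qed simp
qed

text \<open>For a smaller cube \<open>E\<close>, this is the doubling property of the dual weight.\<close>

lemma dual_mass_subset:
  obtains K where "0 < K" "\<And>c L E. 0 < L \<Longrightarrow> E \<in> sets lebesgue \<Longrightarrow> E \<subseteq> gbox \<beta> c L \<Longrightarrow>
    (measure lebesgue E / L powr exponent_size \<beta>) powr conj_exp p * (LINT x:gbox \<beta> c L|lebesgue. w x powr - conj_exp p)
     \<le> K * (LINT x:E|lebesgue. w x powr - conj_exp p)"
proof -
  obtain K where K: "0 < K" "\<And>c L. 0 < L \<Longrightarrow>
    (LINT x:gbox \<beta> c L|lebesgue. w x powr p) powr (1 / p) *
    (LINT x:gbox \<beta> c L|lebesgue. w x powr - conj_exp p) powr (1 / conj_exp p) \<le> K * L powr exponent_size \<beta>"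
    using A_bound by blast
  define q where "q = conj_exp p"
  have q: "1 < q" using conj_exp_gt_1[OF p] by (simp add: q_def)
  show ?thesis
  proof (rule that[of "K powr q"])
    show "0 < K powr q" using K by simp
    fix c L E assume L: "0 < (L::real)" and E[measurable]: "E \<in> sets lebesgue" and EQ: "E \<subseteq> gbox \<beta> c L"
    define Q where "Q = gbox \<beta> c L"
    define m where "m = L powr exponent_size \<beta>"
    have m: "0 < m" using L by (simp add: m_def)
    define A where "A = (LINT x:Q|lebesgue. w x powr p)"
    define B where "B = (LINT x:Q|lebesgue. w x powr - q)"
    define S where "S = (LINT x:E|lebesgue. w x powr - q)"
    have AB: "0 < A" "0 < B" using powr_mass_pos[OF L] dual_mass_pos[OF L] by (auto simp: A_def B_def Q_def q_def)
    have iE: "set_integrable lebesgue E (\<lambda>x. w x powr p)" "set_integrable lebesgue E (\<lambda>x. w x powr - q)"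
      using set_integrable_subset[OF integrable_powr[OF L, of c] E EQ]
        set_integrable_subset[OF integrable_dual[OF L, of c] E EQ] by (auto simp: q_def)
    have S0: "0 \<le> S" unfolding S_def by (simp add: set_lebesgue_integral_def)
    have "E \<in> lmeasurable" using fmeasurableI2[OF gbox_lmeasurable EQ E] .
    \<comment> \<open>Hoelder for the constant 1 on \<open>E\<close> bounds |E| by the masses of w^p
      and w^(-p') on \<open>E\<close>. After enlarging the first to \<open>Q\<close>, the A_p
      condition trades it for the reciprocal of the dual mass of \<open>Q\<close>.\<close>
    then have "measure lebesgue E = (LINT x:E|lebesgue. cmod 1)" by (simp add: set_lebesgue_integral_def)
    also have "\<dots> \<le> (LINT x:E|lebesgue. (cmod 1 * w x) powr p) powr (1 / p) * S powr (1 / q)"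
      unfolding S_def q_def
      by (rule weighted_Holder(2)[OF p]) (use iE AE_pos in \<open>auto simp: q_def\<close>)
    also have "\<dots> \<le> A powr (1 / p) * S powr (1 / q)"
    proof (intro mult_right_mono powr_mono2)
      show "(LINT x:E|lebesgue. (cmod 1 * w x) powr p) \<le> A"
        unfolding A_def Q_def norm_one mult_1
        by (rule set_integral_mono_subset[OF integrable_powr[OF L] _ E EQ]) simp
    qed (use p S0 in \<open>auto simp: set_lebesgue_integral_def\<close>)
    finally have le: "measure lebesgue E \<le> A powr (1 / p) * S powr (1 / q)" .
    have "A powr (1 / p) * B powr (1 / q) \<le> K * m" using K(2)[OF L, of c] by (simp add: A_def B_def Q_def m_def q_def)
    then have "A powr (1 / p) \<le> K * m / B powr (1 / q)" using AB by (simp add: field_simps)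
    then have "A powr (1 / p) * S powr (1 / q) \<le> K * m / B powr (1 / q) * S powr (1 / q)"
      by (intro mult_right_mono) auto
    with le have "measure lebesgue E \<le> K * m / B powr (1 / q) * S powr (1 / q)" by simp
    then have "measure lebesgue E / m * B powr (1 / q) \<le> K * S powr (1 / q)"
      using AB m by (simp add: field_simps)
    then have "(measure lebesgue E / m * B powr (1 / q)) powr q \<le> (K * S powr (1 / q)) powr q"
      using m q by (intro powr_mono2) auto
    moreover have "(measure lebesgue E / m * B powr (1 / q)) powr q = (measure lebesgue E / m) powr q * B"
      using AB m q by (subst powr_mult) (auto simp: powr_powr)
    moreover have "(K * S powr (1 / q)) powr q = K powr q * S"
      using K(1) S0 q by (subst powr_mult) (auto simp: powr_powr)
    ultimately have "(measure lebesgue E / m) powr q * B \<le> K powr q * S" by simp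
    then show "(measure lebesgue E / L powr exponent_size \<beta>) powr conj_exp p * (LINT x:gbox \<beta> c L|lebesgue. w x powr - conj_exp p)
     \<le> K powr q * (LINT x:E|lebesgue. w x powr - conj_exp p)"
      by (simp add: m_def B_def S_def Q_def q_def)
  qed
qed

end


section \<open>Mass of large cubes and normalized means\<close>

context A_weight
begin

lemma dual_mass_mono:
  assumes "0 < L" "E \<in> sets lebesgue" "E \<subseteq> gbox \<beta> c L"
  shows "(LINT x:E|lebesgue. w x powr - conj_exp p) \<le> (LINT x:gbox \<beta> c L|lebesgue. w x powr - conj_exp p)"
  by (rule set_integral_mono_subset[OF integrable_dual[OF assms(1)] _ assms(2,3)]) simp

text \<open>The 3 counts half sides: from the centre of a box to a common point, from there to the
  origin, and from the origin to a point of another centred box, all of side at most L.\<close>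

lemma scale_exists:
  obtains N where "1 \<le> N" "3 \<le> N powr fst \<beta>" "3 \<le> N powr snd \<beta>"
proof (rule that[of "3 powr (1 / fst \<beta>) + 3 powr (1 / snd \<beta>)"])
  have a: "1 \<le> (3::real) powr (1 / fst \<beta>)" using beta by (simp add: ge_one_powr_ge_zero)
  then show "1 \<le> (3::real) powr (1 / fst \<beta>) + 3 powr (1 / snd \<beta>)" by (simp add: add_increasing2)
  have "((3::real) powr (1 / fst \<beta>)) powr fst \<beta> \<le> (3 powr (1 / fst \<beta>) + 3 powr (1 / snd \<beta>)) powr fst \<beta>"
    using beta by (intro powr_mono2) auto
  then show "3 \<le> ((3::real) powr (1 / fst \<beta>) + 3 powr (1 / snd \<beta>)) powr fst \<beta>"
    using beta by (simp add: powr_powr)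
  have "((3::real) powr (1 / snd \<beta>)) powr snd \<beta> \<le> (3 powr (1 / fst \<beta>) + 3 powr (1 / snd \<beta>)) powr snd \<beta>"
    using beta by (intro powr_mono2) auto
  then show "3 \<le> ((3::real) powr (1 / fst \<beta>) + 3 powr (1 / snd \<beta>)) powr snd \<beta>"
    using beta by (simp add: powr_powr)
qed

text \<open>Each shell between consecutive centred cubes fills at least half of the larger one, so
  \<open>dual_mass_subset\<close> gives it a fixed fraction of that cube's dual mass, hence at least
  a fixed multiple of the mass of the first cube. The masses therefore grow at least linearly in the
  number of shells.\<close>

lemma dual_mass_centered_unbounded:
  obtains L where "0 < L" "B \<le> (LINT x:gbox \<beta> 0 L|lebesgue. w x powr - conj_exp p)"
proof -
  obtain N where N: "1 \<le> N" "3 \<le> N powr fst \<beta>" "3 \<le> N powr snd \<beta>" by (rule scale_exists)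
  obtain K where K: "0 < K" "\<And>c L E. 0 < L \<Longrightarrow> E \<in> sets lebesgue \<Longrightarrow> E \<subseteq> gbox \<beta> c L \<Longrightarrow>
    (measure lebesgue E / L powr exponent_size \<beta>) powr conj_exp p * (LINT x:gbox \<beta> c L|lebesgue. w x powr - conj_exp p)
     \<le> K * (LINT x:E|lebesgue. w x powr - conj_exp p)"
    using dual_mass_subset by blast
  define Q where "Q j = gbox \<beta> 0 (N ^ j)" for j :: nat
  define S where "S j = (LINT x:Q j|lebesgue. w x powr - conj_exp p)" for j
  have Npos: "0 < N ^ j" for j using N by simp
  have Qsub: "Q j \<subseteq> Q (Suc j)" for j unfolding Q_def using gbox_mono[OF beta Npos N(1), of 0 j] by simp
  have S0: "S 0 \<le> S j" for j
  proof (induction j)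
    case (Suc j)
    have "S j \<le> S (Suc j)" unfolding S_def using Qsub[of j]
      by (simp add: Q_def) (rule dual_mass_mono; use N in simp)
    with Suc show ?case by simp
  qed simp
  have S0pos: "0 < S 0" unfolding S_def Q_def by (rule dual_mass_pos) simp
  define a where "a = (1 / 2) powr conj_exp p * S 0 / K"
  have a: "0 < a" using S0pos K by (simp add: a_def)
  have step: "S j + a \<le> S (Suc j)" for j
  proof -
    define E where "E = Q (Suc j) - Q j"
    have E[measurable]: "E \<in> sets lebesgue" "E \<subseteq> Q (Suc j)" by (auto simp: E_def Q_def)
    have mQ: "measure lebesgue (Q i) = (N ^ i) powr exponent_size \<beta>" for i
      unfolding Q_def by (rule measure_lebesgue_gbox[OF Npos])
    have "measure lebesgue E = measure lebesgue (Q (Suc j)) - measure lebesgue (Q j)"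
      unfolding E_def using Qsub by (intro measurable_measure_Diff) (auto simp: Q_def)
    moreover have "measure lebesgue (Q (Suc j)) = N powr exponent_size \<beta> * measure lebesgue (Q j)"
      unfolding mQ using N by (simp add: powr_mult)
    moreover have "2 \<le> N powr exponent_size \<beta>"
    proof -
      have "3 * 3 \<le> N powr fst \<beta> * N powr snd \<beta>" using N by (intro mult_mono) auto
      then show ?thesis by (simp add: exponent_size_def powr_add)
    qed
    then have "2 * measure lebesgue (Q j) \<le> N powr exponent_size \<beta> * measure lebesgue (Q j)"
      by (intro mult_right_mono) auto
    ultimately have "1 / 2 * measure lebesgue (Q (Suc j)) \<le> measure lebesgue E" by simp
    then have half: "1 / 2 \<le> measure lebesgue E / (N ^ Suc j) powr exponent_size \<beta>"
    proof -
      have pp: "0 < (N ^ Suc j) powr exponent_size \<beta>" using Npos[of "Suc j"] N by simp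
      assume "1 / 2 * measure lebesgue (Q (Suc j)) \<le> measure lebesgue E"
      then show ?thesis unfolding pos_le_divide_eq[OF pp] mQ .
    qed
    have "a * K = (1 / 2) powr conj_exp p * S 0" using K by (simp add: a_def)
    also have "\<dots> \<le> (measure lebesgue E / (N ^ Suc j) powr exponent_size \<beta>) powr conj_exp p * S (Suc j)"
      using half S0[of "Suc j"] S0pos conj_exp_gt_1[OF p] by (intro mult_mono powr_mono2) auto
    also have "\<dots> \<le> K * (LINT x:E|lebesgue. w x powr - conj_exp p)"
      unfolding S_def Q_def using E unfolding Q_def by (intro K(2) Npos)
    finally have "a \<le> (LINT x:E|lebesgue. w x powr - conj_exp p)" using K by (simp add: mult.commute)
    moreover have "S (Suc j) = S j + (LINT x:E|lebesgue. w x powr - conj_exp p)"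
    proof -
      have u: "Q (Suc j) = Q j \<union> E" "Q j \<inter> E = {}" using Qsub by (auto simp: E_def)
      have iE: "set_integrable lebesgue E (\<lambda>x. w x powr - conj_exp p)"
        using E integrable_dual[OF Npos[of "Suc j"], of 0] unfolding Q_def by (auto intro: set_integrable_subset)
      have iQ: "set_integrable lebesgue (Q j) (\<lambda>x. w x powr - conj_exp p)"
        unfolding Q_def by (rule integrable_dual[OF Npos])
      show ?thesis unfolding S_def u(1) by (rule set_integral_Un[OF u(2) iQ iE])
    qed
    ultimately show ?thesis by simp
  qed
  have lin: "real j * a \<le> S j" for j
  proof (induction j)
    case 0
    then show ?case using S0pos by simp
  next
    case (Suc j)
    then show ?case using step[of j] by (simp add: algebra_simps)
  qed
  obtain j :: nat where "B / a \<le> real j" using real_arch_simple by blast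
  then have "B \<le> real j * a" using a by (simp add: field_simps)
  with lin[of j] have "B \<le> S j" by simp
  then show ?thesis using that[of "N ^ j"] Npos by (simp add: S_def Q_def)
qed

text \<open>Once L is large, the dilate by \<open>N\<close> of a cube meeting the fixed box contains
  a centred cube of prescribed mass, wherever its centre is. Doubling brings the lower bound back
  from the dilate to the cube.\<close>

lemma dual_mass_large:
  assumes R: "0 < R"
  obtains r where "0 < r" "\<And>c L. r \<le> L \<Longrightarrow> gbox \<beta> c L \<inter> gbox \<beta> 0 R \<noteq> {} \<Longrightarrow>
    B \<le> (LINT x:gbox \<beta> c L|lebesgue. w x powr - conj_exp p)"
proof -
  obtain N where N: "1 \<le> N" "3 \<le> N powr fst \<beta>" "3 \<le> N powr snd \<beta>" by (rule scale_exists)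
  obtain K where K: "0 < K" "\<And>c L E. 0 < L \<Longrightarrow> E \<in> sets lebesgue \<Longrightarrow> E \<subseteq> gbox \<beta> c L \<Longrightarrow>
    (measure lebesgue E / L powr exponent_size \<beta>) powr conj_exp p * (LINT x:gbox \<beta> c L|lebesgue. w x powr - conj_exp p)
     \<le> K * (LINT x:E|lebesgue. w x powr - conj_exp p)"
    using dual_mass_subset by blast
  define a where "a = (1 / N powr exponent_size \<beta>) powr conj_exp p"
  have a: "0 < a" using N by (simp add: a_def)
  obtain L0 where L0: "0 < L0" "K * B / a \<le> (LINT x:gbox \<beta> 0 L0|lebesgue. w x powr - conj_exp p)"
    by (rule dual_mass_centered_unbounded)
  show ?thesis
  proof (rule that[of "max L0 R"])
    show "0 < max L0 R" using L0 by simp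
    fix c L assume L: "max L0 R \<le> L" and ne: "gbox \<beta> c L \<inter> gbox \<beta> 0 R \<noteq> {}"
    have Lpos: "0 < L" using L L0 by simp
    have LN: "0 < N * L" using Lpos N by simp
    obtain y where y: "y \<in> gbox \<beta> c L" "y \<in> gbox \<beta> 0 R" using ne by auto
    have Rmono: "R powr e \<le> L powr e" if "0 < e" for e :: real
      using that L R by (intro powr_mono2) auto
    have sub: "gbox \<beta> 0 L0 \<subseteq> gbox \<beta> c (N * L)"
    proof
      fix z assume z: "z \<in> gbox \<beta> 0 L0"
      have 1: "L0 powr fst \<beta> \<le> L powr fst \<beta>" "L0 powr snd \<beta> \<le> L powr snd \<beta>"
        using L L0 beta by (auto intro!: powr_mono2)
      have 2: "(N * L) powr fst \<beta> = N powr fst \<beta> * L powr fst \<beta>" "(N * L) powr snd \<beta> = N powr snd \<beta> * L powr snd \<beta>"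
        using N Lpos by (auto simp: powr_mult)
      have 3: "3 * L powr fst \<beta> \<le> N powr fst \<beta> * L powr fst \<beta>" "3 * L powr snd \<beta> \<le> N powr snd \<beta> * L powr snd \<beta>"
        using N by (auto intro!: mult_right_mono)
      have y': "\<bar>fst y - fst c\<bar> \<le> L powr fst \<beta> / 2" "\<bar>snd y - snd c\<bar> \<le> L powr snd \<beta> / 2"
        "\<bar>fst y\<bar> \<le> R powr fst \<beta> / 2" "\<bar>snd y\<bar> \<le> R powr snd \<beta> / 2"
        "\<bar>fst z\<bar> \<le> L0 powr fst \<beta> / 2" "\<bar>snd z\<bar> \<le> L0 powr snd \<beta> / 2"
        using y z by (auto simp: mem_gbox)
      show "z \<in> gbox \<beta> c (N * L)"
        unfolding mem_gbox 2 using y' 1 3 Rmono[OF beta(1)] Rmono[OF beta(2)] by linarith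
    qed
    have "K * B / a \<le> (LINT x:gbox \<beta> c (N * L)|lebesgue. w x powr - conj_exp p)"
      by (rule order_trans[OF L0(2) dual_mass_mono[OF LN _ sub]]) simp
    then have "K * B \<le> a * (LINT x:gbox \<beta> c (N * L)|lebesgue. w x powr - conj_exp p)"
      using a by (simp add: field_simps)
    also have "a = (measure lebesgue (gbox \<beta> c L) / (N * L) powr exponent_size \<beta>) powr conj_exp p"
      unfolding a_def measure_lebesgue_gbox[OF Lpos] using N Lpos by (simp add: powr_mult)
    also have "\<dots> * (LINT x:gbox \<beta> c (N * L)|lebesgue. w x powr - conj_exp p) \<le> K * (LINT x:gbox \<beta> c L|lebesgue. w x powr - conj_exp p)"
      by (rule K(2)[OF LN]) (use gbox_mono[OF beta Lpos N(1)] in auto)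
    finally show "B \<le> (LINT x:gbox \<beta> c L|lebesgue. w x powr - conj_exp p)" using K by simp
  qed
qed

end

text \<open>Truncate \<Phi> at height n: the excess has small integral by dominated convergence, and
  the bounded part contributes at most n |X|.\<close>

lemma integral_small_on_small_sets:
  fixes \<Phi> :: "'a::euclidean_space \<Rightarrow> real"
  assumes \<Phi>: "integrable lebesgue \<Phi>" and nn: "\<And>x. 0 \<le> \<Phi> x" and e: "0 < e"
  obtains d where "0 < d" "\<And>X. X \<in> lmeasurable \<Longrightarrow> measure lebesgue X \<le> d \<Longrightarrow> (LINT x:X|lebesgue. \<Phi> x) < e"
proof -
  have [measurable]: "\<Phi> \<in> borel_measurable lebesgue" using \<Phi> by auto
  have "(\<lambda>n. LINT x|lebesgue. \<Phi> x - min (\<Phi> x) (real n)) \<longlonglongrightarrow> (LINT x|(lebesgue :: 'a measure). (0::real))"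
  proof (rule integral_dominated_convergence[where w=\<Phi>])
    show "AE x in lebesgue. (\<lambda>n. \<Phi> x - min (\<Phi> x) (real n)) \<longlonglongrightarrow> 0"
    proof (rule AE_I2)
      fix x
      obtain n0 :: nat where "\<Phi> x \<le> real n0" using real_arch_simple by blast
      then show "(\<lambda>n. \<Phi> x - min (\<Phi> x) (real n)) \<longlonglongrightarrow> 0"
        by (intro tendsto_eventually) (auto simp: eventually_sequentially intro!: exI[of _ n0])
    qed
  qed (use nn \<Phi> in auto)
  then have "eventually (\<lambda>n. (LINT x|lebesgue. \<Phi> x - min (\<Phi> x) (real n)) < e / 2) sequentially"
    by (rule order_tendstoD) (use e in simp)
  then obtain n where n: "(LINT x|lebesgue. \<Phi> x - min (\<Phi> x) (real n)) < e / 2"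
    by (auto simp: eventually_sequentially)
  show ?thesis
  proof (rule that[of "e / (2 * (real n + 1))"])
    fix X :: "'a set" assume X: "X \<in> lmeasurable" "measure lebesgue X \<le> e / (2 * (real n + 1))"
    then have [measurable]: "X \<in> sets lebesgue" by auto
    have m: "integrable lebesgue (\<lambda>x. min (\<Phi> x) (real n))"
      by (rule Bochner_Integration.integrable_bound[OF \<Phi>]) (use nn in \<open>auto simp: min_def\<close>)
    have iX: "integrable lebesgue (\<lambda>x. indicator X x * real n)" using X by (auto simp: fmeasurable_def)
    have i1: "integrable lebesgue (\<lambda>x. \<Phi> x - min (\<Phi> x) (real n))" using \<Phi> m by simp
    have "(LINT x:X|lebesgue. \<Phi> x) \<le> (LINT x|lebesgue. (\<Phi> x - min (\<Phi> x) (real n)) + indicator X x * real n)"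
      unfolding set_lebesgue_integral_def
      using integrable_mult_indicator[OF \<open>X \<in> sets lebesgue\<close> \<Phi>] i1 iX
      by (intro integral_mono) (use nn in \<open>auto simp: indicator_def min_def\<close>)
    also have "\<dots> = (LINT x|lebesgue. \<Phi> x - min (\<Phi> x) (real n)) + measure lebesgue X * real n"
      using X by (subst Bochner_Integration.integral_add[OF i1 iX]) simp
    also have "measure lebesgue X * real n \<le> e / (2 * (real n + 1)) * real n"
      using X by (intro mult_right_mono) auto
    also have "\<dots> \<le> e / 2" using e by (simp add: field_simps)
    finally show "(LINT x:X|lebesgue. \<Phi> x) < e" using n by simp
  qed (use e in simp)
qed

lemma integral_small_outside_gbox:
  fixes \<Phi> :: "real \<times> real \<Rightarrow> real"
  assumes beta: "0 < fst \<beta>" "0 < snd \<beta>" and \<Phi>: "integrable lebesgue \<Phi>" and nn: "\<And>x. 0 \<le> \<Phi> x" and e: "0 < e"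
  obtains R where "0 < R" "(LINT x:- gbox \<beta> 0 R|lebesgue. \<Phi> x) < e"
proof -
  have [measurable]: "\<Phi> \<in> borel_measurable lebesgue" using \<Phi> by auto
  have "(\<lambda>n. LINT x|lebesgue. indicator (- gbox \<beta> 0 (real n)) x *\<^sub>R \<Phi> x) \<longlonglongrightarrow> (LINT x|(lebesgue :: (real \<times> real) measure). (0::real))"
  proof (rule integral_dominated_convergence[where w=\<Phi>])
    show "AE x in lebesgue. (\<lambda>n. indicator (- gbox \<beta> 0 (real n)) x *\<^sub>R \<Phi> x) \<longlonglongrightarrow> 0"
    proof (rule AE_I2)
      fix x :: "real \<times> real"
      have ev: "eventually (\<lambda>n. \<bar>y\<bar> \<le> real n powr s / 2) sequentially" if "0 < s" for y s :: real
      proof -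
        obtain n0 :: nat where n0: "(2 * \<bar>y\<bar>) powr (1 / s) \<le> real n0" using real_arch_simple by blast
        have "\<bar>y\<bar> \<le> real n powr s / 2" if "n0 \<le> n" for n
        proof -
          have "2 * \<bar>y\<bar> = ((2 * \<bar>y\<bar>) powr (1 / s)) powr s" using \<open>0 < s\<close> by (cases "y = 0") (auto simp: powr_powr)
          also have "\<dots> \<le> real n powr s" using n0 that \<open>0 < s\<close> by (intro powr_mono2) auto
          finally show ?thesis by simp
        qed
        then show ?thesis by (auto simp: eventually_sequentially)
      qed
      have "eventually (\<lambda>n. indicator (- gbox \<beta> 0 (real n)) x *\<^sub>R \<Phi> x = 0) sequentially"
        using ev[OF beta(1), of "fst x"] ev[OF beta(2), of "snd x"] by eventually_elim (simp add: mem_gbox)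
      then show "(\<lambda>n. indicator (- gbox \<beta> 0 (real n)) x *\<^sub>R \<Phi> x) \<longlonglongrightarrow> 0" by (rule tendsto_eventually)
    qed
    show "(\<lambda>x. indicator (- gbox \<beta> 0 (real n)) x *\<^sub>R \<Phi> x) \<in> borel_measurable lebesgue" for n
      by (intro borel_measurable_scaleR borel_measurable_indicator) auto
  qed (use nn \<Phi> in \<open>auto simp: indicator_def\<close>)
  then have "eventually (\<lambda>n. (LINT x:- gbox \<beta> 0 (real n)|lebesgue. \<Phi> x) < e) sequentially"
    unfolding set_lebesgue_integral_def by (rule order_tendstoD) (use e in simp)
  moreover have "eventually (\<lambda>n. 0 < real n) sequentially" by (auto simp: eventually_sequentially intro!: exI[of _ 1])
  ultimately have "eventually (\<lambda>n. 0 < real n \<and> (LINT x:- gbox \<beta> 0 (real n)|lebesgue. \<Phi> x) < e) sequentially"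
    by eventually_elim simp
  then obtain n where "0 < real n" "(LINT x:- gbox \<beta> 0 (real n)|lebesgue. \<Phi> x) < e" by (auto simp: eventually_sequentially)
  then show ?thesis using that by blast
qed

section \<open>Means of a fixed function over small, large and distant cubes\<close>

context A_weight
begin

text \<open>With this normalization Hoelder bounds the mean by the norm of h in L^p_w over the cube
  alone, so it is controlled by the mass of |h w|^p there.\<close>

definition dual_mean :: "(real \<times> real \<Rightarrow> complex) \<Rightarrow> real \<times> real \<Rightarrow> real \<Rightarrow> real" where
  "dual_mean h c L = (LINT x:gbox \<beta> c L|lebesgue. cmod (h x)) /
      (LINT x:gbox \<beta> c L|lebesgue. w x powr - conj_exp p) powr (1 / conj_exp p)"

lemma Lp_Holder:
  assumes h: "h \<in> Lp_space p w" and X: "X \<in> sets lebesgue" "X \<subseteq> gbox \<beta> c L" and L: "0 < L"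
  shows "set_integrable lebesgue X (\<lambda>x. cmod (h x))"
    and "(LINT x:X|lebesgue. cmod (h x)) \<le> (LINT x:X|lebesgue. (cmod (h x) * w x) powr p) powr (1 / p) *
      (LINT x:gbox \<beta> c L|lebesgue. w x powr - conj_exp p) powr (1 / conj_exp p)"
proof -
  have hm: "h \<in> borel_measurable lebesgue" and hi: "integrable lebesgue (\<lambda>x. (cmod (h x) * w x) powr p)"
    using h by (auto simp: Lp_space_def)
  have 1: "set_integrable lebesgue X (\<lambda>x. (cmod (h x) * w x) powr p)"
    unfolding set_integrable_def by (rule integrable_mult_indicator[OF X(1) hi])
  have 2: "set_integrable lebesgue X (\<lambda>x. w x powr - conj_exp p)"
    by (rule set_integrable_subset[OF integrable_dual[OF L] X])
  note H = weighted_Holder[OF p hm measurable_weight X(1) AE_pos 1 2]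
  show "set_integrable lebesgue X (\<lambda>x. cmod (h x))" by (rule H(1))
  note H(2)
  also have "(LINT x:X|lebesgue. (cmod (h x) * w x) powr p) powr (1 / p) * (LINT x:X|lebesgue. w x powr - conj_exp p) powr (1 / conj_exp p)
    \<le> (LINT x:X|lebesgue. (cmod (h x) * w x) powr p) powr (1 / p) *
      (LINT x:gbox \<beta> c L|lebesgue. w x powr - conj_exp p) powr (1 / conj_exp p)"
    using conj_exp_gt_1[OF p] dual_mass_mono[OF L X]
    by (intro mult_left_mono powr_mono2) (auto simp: set_lebesgue_integral_def)
  finally show "(LINT x:X|lebesgue. cmod (h x)) \<le> (LINT x:X|lebesgue. (cmod (h x) * w x) powr p) powr (1 / p) *
      (LINT x:gbox \<beta> c L|lebesgue. w x powr - conj_exp p) powr (1 / conj_exp p)" .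
qed

lemma dual_mean_le:
  assumes h: "h \<in> Lp_space p w" and L: "0 < L"
  shows "dual_mean h c L \<le> (LINT x:gbox \<beta> c L|lebesgue. (cmod (h x) * w x) powr p) powr (1 / p)"
  unfolding dual_mean_def using Lp_Holder(2)[OF h _ subset_refl L, of c] dual_mass_pos[OF L, of c]
  by (simp add: field_simps)

lemma dual_mean_le_Lp_norm:
  assumes h: "h \<in> Lp_space p w" and L: "0 < L"
  shows "dual_mean h c L \<le> Lp_norm p w h"
proof -
  have hi: "integrable lebesgue (\<lambda>x. (cmod (h x) * w x) powr p)" using h by (auto simp: Lp_space_def)
  have "(LINT x:gbox \<beta> c L|lebesgue. (cmod (h x) * w x) powr p) \<le> (LINT x|lebesgue. (cmod (h x) * w x) powr p)"
    unfolding set_lebesgue_integral_def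
    by (intro integral_mono integrable_mult_indicator hi) (auto simp: indicator_def)
  then have "(LINT x:gbox \<beta> c L|lebesgue. (cmod (h x) * w x) powr p) powr (1 / p) \<le> Lp_norm p w h"
    unfolding Lp_norm_def using p by (intro powr_mono2) (auto simp: set_lebesgue_integral_def)
  with dual_mean_le[OF h L, of c] show ?thesis by simp
qed

lemma powr_less_root:
  assumes "0 \<le> x" "x < e powr p" "0 < e"
  shows "x powr (1 / p) < e"
proof -
  have "x powr (1 / p) < (e powr p) powr (1 / p)" using assms p by (intro powr_less_mono2) auto
  then show ?thesis using assms p by (simp add: powr_powr)
qed

lemma dual_mean_small:
  assumes h: "h \<in> Lp_space p w" and e: "0 < e"
  obtains r where "0 < r" "\<And>c L. 0 < L \<Longrightarrow> L \<le> r \<Longrightarrow> dual_mean h c L < e"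
proof -
  have hi: "integrable lebesgue (\<lambda>x. (cmod (h x) * w x) powr p)" using h by (auto simp: Lp_space_def)
  obtain d where d: "0 < d" "\<And>X. X \<in> lmeasurable \<Longrightarrow> measure lebesgue X \<le> d \<Longrightarrow> (LINT x:X|lebesgue. (cmod (h x) * w x) powr p) < e powr p"
    by (rule integral_small_on_small_sets[OF hi, of "e powr p"]) (use e in auto)
  have es: "0 < exponent_size \<beta>" using beta by (simp add: exponent_size_def)
  show ?thesis
  proof (rule that[of "d powr (1 / exponent_size \<beta>)"])
    show "0 < d powr (1 / exponent_size \<beta>)" using d by simp
    fix c L assume L: "0 < L" "L \<le> d powr (1 / exponent_size \<beta>)"
    have "L powr exponent_size \<beta> \<le> (d powr (1 / exponent_size \<beta>)) powr exponent_size \<beta>"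
      using L es by (intro powr_mono2) auto
    then have "measure lebesgue (gbox \<beta> c L) \<le> d"
      using measure_lebesgue_gbox[OF L(1)] es d by (simp add: powr_powr)
    from d(2)[OF gbox_lmeasurable this] have "(LINT x:gbox \<beta> c L|lebesgue. (cmod (h x) * w x) powr p) powr (1 / p) < e"
      using e by (intro powr_less_root) (auto simp: set_lebesgue_integral_def)
    with dual_mean_le[OF h L(1), of c] show "dual_mean h c L < e" by simp
  qed
qed

text \<open>The tail estimate is kept beside its consequence for disjoint cubes, because large cubes
  that meet the box are split along it.\<close>

lemma dual_mean_outside:
  assumes h: "h \<in> Lp_space p w" and e: "0 < e"
  obtains R where "0 < R" "(LINT x:- gbox \<beta> 0 R|lebesgue. (cmod (h x) * w x) powr p) powr (1 / p) < e"
    "\<And>c L. 0 < L \<Longrightarrow> gbox \<beta> c L \<inter> gbox \<beta> 0 R = {} \<Longrightarrow> dual_mean h c L < e"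
proof -
  have hi: "integrable lebesgue (\<lambda>x. (cmod (h x) * w x) powr p)" using h by (auto simp: Lp_space_def)
  obtain R where R: "0 < R" "(LINT x:- gbox \<beta> 0 R|lebesgue. (cmod (h x) * w x) powr p) < e powr p"
    by (rule integral_small_outside_gbox[OF beta hi, of "e powr p"]) (use e in auto)
  have sm: "(LINT x:- gbox \<beta> 0 R|lebesgue. (cmod (h x) * w x) powr p) powr (1 / p) < e"
    using e R by (intro powr_less_root) (auto simp: set_lebesgue_integral_def)
  have iO: "set_integrable lebesgue (- gbox \<beta> 0 R) (\<lambda>x. (cmod (h x) * w x) powr p)"
    unfolding set_integrable_def by (rule integrable_mult_indicator[OF _ hi]) auto
  show ?thesis
  proof (rule that[OF R(1) sm])
    fix c L assume L: "0 < L" and "gbox \<beta> c L \<inter> gbox \<beta> 0 R = {}"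
    then have "(LINT x:gbox \<beta> c L|lebesgue. (cmod (h x) * w x) powr p) \<le> (LINT x:- gbox \<beta> 0 R|lebesgue. (cmod (h x) * w x) powr p)"
      by (intro set_integral_mono_subset[OF iO]) auto
    then have "(LINT x:gbox \<beta> c L|lebesgue. (cmod (h x) * w x) powr p) powr (1 / p) \<le> (LINT x:- gbox \<beta> 0 R|lebesgue. (cmod (h x) * w x) powr p) powr (1 / p)"
      using p by (intro powr_mono2) (auto simp: set_lebesgue_integral_def)
    with sm dual_mean_le[OF h L, of c] show "dual_mean h c L < e" by simp
  qed
qed

text \<open>A large cube may meet the box carrying most of h. The part inside contributes at most
  the fixed number \<open>H\<close>, which the growing dual mass outweighs; the part outside is a
  tail.\<close>

lemma dual_mean_large:
  assumes h: "h \<in> Lp_space p w" and e: "0 < e"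
  obtains r where "0 < r" "\<And>c L. r \<le> L \<Longrightarrow> dual_mean h c L < e"
proof -
  have e2: "0 < e / 2" using e by simp
  obtain R where R: "0 < R" "(LINT x:- gbox \<beta> 0 R|lebesgue. (cmod (h x) * w x) powr p) powr (1 / p) < e / 2"
    "\<And>c L. 0 < L \<Longrightarrow> gbox \<beta> c L \<inter> gbox \<beta> 0 R = {} \<Longrightarrow> dual_mean h c L < e / 2"
    by (rule dual_mean_outside[OF h e2]) blast
  have hi: "integrable lebesgue (\<lambda>x. (cmod (h x) * w x) powr p)" using h by (auto simp: Lp_space_def)
  define q where "q = conj_exp p"
  have q: "1 < q" using conj_exp_gt_1[OF p] by (simp add: q_def)
  define Z where "Z = gbox \<beta> 0 R"
  define H where "H = (LINT x:Z|lebesgue. cmod (h x))"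
  have H0: "0 \<le> H" by (simp add: H_def set_lebesgue_integral_def)
  \<comment> \<open>For dual mass at least \<open>B\<close> the denominator of the mean is at least
    2 H / e, so the inner part contributes at most e / 2.\<close>
  define B where "B = (2 * H / e) powr q"
  obtain r where r: "0 < r" "\<And>c L. r \<le> L \<Longrightarrow> gbox \<beta> c L \<inter> gbox \<beta> 0 R \<noteq> {} \<Longrightarrow>
    B \<le> (LINT x:gbox \<beta> c L|lebesgue. w x powr - conj_exp p)" by (rule dual_mass_large[OF R(1)]) blast
  show ?thesis
  proof (rule that[OF r(1)])
    fix c L assume rL: "r \<le> L"
    then have L: "0 < L" using r(1) by simp
    show "dual_mean h c L < e"
    proof (cases "gbox \<beta> c L \<inter> gbox \<beta> 0 R = {}")
      case True
      then show ?thesis using R(3)[OF L True] e by simp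
    next
      case False
      define X where "X = gbox \<beta> c L"
      define S where "S = (LINT x:X|lebesgue. w x powr - q) powr (1 / q)"
      have Xs[measurable]: "X \<in> sets lebesgue" "Z \<in> sets lebesgue" by (auto simp: X_def Z_def)
      have mpos: "0 < (LINT x:X|lebesgue. w x powr - q)" using dual_mass_pos[OF L, of c] by (simp add: X_def q_def)
      have S: "0 < S" using mpos by (simp add: S_def)
      have "2 * H / e \<le> S"
      proof -
        have "2 * H / e = B powr (1 / q)" using H0 e q by (simp add: B_def powr_powr)
        also have "\<dots> \<le> S" unfolding S_def using r(2)[OF rL False] q
          by (intro powr_mono2) (auto simp: B_def X_def q_def)
        finally show ?thesis .
      qed
      then have HS: "H \<le> e / 2 * S" using e by (simp add: field_simps)
      have subs: "X \<inter> Z \<subseteq> gbox \<beta> 0 R" "X - Z \<subseteq> gbox \<beta> c L" by (auto simp: X_def Z_def)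
      have i1: "set_integrable lebesgue (X \<inter> Z) (\<lambda>x. cmod (h x))" by (rule Lp_Holder(1)[OF h _ subs(1) R(1)]) auto
      have i2: "set_integrable lebesgue (X - Z) (\<lambda>x. cmod (h x))" by (rule Lp_Holder(1)[OF h _ subs(2) L]) auto
      have i3: "set_integrable lebesgue Z (\<lambda>x. cmod (h x))" by (rule Lp_Holder(1)[OF h _ _ R(1)]) (auto simp: Z_def)
      have "(LINT x:X|lebesgue. cmod (h x)) = (LINT x:(X \<inter> Z) \<union> (X - Z)|lebesgue. cmod (h x))"
        by (simp add: Int_Diff_Un)
      also have "\<dots> = (LINT x:X \<inter> Z|lebesgue. cmod (h x)) + (LINT x:X - Z|lebesgue. cmod (h x))"
        by (rule set_integral_Un[OF _ i1 i2]) auto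
      also have "(LINT x:X \<inter> Z|lebesgue. cmod (h x)) \<le> H"
        unfolding H_def by (rule set_integral_mono_subset[OF i3]) auto
      also have "(LINT x:X - Z|lebesgue. cmod (h x)) \<le> (LINT x:X - Z|lebesgue. (cmod (h x) * w x) powr p) powr (1 / p) * S"
        unfolding S_def X_def q_def by (rule Lp_Holder(2)[OF h _ _ L]) (auto simp: Z_def)
      also have "\<dots> \<le> (LINT x:- gbox \<beta> 0 R|lebesgue. (cmod (h x) * w x) powr p) powr (1 / p) * S"
      proof (intro mult_right_mono powr_mono2)
        have iO: "set_integrable lebesgue (- gbox \<beta> 0 R) (\<lambda>x. (cmod (h x) * w x) powr p)"
          unfolding set_integrable_def by (rule integrable_mult_indicator[OF _ hi]) auto
        show "(LINT x:X - Z|lebesgue. (cmod (h x) * w x) powr p) \<le> (LINT x:- gbox \<beta> 0 R|lebesgue. (cmod (h x) * w x) powr p)"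
          by (rule set_integral_mono_subset[OF iO]) (auto simp: Z_def)
      qed (use p S in \<open>auto simp: set_lebesgue_integral_def\<close>)
      also have "\<dots> < e / 2 * S" using R(2) S by (intro mult_strict_right_mono)
      finally have "(LINT x:X|lebesgue. cmod (h x)) < e * S" using HS by simp
      then show ?thesis using S unfolding dual_mean_def X_def[symmetric] q_def[symmetric] S_def[symmetric]
        by (simp add: field_simps)
    qed
  qed
qed

lemma dual_mean_far:
  assumes h: "h \<in> Lp_space p w" and e: "0 < e" and L: "0 < L"
  obtains r where "\<And>c. r \<le> norm c \<Longrightarrow> dual_mean h c L < e"
proof -
  obtain R where R: "0 < R" "\<And>c L. 0 < L \<Longrightarrow> gbox \<beta> c L \<inter> gbox \<beta> 0 R = {} \<Longrightarrow> dual_mean h c L < e"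
    by (rule dual_mean_outside[OF h e]) blast
  show ?thesis
  proof (rule that[of "L powr fst \<beta> + L powr snd \<beta> + R powr fst \<beta> + R powr snd \<beta>"])
    fix c :: "real \<times> real" assume c: "L powr fst \<beta> + L powr snd \<beta> + R powr fst \<beta> + R powr snd \<beta> \<le> norm c"
    have pos: "0 < L powr fst \<beta>" "0 < L powr snd \<beta>" "0 < R powr fst \<beta>" "0 < R powr snd \<beta>" using L R by auto
    have "gbox \<beta> c L \<inter> gbox \<beta> 0 R = {}"
    proof (rule ccontr)
      assume "gbox \<beta> c L \<inter> gbox \<beta> 0 R \<noteq> {}"
      then obtain y where "y \<in> gbox \<beta> c L" "y \<in> gbox \<beta> 0 R" by auto
      then have y: "\<bar>fst y - fst c\<bar> \<le> L powr fst \<beta> / 2" "\<bar>snd y - snd c\<bar> \<le> L powr snd \<beta> / 2"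
        "\<bar>fst y\<bar> \<le> R powr fst \<beta> / 2" "\<bar>snd y\<bar> \<le> R powr snd \<beta> / 2" by (auto simp: mem_gbox)
      have "norm c \<le> \<bar>fst c\<bar> + \<bar>snd c\<bar>" using norm_Pair_le[of "fst c" "snd c"] by simp
      with y c pos show False by linarith
    qed
    then show "dual_mean h c L < e" by (rule R(2)[OF L])
  qed
qed

end


section \<open>The two-weight bound\<close>

lemma set_integral_const_lebesgue:
  fixes k :: real
  assumes "A \<in> lmeasurable"
  shows "set_integrable lebesgue A (\<lambda>_. k)" "(LINT x:A|lebesgue. k) = k * measure lebesgue A"
  using assms by (auto simp: set_integrable_def set_lebesgue_integral_def fmeasurable_def mult.commute)

text \<open>Three-factor Hoelder for 1 = \<mu>^(-1/2) \<kappa>^(1/2) \<nu>^(\<theta>/2) bounds |Q|^2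
  by the masses of \<mu>^(-p'), \<kappa>^q and \<nu> to the powers 1/p', 1/q and \<theta>. The two A
  conditions turn the first two into reciprocals of the masses on the left-hand side, with the same
  power of |Q|.\<close>

lemma two_weight_bound:
  fixes \<mu> \<kappa> :: "real \<times> real \<Rightarrow> real"
  assumes "A_weight \<beta> p \<mu>" "A_weight \<beta> q \<kappa>" and N: "1 \<le> N"
    and \<theta>: "\<theta> = 1 / p + 1 / conj_exp q" and \<nu>: "\<nu> = (\<lambda>x. (\<mu> x / \<kappa> x) powr (1 / \<theta>))"
  obtains C where "0 < C"
    "\<And>c L. 0 < L \<Longrightarrow> 0 < (LINT x:gbox \<beta> c L|lebesgue. \<nu> x)"
    "\<And>c L. 0 < L \<Longrightarrow> (LINT x:gbox \<beta> c (N * L)|lebesgue. \<mu> x powr p) powr (1 / p) *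
      (LINT x:gbox \<beta> c (N * L)|lebesgue. \<kappa> x powr - conj_exp q) powr (1 / conj_exp q)
      \<le> C * (LINT x:gbox \<beta> c L|lebesgue. \<nu> x) powr \<theta>"
proof -
  interpret U: A_weight \<beta> p \<mu> by fact
  interpret K: A_weight \<beta> q \<kappa> by fact
  define p' where "p' = conj_exp p"
  define q' where "q' = conj_exp q"
  have p: "1 < p" "1 < q" "1 < p'" "1 < q'" "1 / p + 1 / p' = 1" "1 / q + 1 / q' = 1"
    using U.p K.p conj_exp_gt_1 conj_exp_inverse by (auto simp: p'_def q'_def)
  have \<theta>': "\<theta> = 1 / p + 1 / q'" by (simp add: \<theta> q'_def)
  have \<theta>0: "0 < \<theta>" using p by (simp add: \<theta>' add_pos_pos)
  have \<nu>m[measurable]: "\<nu> \<in> borel_measurable lebesgue" unfolding \<nu> by measurable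
  have \<nu>pos: "AE x in lebesgue. 0 < \<nu> x"
    using U.AE_pos K.AE_pos unfolding \<nu> by eventually_elim simp
  \<comment> \<open>This domination yields the local integrability of \<nu>. The exponents p
    \<theta> and q' \<theta> are conjugate since 1/p + 1/q' = \<theta>.\<close>
  have young: "(s / t) powr (1 / \<theta>) \<le> s powr p + t powr - q'" if "0 < s" "0 < t" for s t :: real
  proof -
    have h: "1 < p * \<theta>" "1 < q' * \<theta>" using p by (simp_all add: \<theta>' distrib_left)
    have "s powr (1 / \<theta>) * t powr (- 1 / \<theta>) \<le> (s powr (1 / \<theta>)) powr (p * \<theta>) / (p * \<theta>) + (t powr (- 1 / \<theta>)) powr (q' * \<theta>) / (q' * \<theta>)"
    proof (rule Youngs_inequality)
      show "1 < p * \<theta>" "1 < q' * \<theta>" by (rule h)+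
      have "1 / (p * \<theta>) + 1 / (q' * \<theta>) = (1 / p + 1 / q') / \<theta>" using p \<theta>0 by (simp add: field_simps)
      also have "\<dots> = 1" using \<theta>0 unfolding \<theta>'[symmetric] by simp
      finally show "1 / (p * \<theta>) + 1 / (q' * \<theta>) = 1" .
    qed auto
    also have "\<dots> = s powr p / (p * \<theta>) + t powr - q' / (q' * \<theta>)"
      using that \<theta>0 by (simp add: powr_powr)
    also have "\<dots> \<le> s powr p / 1 + t powr - q' / 1"
      using h by (intro add_mono divide_left_mono) auto
    finally show ?thesis
      using that powr_minus_divide[of t "1 / \<theta>"] by (simp add: powr_divide)
  qed
  have \<nu>int: "set_integrable lebesgue (gbox \<beta> c L) \<nu>" if "0 < L" for c L
  proof (rule set_integrable_bound)
    show "set_integrable lebesgue (gbox \<beta> c L) (\<lambda>x. \<mu> x powr p + \<kappa> x powr - q')"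
      unfolding q'_def by (intro set_integral_add U.integrable_powr K.integrable_dual that)
    show "set_borel_measurable lebesgue (gbox \<beta> c L) \<nu>"
      unfolding set_borel_measurable_def by (intro borel_measurable_scaleR borel_measurable_indicator \<nu>m) simp
    show "AE x in lebesgue. x \<in> gbox \<beta> c L \<longrightarrow> norm (\<nu> x) \<le> norm (\<mu> x powr p + \<kappa> x powr - q')"
      using U.AE_pos K.AE_pos
    proof eventually_elim
      case (elim x)
      then show ?case using young[of "\<mu> x" "\<kappa> x"] by (auto simp: \<nu>)
    qed
  qed
  have \<nu>mass: "0 < (LINT x:gbox \<beta> c L|lebesgue. \<nu> x)" if "0 < L" for c L
    by (intro set_integral_pos \<nu>int \<nu>pos U.emeasure_gbox_neq_0 that) auto
  have Holder3: "(L powr exponent_size \<beta>)\<^sup>2 \<le> (LINT x:gbox \<beta> c L|lebesgue. \<mu> x powr - p') powr (1 / p') *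
      (LINT x:gbox \<beta> c L|lebesgue. \<kappa> x powr q) powr (1 / q) * (LINT x:gbox \<beta> c L|lebesgue. \<nu> x) powr \<theta>"
    if L: "0 < L" for c L
  proof -
    define Q where "Q = gbox \<beta> c L"
    define m where "m = L powr exponent_size \<beta>"
    have m: "0 < m" "measure lebesgue Q = m" using L measure_lebesgue_gbox[OF L] by (auto simp: m_def Q_def)
    define a where "a = (LINT x:Q|lebesgue. \<mu> x powr - p')"
    define d where "d = (LINT x:Q|lebesgue. \<kappa> x powr q)"
    define n where "n = (LINT x:Q|lebesgue. \<nu> x)"
    have pos: "0 < a" "0 < d" "0 < n"
      using U.dual_mass_pos[OF L] K.powr_mass_pos[OF L] \<nu>mass[OF L] by (auto simp: a_def d_def n_def Q_def p'_def)
    \<comment> \<open>The exponents 1/p', 1/q and \<theta> add up to 2, so they are halved for the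
      inequality of means; this is the origin of the square of |Q|.\<close>
    define e1 where "e1 = 1 / (2 * p')"
    define e2 where "e2 = 1 / (2 * q)"
    define e3 where "e3 = \<theta> / 2"
    have e: "0 \<le> e1" "0 \<le> e2" "0 \<le> e3" using p \<theta>0 by (auto simp: e1_def e2_def e3_def)
    have "e1 + e2 + e3 = ((1 / p + 1 / p') + (1 / q + 1 / q')) / 2"
      by (simp add: e1_def e2_def e3_def \<theta>' add_divide_distrib)
    then have esum: "e1 + e2 + e3 = 1" using p by simp
    define A where "A = a powr e1 * d powr e2 * n powr e3"
    have A: "0 < A" using pos by (simp add: A_def)
    have ia: "set_integrable lebesgue Q (\<lambda>x. \<mu> x powr - p')" unfolding Q_def p'_def by (rule U.integrable_dual[OF L])
    have id: "set_integrable lebesgue Q (\<lambda>x. \<kappa> x powr q)" unfolding Q_def by (rule K.integrable_powr[OF L])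
    have iN: "set_integrable lebesgue Q \<nu>" unfolding Q_def by (rule \<nu>int[OF L])
    have i1: "set_integrable lebesgue Q (\<lambda>x. e1 / a * \<mu> x powr - p')" using ia by (rule set_integrable_mult_right)
    have i2: "set_integrable lebesgue Q (\<lambda>x. e2 / d * \<kappa> x powr q)" using id by (rule set_integrable_mult_right)
    have i3: "set_integrable lebesgue Q (\<lambda>x. e3 / n * \<nu> x)" using iN by (rule set_integrable_mult_right)
    have Ql: "Q \<in> lmeasurable" by (simp add: Q_def)
    have "1 / A * m = (LINT x:Q|lebesgue. 1 / A)" by (simp only: set_integral_const_lebesgue(2)[OF Ql] m(2))
    also have "\<dots> \<le> (LINT x:Q|lebesgue. e1 / a * \<mu> x powr - p' + e2 / d * \<kappa> x powr q + e3 / n * \<nu> x)"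
    proof (rule set_integral_mono_AE)
      show "set_integrable lebesgue Q (\<lambda>_. 1 / A)" by (rule set_integral_const_lebesgue[OF Ql])
      show "set_integrable lebesgue Q (\<lambda>x. e1 / a * \<mu> x powr - p' + e2 / d * \<kappa> x powr q + e3 / n * \<nu> x)"
        by (intro set_integral_add i1 i2 i3)
      show "AE x\<in>Q in lebesgue. 1 / A \<le> e1 / a * \<mu> x powr - p' + e2 / d * \<kappa> x powr q + e3 / n * \<nu> x"
        using U.AE_pos K.AE_pos
      proof eventually_elim
        case (elim x)
        have 1: "(\<mu> x powr - p') powr e1 = \<mu> x powr - (1 / 2)" "(\<kappa> x powr q) powr e2 = \<kappa> x powr (1 / 2)"
          "\<nu> x powr e3 = (\<mu> x / \<kappa> x) powr (1 / 2)"
          using p \<theta>0 by (auto simp: powr_powr e1_def e2_def e3_def \<nu>)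
        have nux: "0 < \<nu> x" using elim by (simp add: \<nu>)
        have pd: "(\<mu> x powr - p' / a) powr e1 = \<mu> x powr - (1 / 2) / a powr e1"
          "(\<kappa> x powr q / d) powr e2 = \<kappa> x powr (1 / 2) / d powr e2"
          "(\<nu> x / n) powr e3 = (\<mu> x / \<kappa> x) powr (1 / 2) / n powr e3"
          using pos nux 1 by (simp_all only: powr_divide powr_ge_zero less_imp_le)
        have prod1: "\<mu> x powr - (1 / 2) * \<kappa> x powr (1 / 2) * (\<mu> x / \<kappa> x) powr (1 / 2) = 1"
          using elim by (simp add: powr_divide powr_minus field_simps)
        have "1 / A = (\<mu> x powr - p' / a) powr e1 * (\<kappa> x powr q / d) powr e2 * (\<nu> x / n) powr e3"
          unfolding pd times_divide_times_eq prod1 A_def ..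
        also have "\<dots> \<le> e1 * (\<mu> x powr - p' / a) + e2 * (\<kappa> x powr q / d) + e3 * (\<nu> x / n)"
          using elim pos e esum by (intro weighted_am_gm3) (auto simp: \<nu>)
        finally show ?case by (simp add: mult.commute)
      qed
    qed
    also have "\<dots> = (LINT x:Q|lebesgue. e1 / a * \<mu> x powr - p') + (LINT x:Q|lebesgue. e2 / d * \<kappa> x powr q) + (LINT x:Q|lebesgue. e3 / n * \<nu> x)"
      by (simp only: set_integral_add(2)[OF set_integral_add(1)[OF i1 i2] i3] set_integral_add(2)[OF i1 i2])
    also have "(LINT x:Q|lebesgue. e1 / a * \<mu> x powr - p') = e1 / a * a"
      using set_integral_mult_right[where a="e1 / a" and M=lebesgue and A=Q and f="\<lambda>x. \<mu> x powr - p'"] ia unfolding a_def[symmetric] by blast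
    also have "(LINT x:Q|lebesgue. e2 / d * \<kappa> x powr q) = e2 / d * d"
      using set_integral_mult_right[where a="e2 / d" and M=lebesgue and A=Q and f="\<lambda>x. \<kappa> x powr q"] id unfolding d_def[symmetric] by blast
    also have "(LINT x:Q|lebesgue. e3 / n * \<nu> x) = e3 / n * n"
      using set_integral_mult_right[where a="e3 / n" and M=lebesgue and A=Q and f=\<nu>] iN unfolding n_def[symmetric] by blast
    also have "e1 / a * a + e2 / d * d + e3 / n * n = 1" using pos esum by simp
    finally have "m \<le> A" using A by (simp add: field_simps)
    then have "m\<^sup>2 \<le> A\<^sup>2" using m by (intro power_mono) auto
    also have "A\<^sup>2 = (a powr e1)\<^sup>2 * (d powr e2)\<^sup>2 * (n powr e3)\<^sup>2" by (simp add: A_def power_mult_distrib)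
    also have "(a powr e1)\<^sup>2 = a powr (1 / p')" using pos p by (simp add: e1_def power2_eq_square flip: powr_add)
    also have "(d powr e2)\<^sup>2 = d powr (1 / q)" using pos p by (simp add: e2_def power2_eq_square flip: powr_add)
    also have "(n powr e3)\<^sup>2 = n powr \<theta>" using pos by (simp add: e3_def power2_eq_square flip: powr_add)
    finally show ?thesis by (simp add: m_def a_def d_def n_def Q_def)
  qed
  obtain K1 where K1: "0 < K1" "\<And>c L. 0 < L \<Longrightarrow>
    (LINT x:gbox \<beta> c L|lebesgue. \<mu> x powr p) powr (1 / p) *
    (LINT x:gbox \<beta> c L|lebesgue. \<mu> x powr - p') powr (1 / p') \<le> K1 * L powr exponent_size \<beta>"
    unfolding p'_def by (rule U.A_bound) blast
  obtain K2 where K2: "0 < K2" "\<And>c L. 0 < L \<Longrightarrow>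
    (LINT x:gbox \<beta> c L|lebesgue. \<kappa> x powr q) powr (1 / q) *
    (LINT x:gbox \<beta> c L|lebesgue. \<kappa> x powr - q') powr (1 / q') \<le> K2 * L powr exponent_size \<beta>"
    unfolding q'_def by (rule K.A_bound) blast
  define C where "C = K1 * K2 * (N powr exponent_size \<beta>)\<^sup>2"
  \<comment> \<open>Hoelder is used at scale L and the A conditions at scale N L: the masses of
    \<mu>^(-p') and \<kappa>^q may be enlarged to the dilate while \<nu> stays on the cube. The
    price is the square of N^|\<beta>| in \<open>C\<close>.\<close>
  have main: "(LINT x:gbox \<beta> c (N * L)|lebesgue. \<mu> x powr p) powr (1 / p) *
      (LINT x:gbox \<beta> c (N * L)|lebesgue. \<kappa> x powr - q') powr (1 / q')
      \<le> C * (LINT x:gbox \<beta> c L|lebesgue. \<nu> x) powr \<theta>" if L: "0 < L" for c L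
  proof -
    have LN: "0 < N * L" using L N by simp
    note sub = gbox_mono[OF U.beta L N, of c]
    define m where "m = L powr exponent_size \<beta>"
    define m' where "m' = (N * L) powr exponent_size \<beta>"
    have m: "0 < m" "m' = N powr exponent_size \<beta> * m" using L N by (auto simp: m_def m'_def powr_mult)
    define P where "P = (LINT x:gbox \<beta> c (N * L)|lebesgue. \<mu> x powr p) powr (1 / p)"
    define S where "S = (LINT x:gbox \<beta> c (N * L)|lebesgue. \<kappa> x powr - q') powr (1 / q')"
    define a where "a = (LINT x:gbox \<beta> c (N * L)|lebesgue. \<mu> x powr - p') powr (1 / p')"
    define d where "d = (LINT x:gbox \<beta> c (N * L)|lebesgue. \<kappa> x powr q) powr (1 / q)"
    define n where "n = (LINT x:gbox \<beta> c L|lebesgue. \<nu> x) powr \<theta>"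
    have nn: "0 \<le> P" "0 \<le> S" "0 \<le> a" "0 \<le> d" "0 \<le> n" by (auto simp: P_def S_def a_def d_def n_def)
    have 1: "P * a \<le> K1 * m'" "d * S \<le> K2 * m'"
      using K1(2)[OF LN, of c] K2(2)[OF LN, of c] by (auto simp: P_def S_def a_def d_def m'_def)
    have "m\<^sup>2 \<le> a * d * n"
    proof -
      have "(LINT x:gbox \<beta> c L|lebesgue. \<mu> x powr - p') powr (1 / p') \<le> a"
        unfolding a_def using U.integrable_dual[OF LN, of c] sub p
        by (intro powr_mono2 set_integral_mono_subset) (auto simp: p'_def set_lebesgue_integral_def)
      moreover have "(LINT x:gbox \<beta> c L|lebesgue. \<kappa> x powr q) powr (1 / q) \<le> d"
        unfolding d_def using K.integrable_powr[OF LN, of c] sub p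
        by (intro powr_mono2 set_integral_mono_subset) (auto simp: set_lebesgue_integral_def)
      ultimately have "(LINT x:gbox \<beta> c L|lebesgue. \<mu> x powr - p') powr (1 / p') *
        (LINT x:gbox \<beta> c L|lebesgue. \<kappa> x powr q) powr (1 / q) * n \<le> a * d * n"
        using nn by (intro mult_mono) auto
      with Holder3[OF L, of c] show ?thesis by (simp add: m_def n_def)
    qed
    then have "P * S * m\<^sup>2 \<le> P * S * (a * d * n)" using nn by (intro mult_left_mono) auto
    also have "\<dots> = (P * a) * (d * S) * n" by simp
    also have "\<dots> \<le> (K1 * m') * (K2 * m') * n"
    proof (rule mult_right_mono[OF mult_mono[OF 1]])
      show "0 \<le> K1 * m'" using K1 m N by simp
    qed (use nn in auto)
    also have "\<dots> = (C * n) * m\<^sup>2" by (simp add: C_def m power2_eq_square)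
    finally have "P * S \<le> C * n" using m by simp
    then show ?thesis by (simp add: P_def S_def n_def)
  qed
  show ?thesis
  proof (rule that[of C])
    show "0 < C" using K1 K2 N by (simp add: C_def)
  qed (use \<nu>mass main in \<open>auto simp: q'_def\<close>)
qed

lemma Lp_space_diff:
  fixes u v :: "'a::euclidean_space \<Rightarrow> complex"
  assumes q: "0 < q" and w[measurable]: "w \<in> borel_measurable lebesgue" and pos: "AE x in lebesgue. 0 < w x"
    and u: "u \<in> Lp_space q w" and v: "v \<in> Lp_space q w"
  shows "(\<lambda>x. u x - v x) \<in> Lp_space q w"
proof -
  have [measurable]: "u \<in> borel_measurable lebesgue" "v \<in> borel_measurable lebesgue"
    using u v by (auto simp: Lp_space_def)
  have pw: "(cmod (u x - v x) * w x) powr q \<le> 2 powr q * ((cmod (u x) * w x) powr q + (cmod (v x) * w x) powr q)"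
    if "0 < w x" for x
  proof -
    define a where "a = cmod (u x) * w x"
    define b where "b = cmod (v x) * w x"
    have ab: "0 \<le> a" "0 \<le> b" using that by (auto simp: a_def b_def)
    have "cmod (u x - v x) * w x \<le> (cmod (u x) + cmod (v x)) * w x"
      using that by (intro mult_right_mono norm_triangle_ineq4) auto
    also have "\<dots> \<le> 2 * max a b" by (simp add: a_def b_def distrib_right)
    finally have "(cmod (u x - v x) * w x) powr q \<le> (2 * max a b) powr q"
      using that q by (intro powr_mono2) auto
    also have "\<dots> = 2 powr q * max a b powr q" using ab by (simp add: powr_mult)
    also have "max a b powr q \<le> a powr q + b powr q" by (simp add: max_def)
    finally show ?thesis by (simp add: a_def b_def)
  qed
  have "integrable lebesgue (\<lambda>x. (cmod (u x - v x) * w x) powr q)"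
  proof (rule Bochner_Integration.integrable_bound)
    show "integrable lebesgue (\<lambda>x. 2 powr q * ((cmod (u x) * w x) powr q + (cmod (v x) * w x) powr q))"
      using u v by (auto simp: Lp_space_def)
    show "AE x in lebesgue. norm ((cmod (u x - v x) * w x) powr q) \<le> norm (2 powr q * ((cmod (u x) * w x) powr q + (cmod (v x) * w x) powr q))"
      using pos by eventually_elim (use pw in simp)
  qed measurable
  then show ?thesis by (simp add: Lp_space_def)
qed

lemma comm_form_scale:
  "comm_form M \<gamma> b (\<lambda>x. f x / k) (\<lambda>x. g x / j) = comm_form M \<gamma> b f g / (k * j)"
proof -
  have "(LINT t|M. f (x - \<gamma> t) / k * (b x - b (x - \<gamma> t))) = (LINT t|M. f (x - \<gamma> t) * (b x - b (x - \<gamma> t))) / k" for x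
    by (simp flip: integral_divide_zero)
  then have "comm_form M \<gamma> b (\<lambda>x. f x / k) (\<lambda>x. g x / j) =
     (LINT x|lborel. (g x * (LINT t|M. f (x - \<gamma> t) * (b x - b (x - \<gamma> t)))) / (k * j))"
    unfolding comm_form_def by (intro Bochner_Integration.integral_cong) (auto simp: mult.commute)
  then show ?thesis unfolding comm_form_def by simp
qed

text \<open>The average differs from any constant z by at most the mean of |b - z|. The factor 2 is
  the cost of passing from medians to the average in the definition of oscillation.\<close>

lemma set_integral_abs_diff_average_le:
  fixes b :: "'a::euclidean_space \<Rightarrow> complex"
  assumes Q: "Q \<in> lmeasurable" "0 < measure lebesgue Q" and b: "b absolutely_integrable_on Q"
  shows "(LINT x:Q|lebesgue. cmod (b x - average Q b)) \<le> 2 * (LINT x:Q|lebesgue. cmod (b x - z))"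
proof -
  have ic: "set_integrable lebesgue Q (\<lambda>_. y)" for y :: complex
    using Q by (auto simp: set_integrable_def fmeasurable_def)
  have id: "set_integrable lebesgue Q (\<lambda>x. b x - y)" for y by (rule set_integral_diff(1)[OF b ic])
  have idn: "set_integrable lebesgue Q (\<lambda>x. cmod (b x - y))" for y by (rule set_integrable_norm[OF id])
  define m where "m = measure lebesgue Q"
  define I where "I = (LINT x:Q|lebesgue. cmod (b x - z))"
  have cz: "(LINT x:Q|lebesgue. z) = m *\<^sub>R z"
    unfolding set_lebesgue_integral_def m_def
    by (subst integral_scaleR_left) (use Q in \<open>auto simp: fmeasurable_def\<close>)
  have "(LINT x:Q|lebesgue. b x - z) = (LINT x:Q|lebesgue. b x) - m *\<^sub>R z"
    using set_integral_diff(2)[OF b ic[of z]] cz by simp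
  then have "(1 / m) *\<^sub>R (LINT x:Q|lebesgue. b x - z) = average Q b - z"
    using Q by (simp add: average_def m_def scaleR_diff_right)
  then have "cmod (average Q b - z) = (1 / m) * cmod (LINT x:Q|lebesgue. b x - z)"
    using Q by (metis abs_of_pos m_def norm_scaleR zero_less_divide_1_iff)
  also have "\<dots> \<le> (1 / m) * I"
  proof (rule mult_left_mono)
    have "cmod (LINT x:Q|lebesgue. b x - z) \<le> (LINT x|lebesgue. norm (indicator Q x *\<^sub>R (b x - z)))"
      unfolding set_lebesgue_integral_def by (rule integral_norm_bound)
    also have "\<dots> = I" unfolding I_def set_lebesgue_integral_def
      by (intro Bochner_Integration.integral_cong) (auto simp: indicator_def)
    finally show "cmod (LINT x:Q|lebesgue. b x - z) \<le> I" .
  qed (use Q in \<open>simp add: m_def\<close>)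
  finally have av: "cmod (average Q b - z) * m \<le> I" using Q by (simp add: m_def field_simps)
  have "(LINT x:Q|lebesgue. cmod (b x - average Q b)) \<le> (LINT x:Q|lebesgue. cmod (b x - z) + cmod (average Q b - z))"
  proof (rule set_integral_mono[OF idn])
    show "set_integrable lebesgue Q (\<lambda>x. cmod (b x - z) + cmod (average Q b - z))"
      by (intro set_integral_add idn set_integral_const_lebesgue Q)
    show "cmod (b x - average Q b) \<le> cmod (b x - z) + cmod (average Q b - z)" for x
      using norm_triangle_ineq4[of "b x - z" "average Q b - z"] by simp
  qed
  also have "\<dots> = I + cmod (average Q b - z) * m"
    unfolding I_def m_def by (simp add: set_integral_add(2)[OF idn set_integral_const_lebesgue(1)[OF Q(1)]] set_integral_const_lebesgue(2)[OF Q(1)])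
  also have "\<dots> \<le> 2 * I" using av by simp
  finally show ?thesis by (simp add: I_def)
qed


section \<open>Oscillation and normalized means\<close>

text \<open>A locally integrable function is only Lebesgue measurable, and its composition with x -
  \<gamma>(t) need not be measurable in t. The commutator form is therefore evaluated on Borel
  representatives.\<close>

lemma borel_representatives:
  fixes b :: "real \<times> real \<Rightarrow> complex"
  assumes b: "locally_integrable b"
  obtains b1 b2 :: "real \<times> real \<Rightarrow> real" where "b1 \<in> borel_measurable borel" "b2 \<in> borel_measurable borel"
    "AE x in lebesgue. b x = Complex (b1 x) (b2 x)"
    "\<And>K. compact K \<Longrightarrow> set_integrable lborel K b1" "\<And>K. compact K \<Longrightarrow> set_integrable lborel K b2"
proof -
  have bm[measurable]: "b \<in> borel_measurable lebesgue" by (rule locally_integrable_measurable[OF b])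
  have RI: "(\<lambda>x. Re (b x)) \<in> borel_measurable lebesgue" "(\<lambda>x. Im (b x)) \<in> borel_measurable lebesgue"
    by measurable
  obtain b1 where b1: "b1 \<in> borel_measurable lborel" "AE x in lborel. Re (b x) = b1 x"
    using completion_ex_borel_measurable_real[OF RI(1)] by blast
  obtain b2 where b2: "b2 \<in> borel_measurable lborel" "AE x in lborel. Im (b x) = b2 x"
    using completion_ex_borel_measurable_real[OF RI(2)] by blast
  note b12 = b1(1) b2(1) and ae = b1(2) b2(2)
  have ae': "AE x in lebesgue. Re (b x) = b1 x" "AE x in lebesgue. Im (b x) = b2 x"
    using ae by (simp_all add: AE_completion_iff)
  have L: "set_integrable lborel K u" if K: "compact K" and u[measurable]: "u \<in> borel_measurable lborel"
    and i: "set_integrable lebesgue K v" and e: "AE x in lebesgue. v x = u x" for K and u v :: "real \<times> real \<Rightarrow> real"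
  proof -
    have [measurable]: "K \<in> sets borel" using K by (simp add: borel_compact)
    have um: "(\<lambda>x. indicator K x *\<^sub>R u x) \<in> borel_measurable lborel" by measurable
    have "integrable lebesgue (\<lambda>x. indicator K x *\<^sub>R u x)"
      by (rule integrable_cong_AE_imp[OF i[unfolded set_integrable_def]])
         (use e in \<open>auto intro!: measurable_completion um elim: eventually_mono\<close>)
    then show ?thesis unfolding set_integrable_def using integrable_completion[OF um] by simp
  qed
  show ?thesis
  proof (rule that)
    show "b1 \<in> borel_measurable borel" "b2 \<in> borel_measurable borel" using b12 by simp_all
    show "AE x in lebesgue. b x = Complex (b1 x) (b2 x)"
      using ae' by eventually_elim (simp add: complex_eq_iff)
    fix K :: "(real \<times> real) set" assume K: "compact K"
    then have bi: "set_integrable lebesgue K b" using b by (simp add: locally_integrable_def)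
    have "set_integrable lebesgue K (\<lambda>x. Re (b x))" "set_integrable lebesgue K (\<lambda>x. Im (b x))"
      using integrable_Re[OF bi[unfolded set_integrable_def]] integrable_Im[OF bi[unfolded set_integrable_def]]
      by (simp_all add: set_integrable_def)
    then show "set_integrable lborel K b1" "set_integrable lborel K b2"
      using L[OF K b12(1) _ ae'(1)] L[OF K b12(2) _ ae'(2)] by auto
  qed
qed

lemma set_integral_lebesgue_lborel:
  fixes f :: "'a::euclidean_space \<Rightarrow> real"
  assumes [measurable]: "f \<in> borel_measurable borel" "A \<in> sets borel"
  shows "(LINT x:A|lebesgue. f x) = (LINT x:A|lborel. f x)"
  unfolding set_lebesgue_integral_def by (rule integral_completion) measurable

lemma complex_diff_average_le:
  fixes b :: "real \<times> real \<Rightarrow> complex"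
  assumes L: "0 < L" and b: "locally_integrable b"
    and [measurable]: "b1 \<in> borel_measurable borel" "b2 \<in> borel_measurable borel"
    and ae: "AE x in lebesgue. b x = Complex (b1 x) (b2 x)"
    and i1: "set_integrable lborel (gbox \<beta> c L) b1" and i2: "set_integrable lborel (gbox \<beta> c L) b2"
  shows "(LINT x:gbox \<beta> c L|lebesgue. cmod (b x - average (gbox \<beta> c L) b)) \<le>
    2 * ((LINT x:gbox \<beta> c L|lborel. \<bar>b1 x - m1\<bar>) + (LINT x:gbox \<beta> c L|lborel. \<bar>b2 x - m2\<bar>))"
proof -
  define Q where "Q = gbox \<beta> c L"
  have [measurable]: "Q \<in> sets borel" "Q \<in> sets lebesgue" and Ql: "Q \<in> lmeasurable" by (auto simp: Q_def)
  have bi: "b absolutely_integrable_on Q" using b by (simp add: locally_integrable_def Q_def)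
  have ci: "set_integrable lborel Q (\<lambda>_. m)" for m :: real
    using emeasure_compact_finite[of Q] by (auto simp: set_integrable_def Q_def)
  have a1: "set_integrable lborel Q (\<lambda>x. \<bar>b1 x - m1\<bar>)" and a2: "set_integrable lborel Q (\<lambda>x. \<bar>b2 x - m2\<bar>)"
    using i1 i2 ci unfolding Q_def[symmetric] by (auto intro!: set_integrable_abs set_integral_diff)
  have leb: "set_integrable lebesgue Q u" if "set_integrable lborel Q u" for u :: "real \<times> real \<Rightarrow> real"
    using that unfolding set_integrable_def using integrable_completion[of "\<lambda>x. indicator Q x *\<^sub>R u x" lborel]
    by auto
  have cc: "set_integrable lebesgue Q (\<lambda>_. Complex m1 m2)" 
    using Ql by (auto simp: set_integrable_def fmeasurable_def)
  have "(LINT x:Q|lebesgue. cmod (b x - average Q b)) \<le> 2 * (LINT x:Q|lebesgue. cmod (b x - Complex m1 m2))"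
    by (rule set_integral_abs_diff_average_le[OF Ql _ bi]) (use measure_lebesgue_gbox[OF L] L in \<open>simp add: Q_def\<close>)
  also have "(LINT x:Q|lebesgue. cmod (b x - Complex m1 m2)) \<le> (LINT x:Q|lebesgue. \<bar>b1 x - m1\<bar> + \<bar>b2 x - m2\<bar>)"
  proof (rule set_integral_mono_AE)
    show "set_integrable lebesgue Q (\<lambda>x. cmod (b x - Complex m1 m2))"
      by (intro set_integrable_norm set_integral_diff(1) bi cc)
    show "set_integrable lebesgue Q (\<lambda>x. \<bar>b1 x - m1\<bar> + \<bar>b2 x - m2\<bar>)"
      by (intro set_integral_add leb a1 a2)
    show "AE x\<in>Q in lebesgue. cmod (b x - Complex m1 m2) \<le> \<bar>b1 x - m1\<bar> + \<bar>b2 x - m2\<bar>"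
      using ae
    proof eventually_elim
      case (elim x)
      then show ?case using cmod_le[of "b x - Complex m1 m2"] by simp
    qed
  qed
  also have "\<dots> = (LINT x:Q|lborel. \<bar>b1 x - m1\<bar> + \<bar>b2 x - m2\<bar>)"
    by (rule set_integral_lebesgue_lborel) auto
  also have "\<dots> = (LINT x:Q|lborel. \<bar>b1 x - m1\<bar>) + (LINT x:Q|lborel. \<bar>b2 x - m2\<bar>)"
    by (rule set_integral_add(2)[OF a1 a2])
  finally show ?thesis by (simp add: Q_def)
qed

text \<open>|F| is at most the indicator of the cube divided by the norm of that indicator in
  L^p_\<mu>.\<close>

lemma test_function_normalized:
  fixes f :: "real \<times> real \<Rightarrow> real"
  assumes "A_weight \<beta> p \<mu>" and L: "0 < L" and D: "0 < D"
    and fm[measurable]: "f \<in> borel_measurable borel" and fD: "\<And>x. \<bar>f x\<bar> \<le> D"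
    and supp: "\<And>x. f x \<noteq> 0 \<Longrightarrow> x \<in> gbox \<beta> c L"
  defines "F \<equiv> (\<lambda>x. complex_of_real (f x / (D * (LINT x:gbox \<beta> c L|lebesgue. \<mu> x powr p) powr (1 / p))))"
  shows "F \<in> bounded_compact_support" "F \<in> Lp_space p \<mu>" "Lp_norm p \<mu> F \<le> 1"
proof -
  interpret U: A_weight \<beta> p \<mu> by fact
  define Q where "Q = gbox \<beta> c L"
  define P where "P = (LINT x:Q|lebesgue. \<mu> x powr p)"
  have P: "0 < P" unfolding P_def Q_def by (rule U.powr_mass_pos[OF L])
  define k where "k = D * P powr (1 / p)"
  have k: "0 < k" using D P by (simp add: k_def)
  have F: "F = (\<lambda>x. complex_of_real (f x / k))" by (simp add: F_def k_def P_def Q_def)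
  have Fb[measurable]: "F \<in> borel_measurable borel" unfolding F by measurable
  have FL[measurable]: "F \<in> borel_measurable lebesgue" by (rule measurable_completion) simp
  have nF: "cmod (F x) \<le> indicator Q x / P powr (1 / p)" for x
  proof (cases "f x = 0")
    case False
    then have "x \<in> Q" using supp by (simp add: Q_def)
    moreover have "\<bar>f x\<bar> / k \<le> D / k" using fD k by (intro divide_right_mono) auto
    ultimately show ?thesis using D k P by (simp add: F k_def norm_divide norm_mult)
  qed (simp add: F P)
  have "bounded (range F)" unfolding bounded_iff
    by (intro exI[of _ "1 / P powr (1 / p)"]) (auto intro!: order_trans[OF nF] divide_right_mono simp: indicator_def)
  moreover have "\<forall>x. x \<notin> Q \<longrightarrow> F x = 0" using supp by (auto simp: F Q_def)
  ultimately show "F \<in> bounded_compact_support"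
    unfolding bounded_compact_support_def using FL by (auto simp: Q_def intro!: exI[of _ "gbox \<beta> c L"])
  have iP: "integrable lebesgue (\<lambda>x. indicator Q x * \<mu> x powr p / P)"
    using U.integrable_powr[OF L, of c] unfolding set_integrable_def Q_def[symmetric] by simp
  have ae: "AE x in lebesgue. (cmod (F x) * \<mu> x) powr p \<le> indicator Q x * \<mu> x powr p / P"
    using U.AE_pos
  proof eventually_elim
    case (elim x)
    have p: "0 < p" using U.p by simp
    have "(cmod (F x) * \<mu> x) powr p \<le> (indicator Q x / P powr (1 / p) * \<mu> x) powr p"
      using nF[of x] elim p by (intro powr_mono2 mult_right_mono) auto
    also have "\<dots> = indicator Q x * \<mu> x powr p / P"
    proof (cases "x \<in> Q")
      case True
      then have "(indicator Q x / P powr (1 / p) * \<mu> x) powr p = (\<mu> x / P powr (1 / p)) powr p" by simp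
      also have "\<dots> = \<mu> x powr p / (P powr (1 / p)) powr p" using elim P by (subst powr_divide) auto
      also have "(P powr (1 / p)) powr p = P" using P p by (simp add: powr_powr)
      finally show ?thesis using True by simp
    qed simp
    finally show ?case .
  qed
  have int: "integrable lebesgue (\<lambda>x. (cmod (F x) * \<mu> x) powr p)"
  proof (rule Bochner_Integration.integrable_bound[OF iP])
    show "AE x in lebesgue. norm ((cmod (F x) * \<mu> x) powr p) \<le> norm (indicator Q x * \<mu> x powr p / P)"
      using ae by eventually_elim (use P in auto)
  qed measurable
  then show "F \<in> Lp_space p \<mu>" by (simp add: Lp_space_def)
  have "(LINT x|lebesgue. (cmod (F x) * \<mu> x) powr p) \<le> (LINT x|lebesgue. indicator Q x * \<mu> x powr p / P)"
    by (rule integral_mono_AE[OF int iP ae])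
  also have "\<dots> = 1" using P by (simp add: P_def set_lebesgue_integral_def)
  finally show "Lp_norm p \<mu> F \<le> 1"
    unfolding Lp_norm_def using U.p by (intro powr_le1) auto
qed

text \<open>Only \<open>f\<close> is fed to \<open>T\<close>; \<open>g\<close>, divided by its
  bound, is at most the indicator of the dilate and leaves the mean of |T f|. Normalizing
  \<open>f\<close> costs the \<mu> mass and the mean costs the dual \<kappa> mass, and their product
  is what the two-weight bound compares with \<nu>(Q)^\<theta>.\<close>

lemma oscillation_le_dual_mean:
  fixes b :: "real \<times> real \<Rightarrow> complex"
  assumes curve: "is_monomial_curve \<beta> \<gamma>" and UW: "A_weight \<beta> p \<mu>" and KW: "A_weight \<beta> q \<kappa>"
    and \<alpha>: "\<alpha> / exponent_size \<beta> = 1 / p - 1 / q"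
    and \<nu>: "\<nu> = (\<lambda>x. (\<mu> x / \<kappa> x) powr inverse (1 + \<alpha> / exponent_size \<beta>))"
    and b: "locally_integrable b"
    and Tmap: "\<And>f. f \<in> Lp_space p \<mu> \<Longrightarrow> T f \<in> Lp_space q \<kappa>"
    and Tform: "\<And>f. f \<in> bounded_compact_support \<Longrightarrow> AE x in lebesgue.
           hilbert_exists \<gamma> f x \<and> hilbert_exists \<gamma> (\<lambda>y. b y * f y) x \<and> T f x = commutator b (hilbert \<gamma>) f x"
  obtains C N where "0 < C" "1 \<le> N"
    "\<And>c L. 0 < L \<Longrightarrow> \<exists>f\<in>Lp_space p \<mu>. Lp_norm p \<mu> f \<le> 1 \<and>
       oscillation \<beta> \<alpha> \<nu> b (gbox \<beta> c L) \<le> C * A_weight.dual_mean \<beta> q \<kappa> (T f) c (N * L)"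
proof -
  interpret U: A_weight \<beta> p \<mu> by fact
  interpret K: A_weight \<beta> q \<kappa> by fact
  \<comment> \<open>1 + 1/p - 1/q = 1/p + 1/q', the exponent that normalizes the
    oscillation.\<close>
  define \<theta> where "\<theta> = 1 / p + 1 / conj_exp q"
  have \<theta>: "1 + \<alpha> / exponent_size \<beta> = \<theta>" using conj_exp_inverse[OF K.p] by (simp add: \<alpha> \<theta>_def)
  have \<nu>': "\<nu> = (\<lambda>x. (\<mu> x / \<kappa> x) powr (1 / \<theta>))" by (simp add: \<nu> \<theta> inverse_eq_divide)
  obtain C1 N D where C1: "0 < C1" and N: "1 \<le> N" and D: "1 \<le> D" and
    test: "\<And>c L b. 0 < L \<Longrightarrow> b \<in> borel_measurable borel \<Longrightarrow> set_integrable lborel (gbox \<beta> c (N * L)) b \<Longrightarrow>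
       \<exists>m f g. test_pair \<beta> \<gamma> N D c L f g \<and>
          (LINT x:gbox \<beta> c L|lborel. \<bar>b x - m\<bar>) \<le> C1 * \<bar>comm_form (log_measure L (D * L)) \<gamma> b f g\<bar>"
    by (rule oscillation_le_comm_form[OF curve]) blast
  obtain C2 where C2: "0 < C2" and \<nu>pos: "\<And>c L. 0 < L \<Longrightarrow> 0 < (LINT x:gbox \<beta> c L|lebesgue. \<nu> x)"
    and C2b: "\<And>c L. 0 < L \<Longrightarrow> (LINT x:gbox \<beta> c (N * L)|lebesgue. \<mu> x powr p) powr (1 / p) *
      (LINT x:gbox \<beta> c (N * L)|lebesgue. \<kappa> x powr - conj_exp q) powr (1 / conj_exp q)
      \<le> C2 * (LINT x:gbox \<beta> c L|lebesgue. \<nu> x) powr \<theta>"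
    by (rule two_weight_bound[OF UW KW N \<theta>_def \<nu>']) blast
  obtain b1 b2 where b1[measurable]: "b1 \<in> borel_measurable borel" and b2[measurable]: "b2 \<in> borel_measurable borel"
    and ae: "AE x in lebesgue. b x = Complex (b1 x) (b2 x)"
    and bi: "\<And>K. compact K \<Longrightarrow> set_integrable lborel K b1" "\<And>K. compact K \<Longrightarrow> set_integrable lborel K b2"
    by (rule borel_representatives[OF b]) blast
  \<comment> \<open>The 4 is 2 for replacing the average by medians times 2 for keeping only one of
    the pairs found for the two parts of \<open>b\<close>; D^2 comes from the bounds of
    \<open>f\<close> and \<open>g\<close>.\<close>
  define C where "C = 4 * C1 * D\<^sup>2 * C2"
  have C: "0 < C" using C1 C2 D by (simp add: C_def)
  have D0: "0 < D" using D by simp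
  have main: "\<exists>f\<in>Lp_space p \<mu>. Lp_norm p \<mu> f \<le> 1 \<and>
       oscillation \<beta> \<alpha> \<nu> b (gbox \<beta> c L) \<le> C * K.dual_mean (T f) c (N * L)" if L: "0 < L" for c L
  proof -
    define Q where "Q = gbox \<beta> c L"
    define Q' where "Q' = gbox \<beta> c (N * L)"
    have LN: "0 < N * L" using L N by simp
    define M where "M = log_measure L (D * L)"
    obtain m1 f1 g1 where 1: "test_pair \<beta> \<gamma> N D c L f1 g1" "(LINT x:Q|lborel. \<bar>b1 x - m1\<bar>) \<le> C1 * \<bar>comm_form M \<gamma> b1 f1 g1\<bar>"
      using test[OF L b1 bi(1)] unfolding Q_def M_def by (meson compact_gbox)
    obtain m2 f2 g2 where 2: "test_pair \<beta> \<gamma> N D c L f2 g2" "(LINT x:Q|lborel. \<bar>b2 x - m2\<bar>) \<le> C1 * \<bar>comm_form M \<gamma> b2 f2 g2\<bar>"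
      using test[OF L b2 bi(2)] unfolding Q_def M_def by (meson compact_gbox)
    \<comment> \<open>For one pair f, g the two forms are, up to scaling, the real and imaginary
      part of a single pairing with \<open>T\<close>, so its modulus controls the larger one,
      whichever part of \<open>b\<close> the pair was found for.\<close>
    define \<Lambda> where "\<Lambda> f g = max \<bar>comm_form M \<gamma> b1 f g\<bar> \<bar>comm_form M \<gamma> b2 f g\<bar>" for f g
    have "(LINT x:Q|lebesgue. cmod (b x - average Q b)) \<le>
        2 * ((LINT x:Q|lborel. \<bar>b1 x - m1\<bar>) + (LINT x:Q|lborel. \<bar>b2 x - m2\<bar>))"
      unfolding Q_def by (rule complex_diff_average_le[OF L b b1 b2 ae bi]) simp_all
    also have "\<dots> \<le> 2 * (C1 * \<Lambda> f1 g1 + C1 * \<Lambda> f2 g2)"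
    proof -
      have "C1 * \<bar>comm_form M \<gamma> b1 f1 g1\<bar> \<le> C1 * \<Lambda> f1 g1" "C1 * \<bar>comm_form M \<gamma> b2 f2 g2\<bar> \<le> C1 * \<Lambda> f2 g2"
        using C1 by (auto simp: \<Lambda>_def)
      from add_mono[OF order_trans[OF 1(2) this(1)] order_trans[OF 2(2) this(2)]] show ?thesis by simp
    qed
    finally have le: "(LINT x:Q|lebesgue. cmod (b x - average Q b)) \<le> 2 * (C1 * \<Lambda> f1 g1 + C1 * \<Lambda> f2 g2)" .
    obtain f g where tp: "test_pair \<beta> \<gamma> N D c L f g" and osc: "(LINT x:Q|lebesgue. cmod (b x - average Q b)) \<le> 4 * C1 * \<Lambda> f g"
    proof (cases "\<Lambda> f1 g1 \<le> \<Lambda> f2 g2")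
      case True
      then have "C1 * \<Lambda> f1 g1 \<le> C1 * \<Lambda> f2 g2" using C1 by simp
      with le show ?thesis by (intro that[OF 2(1)]) simp
    next
      case False
      then have "C1 * \<Lambda> f2 g2 \<le> C1 * \<Lambda> f1 g1" using C1 by simp
      with le show ?thesis by (intro that[OF 1(1)]) simp
    qed
    have fm[measurable]: "f \<in> borel_measurable borel" and gm[measurable]: "g \<in> borel_measurable borel"
      and fg: "\<And>x. \<bar>f x\<bar> \<le> D" "\<And>x. \<bar>g x\<bar> \<le> D" "\<And>x. f x \<noteq> 0 \<Longrightarrow> x \<in> Q'" "\<And>x. g x \<noteq> 0 \<Longrightarrow> x \<in> Q'"
      and sep: "\<And>x t. g x \<noteq> 0 \<Longrightarrow> f (x - \<gamma> t) \<noteq> 0 \<Longrightarrow> L \<le> t \<and> t \<le> D * L"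
      using tp unfolding test_pair_def Q'_def by auto
    define P where "P = (LINT x:Q'|lebesgue. \<mu> x powr p) powr (1 / p)"
    define S where "S = (LINT x:Q'|lebesgue. \<kappa> x powr - conj_exp q) powr (1 / conj_exp q)"
    have P: "0 < P" using U.powr_mass_pos[OF LN, of c] by (simp add: P_def Q'_def)
    have S: "0 < S" using K.dual_mass_pos[OF LN, of c] by (simp add: S_def Q'_def)
    define F where "F = (\<lambda>x. complex_of_real (f x / (D * P)))"
    have F: "F \<in> bounded_compact_support" "F \<in> Lp_space p \<mu>" "Lp_norm p \<mu> F \<le> 1"
      unfolding F_def P_def Q'_def
      by (rule test_function_normalized[OF UW LN D0 fm fg(1)]; use fg(3) in \<open>simp add: Q'_def\<close>)+
    define G where "G x = g x / D" for x
    have [measurable]: "G \<in> borel_measurable borel" "G \<in> borel_measurable lebesgue"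
      unfolding G_def by (auto intro!: measurable_completion)
    have G1: "\<bar>G x\<bar> \<le> indicator Q' x" for x
      using fg(2,4)[of x] D0 by (cases "g x = 0") (auto simp: G_def)
    have TF: "T F \<in> Lp_space q \<kappa>" by (rule Tmap[OF F(2)])
    then have TFm[measurable]: "T F \<in> borel_measurable lebesgue" by (simp add: Lp_space_def)
    have Q'l: "Q' \<in> sets lebesgue" by (simp add: Q'_def)
    have iT: "set_integrable lebesgue Q' (\<lambda>x. cmod (T F x))"
      by (rule K.Lp_Holder(1)[OF TF Q'l _ LN, of c]) (simp add: Q'_def)
    have GT: "cmod (complex_of_real (G x) * T F x) \<le> indicator Q' x *\<^sub>R cmod (T F x)" for x
      using G1[of x] by (simp add: norm_mult mult_right_mono)
    have int: "integrable lebesgue (\<lambda>x. complex_of_real (G x) * T F x)"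
      by (rule Bochner_Integration.integrable_bound[OF iT[unfolded set_integrable_def]])
         (use GT in \<open>auto intro!: AE_I2\<close>)
    have pair: "(LINT x|lebesgue. complex_of_real (G x) * T F x) =
       Complex (comm_form M \<gamma> b1 (\<lambda>x. f x / (D * P)) G) (comm_form M \<gamma> b2 (\<lambda>x. f x / (D * P)) G)"
      unfolding M_def
    proof (rule commutator_pairing_eq_comm_form[OF monomial_curve_measurable[OF curve] _ _ _ L D b1 b2 ae _ int])
      show "L \<le> t \<and> t \<le> D * L" if "G x \<noteq> 0" "f (x - \<gamma> t) / (D * P) \<noteq> 0" for x t
        using that sep[of x t] by (auto simp: G_def)
      show "AE x in lebesgue. hilbert_exists \<gamma> (\<lambda>y. complex_of_real (f y / (D * P))) x \<and>
        hilbert_exists \<gamma> (\<lambda>y. b y * complex_of_real (f y / (D * P))) x \<and>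
        T F x = commutator b (hilbert \<gamma>) (\<lambda>y. complex_of_real (f y / (D * P))) x"
        using Tform[OF F(1)] unfolding F_def .
    qed measurable
    have sc: "comm_form M \<gamma> bb (\<lambda>x. f x / (D * P)) G = comm_form M \<gamma> bb f g / (D * P * D)" for bb
      unfolding G_def[abs_def] by (rule comm_form_scale)
    have "\<Lambda> f g / (D * P * D) \<le> cmod (LINT x|lebesgue. complex_of_real (G x) * T F x)"
    proof -
      define z where "z = (LINT x|lebesgue. complex_of_real (G x) * T F x)"
      have "\<bar>comm_form M \<gamma> b1 f g\<bar> / (D * P * D) = \<bar>Re z\<bar>" "\<bar>comm_form M \<gamma> b2 f g\<bar> / (D * P * D) = \<bar>Im z\<bar>"
        using D0 P unfolding z_def pair sc by (simp_all add: abs_mult)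
      then have "\<bar>comm_form M \<gamma> b1 f g\<bar> / (D * P * D) \<le> cmod z" "\<bar>comm_form M \<gamma> b2 f g\<bar> / (D * P * D) \<le> cmod z"
        using abs_Re_le_cmod[of z] abs_Im_le_cmod[of z] by auto
      then show ?thesis unfolding \<Lambda>_def z_def[symmetric] by (auto simp: max_def)
    qed
    also have "\<dots> \<le> (LINT x|lebesgue. cmod (complex_of_real (G x) * T F x))" by (rule integral_norm_bound)
    also have "\<dots> \<le> (LINT x:Q'|lebesgue. cmod (T F x))"
      unfolding set_lebesgue_integral_def
      by (rule integral_mono[OF integrable_norm[OF int] iT[unfolded set_integrable_def] GT])
    also have "\<dots> = K.dual_mean (T F) c (N * L) * S"
      using S by (simp add: K.dual_mean_def S_def Q'_def)
    finally have \<Lambda>: "\<Lambda> f g \<le> D\<^sup>2 * (P * S) * K.dual_mean (T F) c (N * L)"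
      using D0 P by (simp add: field_simps power2_eq_square)
    define n where "n = (LINT x:Q|lebesgue. \<nu> x)"
    have n: "0 < n" unfolding n_def Q_def by (rule \<nu>pos[OF L])
    have "P * S \<le> C2 * n powr \<theta>" using C2b[OF L, of c] by (simp add: P_def S_def n_def Q_def Q'_def)
    moreover have dm0: "0 \<le> K.dual_mean (T F) c (N * L)"
      unfolding K.dual_mean_def by (auto simp: set_lebesgue_integral_def)
    ultimately have "D\<^sup>2 * (P * S) * K.dual_mean (T F) c (N * L) \<le> D\<^sup>2 * (C2 * n powr \<theta>) * K.dual_mean (T F) c (N * L)"
      by (intro mult_right_mono mult_left_mono) auto
    with \<Lambda> have "\<Lambda> f g \<le> D\<^sup>2 * (C2 * n powr \<theta>) * K.dual_mean (T F) c (N * L)" by simp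
    then have "4 * C1 * \<Lambda> f g \<le> 4 * C1 * (D\<^sup>2 * (C2 * n powr \<theta>) * K.dual_mean (T F) c (N * L))"
      using C1 by (intro mult_left_mono) auto
    with osc have "(LINT x:Q|lebesgue. cmod (b x - average Q b)) \<le> n powr \<theta> * (C * K.dual_mean (T F) c (N * L))"
      by (simp add: C_def mult_ac)
    then have fin: "(LINT x:Q|lebesgue. cmod (b x - average Q b)) / n powr \<theta> \<le> C * K.dual_mean (T F) c (N * L)"
      using n by (simp add: field_simps)
    have "oscillation \<beta> \<alpha> \<nu> b Q = n powr (- \<alpha> / exponent_size \<beta>) * (1 / n * (LINT x:Q|lebesgue. cmod (b x - average Q b)))"
      by (simp add: oscillation_def n_def Let_def)
    also have "\<dots> = (LINT x:Q|lebesgue. cmod (b x - average Q b)) / n powr \<theta>"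
    proof -
      have "n powr \<theta> = n * n powr (\<alpha> / exponent_size \<beta>)" using n by (simp add: powr_add flip: \<theta>)
      then show ?thesis using powr_minus_divide[of n "\<alpha> / exponent_size \<beta>"] by simp
    qed
    finally show ?thesis using fin F(2,3) by (intro bexI[of _ F]) (auto simp: Q_def)
  qed
  show ?thesis by (rule that[OF C N]) (use main in blast)
qed


section \<open>Compactness\<close>

lemma oscillation_nonneg:
  assumes "\<And>x. 0 \<le> w x"
  shows "0 \<le> oscillation \<beta> \<alpha> w b Q"
  unfolding oscillation_def Let_def using assms
  by (intro mult_nonneg_nonneg) (auto simp: set_lebesgue_integral_def)

lemma translate_gbox: "(+) x ` gbox \<beta> c L = gbox \<beta> (x + c) L"
proof (intro set_eqI iffI)
  fix y assume "y \<in> (+) x ` gbox \<beta> c L"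
  then obtain z where "z \<in> gbox \<beta> c L" "y = x + z" by blast
  then show "y \<in> gbox \<beta> (x + c) L" by (simp add: mem_gbox)
next
  fix y assume "y \<in> gbox \<beta> (x + c) L"
  then have "y - x \<in> gbox \<beta> c L" by (simp add: mem_gbox algebra_simps)
  then show "y \<in> (+) x ` gbox \<beta> c L" by (intro image_eqI[of _ _ "y - x"]) auto
qed

lemma (in A_weight) dual_mean_triangle:
  assumes u: "u \<in> Lp_space p w" and h: "h \<in> Lp_space p w" and L: "0 < L"
  shows "dual_mean u c L \<le> Lp_norm p w (\<lambda>x. u x - h x) + dual_mean h c L"
proof -
  define Q where "Q = gbox \<beta> c L"
  define S where "S = (LINT x:Q|lebesgue. w x powr - conj_exp p) powr (1 / conj_exp p)"
  have S: "0 < S" using dual_mass_pos[OF L, of c] by (simp add: S_def Q_def)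
  have uh: "(\<lambda>x. u x - h x) \<in> Lp_space p w"
    using p by (intro Lp_space_diff measurable_weight AE_pos u h) simp
  have i: "set_integrable lebesgue Q (\<lambda>x. cmod (v x))" if "v \<in> Lp_space p w" for v
    by (rule Lp_Holder(1)[OF that _ _ L, of _ c]) (auto simp: Q_def)
  have "(LINT x:Q|lebesgue. cmod (u x)) \<le> (LINT x:Q|lebesgue. cmod (u x - h x) + cmod (h x))"
    by (rule set_integral_mono[OF i[OF u] set_integral_add(1)[OF i[OF uh] i[OF h]]])
       (metis diff_add_cancel norm_triangle_ineq)
  also have "\<dots> = (LINT x:Q|lebesgue. cmod (u x - h x)) + (LINT x:Q|lebesgue. cmod (h x))"
    by (rule set_integral_add(2)[OF i[OF uh] i[OF h]])
  finally have "(LINT x:Q|lebesgue. cmod (u x)) / S \<le> ((LINT x:Q|lebesgue. cmod (u x - h x)) + (LINT x:Q|lebesgue. cmod (h x))) / S"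
    using S by (intro divide_right_mono) auto
  then have "dual_mean u c L \<le> dual_mean (\<lambda>x. u x - h x) c L + dual_mean h c L"
    by (simp add: dual_mean_def S_def Q_def add_divide_distrib)
  with dual_mean_le_Lp_norm[OF uh L, of c] show ?thesis by simp
qed

text \<open>Compactness enters only here: along a subsequence the images of the test functions are
  replaced by a single function, whose normalized means over the cubes can then be estimated.\<close>

lemma (in A_weight) compact_oscillation_subsequence:
  fixes osc :: "real \<times> real \<Rightarrow> real \<Rightarrow> real" and c :: "nat \<Rightarrow> real \<times> real" and L :: "nat \<Rightarrow> real"
  assumes C: "0 < C" and N: "1 \<le> N"
    and T: "compact_operator r \<mu> p w T"
    and key: "\<And>c L. 0 < L \<Longrightarrow> \<exists>f\<in>Lp_space r \<mu>. Lp_norm r \<mu> f \<le> 1 \<and> osc c L \<le> C * dual_mean (T f) c (N * L)"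
    and L: "\<And>n. 0 < L n"
  obtains s h e where "strict_mono s" "h \<in> Lp_space p w" "e \<longlonglongrightarrow> 0"
    "\<And>n. osc (c (s n)) (L (s n)) \<le> C * (e n + dual_mean h (c (s n)) (N * L (s n)))"
proof -
  have "\<forall>n. \<exists>f. f \<in> Lp_space r \<mu> \<and> Lp_norm r \<mu> f \<le> 1 \<and> osc (c n) (L n) \<le> C * dual_mean (T f) (c n) (N * L n)"
    using key[OF L] by blast
  then obtain F where F: "\<And>n. F n \<in> Lp_space r \<mu>" "\<And>n. Lp_norm r \<mu> (F n) \<le> 1"
    "\<And>n. osc (c n) (L n) \<le> C * dual_mean (T (F n)) (c n) (N * L n)"
    by metis
  have TF: "T (F n) \<in> Lp_space p w" for n using T F(1) unfolding compact_operator_def by blast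
  have cpt: "\<forall>F C. (\<forall>n::nat. F n \<in> Lp_space r \<mu> \<and> Lp_norm r \<mu> (F n) \<le> C) \<longrightarrow>
        (\<exists>s g. strict_mono s \<and> g \<in> Lp_space p w \<and> (\<lambda>n. Lp_norm p w (\<lambda>x. T (F (s n)) x - g x)) \<longlonglongrightarrow> 0)"
    using T unfolding compact_operator_def by blast
  have "\<exists>s g. strict_mono s \<and> g \<in> Lp_space p w \<and> (\<lambda>n. Lp_norm p w (\<lambda>x. T (F (s n)) x - g x)) \<longlonglongrightarrow> 0"
    using spec[OF spec[OF cpt, of F], of 1] F(1,2) by simp
  then obtain s h where s: "strict_mono s" and h: "h \<in> Lp_space p w"
    and lim: "(\<lambda>n. Lp_norm p w (\<lambda>x. T (F (s n)) x - h x)) \<longlonglongrightarrow> 0"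
    by auto
  show ?thesis
  proof (rule that[OF s h lim])
    fix n
    have "0 < N * L (s n)" using N L[of "s n"] by simp
    from dual_mean_triangle[OF TF[of "s n"] h this, of "c (s n)"]
    have "C * dual_mean (T (F (s n))) (c (s n)) (N * L (s n)) \<le>
      C * (Lp_norm p w (\<lambda>x. T (F (s n)) x - h x) + dual_mean h (c (s n)) (N * L (s n)))"
      using C by (intro mult_left_mono) auto
    with F(3)[of "s n"] show "osc (c (s n)) (L (s n)) \<le>
      C * (Lp_norm p w (\<lambda>x. T (F (s n)) x - h x) + dual_mean h (c (s n)) (N * L (s n)))" by simp
  qed
qed

text \<open>If cubes had oscillations above every n, then along the subsequence the bound C (1 +
  norm of h) would be exceeded. So the BMO condition also follows from compactness, without an
  operator norm of \<open>T\<close>.\<close>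

lemma (in A_weight) compact_oscillation_bounded:
  fixes osc :: "real \<times> real \<Rightarrow> real \<Rightarrow> real"
  assumes C: "0 < C" and N: "1 \<le> N"
    and T: "compact_operator r \<mu> p w T"
    and key: "\<And>c L. 0 < L \<Longrightarrow> \<exists>f\<in>Lp_space r \<mu>. Lp_norm r \<mu> f \<le> 1 \<and> osc c L \<le> C * dual_mean (T f) c (N * L)"
  obtains B where "\<And>c L. 0 < L \<Longrightarrow> osc c L \<le> B"
proof -
  have "\<exists>B. \<forall>c L. 0 < L \<longrightarrow> osc c L \<le> B"
  proof (rule ccontr)
    assume "\<not> ?thesis"
    then have "\<forall>n::nat. \<exists>c L. 0 < L \<and> real n < osc c L" by (meson not_le)
    then obtain c L where L: "\<And>n::nat. 0 < L n" and big: "\<And>n::nat. real n < osc (c n) (L n)" by metis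
    obtain s h e where s: "strict_mono (s :: nat \<Rightarrow> nat)" and h: "h \<in> Lp_space p w" and e: "e \<longlonglongrightarrow> (0::real)"
      and le: "\<And>n. osc (c (s n)) (L (s n)) \<le> C * (e n + dual_mean h (c (s n)) (N * L (s n)))"
      by (rule compact_oscillation_subsequence[where c=c and L=L and osc=osc, OF C N T key L]) (assumption | rule that)+
    have "eventually (\<lambda>n. e n < 1) sequentially" using e by (rule order_tendstoD) simp
    then obtain n0 where n0: "\<And>n. n0 \<le> n \<Longrightarrow> e n < 1" by (auto simp: eventually_sequentially)
    obtain n1 :: nat where n1: "C * (1 + Lp_norm p w h) \<le> real n1" using real_arch_simple by blast
    define n where "n = max n0 n1"
    have "dual_mean h (c (s n)) (N * L (s n)) \<le> Lp_norm p w h"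
      using N L[of "s n"] by (intro dual_mean_le_Lp_norm h) simp
    with n0[of n] have "C * (e n + dual_mean h (c (s n)) (N * L (s n))) \<le> C * (1 + Lp_norm p w h)"
      using C by (intro mult_left_mono) (auto simp: n_def)
    with le[of n] n1 have "osc (c (s n)) (L (s n)) \<le> real n1" by linarith
    also have "\<dots> \<le> real (s n)" using seq_suble[OF s, of n] by (simp add: n_def)
    also have "\<dots> < osc (c (s n)) (L (s n))" by (rule big)
    finally show False by simp
  qed
  then show ?thesis using that by blast
qed

text \<open>\<open>P\<close> n describes the n-th stage of a family of cubes along which the means
  of each fixed function vanish. One argument by contradiction then serves small, large and distant
  cubes; a single stage n is enough because these families shrink as n grows.\<close>

lemma (in A_weight) compact_oscillation_vanishes:
  fixes osc :: "real \<times> real \<Rightarrow> real \<Rightarrow> real"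
  assumes C: "0 < C" and N: "1 \<le> N"
    and T: "compact_operator r \<mu> p w T"
    and key: "\<And>c L. 0 < L \<Longrightarrow> \<exists>f\<in>Lp_space r \<mu>. Lp_norm r \<mu> f \<le> 1 \<and> osc c L \<le> C * dual_mean (T f) c (N * L)"
    and P: "\<And>h \<epsilon>. h \<in> Lp_space p w \<Longrightarrow> 0 < \<epsilon> \<Longrightarrow>
        \<exists>n0. \<forall>n\<ge>n0. \<forall>c L. 0 < L \<longrightarrow> P (n::nat) c L \<longrightarrow> dual_mean h c (N * L) < \<epsilon>"
    and \<epsilon>: "0 < \<epsilon>"
  obtains n where "\<And>c L. 0 < L \<Longrightarrow> P n c L \<Longrightarrow> osc c L \<le> \<epsilon>"
proof -
  have "\<exists>n. \<forall>c L. 0 < L \<longrightarrow> P n c L \<longrightarrow> osc c L \<le> \<epsilon>"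
  proof (rule ccontr)
    assume "\<not> ?thesis"
    then have "\<forall>n. \<exists>c L. 0 < L \<and> P n c L \<and> \<epsilon> < osc c L" by (meson not_le)
    then obtain c L where L: "\<And>n. 0 < L n" and Pn: "\<And>n. P n (c n) (L n)" and big: "\<And>n. \<epsilon> < osc (c n) (L n)" by metis
    obtain s h e where s: "strict_mono (s :: nat \<Rightarrow> nat)" and h: "h \<in> Lp_space p w" and e: "e \<longlonglongrightarrow> (0::real)"
      and le: "\<And>n. osc (c (s n)) (L (s n)) \<le> C * (e n + dual_mean h (c (s n)) (N * L (s n)))"
      by (rule compact_oscillation_subsequence[where c=c and L=L and osc=osc, OF C N T key L]) (assumption | rule that)+
    have d: "0 < \<epsilon> / (2 * C)" using \<epsilon> C by simp
    have "eventually (\<lambda>n. e n < \<epsilon> / (2 * C)) sequentially" using e d by (rule order_tendstoD)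
    then obtain n0 where n0: "\<And>n. n0 \<le> n \<Longrightarrow> e n < \<epsilon> / (2 * C)" by (auto simp: eventually_sequentially)
    obtain n1 where n1: "\<And>n c L. n1 \<le> n \<Longrightarrow> 0 < L \<Longrightarrow> P n c L \<Longrightarrow> dual_mean h c (N * L) < \<epsilon> / (2 * C)"
      using P[OF h d] by blast
    define n where "n = max n0 n1"
    have "n1 \<le> s n" using seq_suble[OF s, of n] by (simp add: n_def)
    from n1[OF this L Pn] n0[of n] have "e n + dual_mean h (c (s n)) (N * L (s n)) \<le> \<epsilon> / (2 * C) + \<epsilon> / (2 * C)"
      by (simp add: n_def)
    then have "C * (e n + dual_mean h (c (s n)) (N * L (s n))) \<le> C * (\<epsilon> / (2 * C) + \<epsilon> / (2 * C))"
      using C by (intro mult_left_mono) auto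
    also have "\<dots> = \<epsilon>" using C by (simp add: field_simps)
    finally show False using le[of n] big[of "s n"] by simp
  qed
  then show ?thesis using that by blast
qed

theorem theorem1p35:
  fixes \<gamma> :: "real \<Rightarrow> real \<times> real" and \<beta> :: "real \<times> real"
    and p q \<alpha> :: real
    and \<mu> \<kappa> \<nu> :: "real \<times> real \<Rightarrow> real"
    and b :: "real \<times> real \<Rightarrow> complex"
  assumes "is_monomial_curve \<beta> \<gamma>"
    and "1 < p" and "1 < q"
    and "\<mu> \<in> A_class \<beta> p" and "\<kappa> \<in> A_class \<beta> q"
    and "\<alpha> / exponent_size \<beta> = 1 / p - 1 / q"
    and "\<nu> = (\<lambda>x. (\<mu> x / \<kappa> x) powr inverse (1 + \<alpha> / exponent_size \<beta>))"
    and "locally_integrable b"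
    and "commutator_compact \<gamma> b p \<mu> q \<kappa>"
  shows "b \<in> VMO \<beta> \<alpha> \<nu>"
proof -
  have beta: "0 < fst \<beta>" "0 < snd \<beta>" using assms(1) by (auto simp: is_monomial_curve_def)
  have UW: "A_weight \<beta> p \<mu>" and KW: "A_weight \<beta> q \<kappa>"
    using beta assms by (auto intro!: A_weight.intro)
  interpret K: A_weight \<beta> q \<kappa> by fact
  obtain T where T: "compact_operator p \<mu> q \<kappa> T" and
    Tform: "\<And>f. f \<in> bounded_compact_support \<Longrightarrow> AE x in lebesgue.
           hilbert_exists \<gamma> f x \<and> hilbert_exists \<gamma> (\<lambda>y. b y * f y) x \<and> T f x = commutator b (hilbert \<gamma>) f x"
    using assms(9) unfolding commutator_compact_def by blast
  have Tmap: "T f \<in> Lp_space q \<kappa>" if "f \<in> Lp_space p \<mu>" for f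
    using T that unfolding compact_operator_def by blast
  define osc where "osc c L = oscillation \<beta> \<alpha> \<nu> b (gbox \<beta> c L)" for c L
  obtain C N where C: "0 < C" and N: "1 \<le> N" and key: "\<And>c L. 0 < L \<Longrightarrow> \<exists>f\<in>Lp_space p \<mu>. Lp_norm p \<mu> f \<le> 1 \<and>
       osc c L \<le> C * K.dual_mean (T f) c (N * L)"
    unfolding osc_def
    by (rule oscillation_le_dual_mean[OF assms(1) UW KW assms(6,7,8) Tmap Tform]) blast+
  note vanishes = K.compact_oscillation_vanishes[OF C N T key]
  have osc0: "0 \<le> osc c L" for c L
    unfolding osc_def by (rule oscillation_nonneg) (simp add: assms(7))
  obtain B where B: "\<And>c L. 0 < L \<Longrightarrow> osc c L \<le> B"
    by (rule K.compact_oscillation_bounded[OF C N T key]) blast+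
  have cubes: "Q \<in> gamma_cubes \<beta> \<longleftrightarrow> (\<exists>c L. 0 < L \<and> Q = gbox \<beta> c L)" for Q
    by (rule gamma_cubes_eq_gbox[OF beta])
  have BMO: "bdd_above (oscillation \<beta> \<alpha> \<nu> b ` gamma_cubes \<beta>)"
    using B by (intro bdd_aboveI[of _ B]) (auto simp: cubes osc_def)
  \<comment> \<open>The supremum is taken in the reals, where an empty or unbounded set gives an
    uninformative value. The witness side \<open>L0\<close> and the BMO bound exclude both.\<close>
  have SUP: "\<bar>SUP Q\<in>{Q\<in>gamma_cubes \<beta>. R (side \<beta> Q)}. oscillation \<beta> \<alpha> \<nu> b Q\<bar> \<le> \<epsilon>"
    if R: "0 < L0" "R L0" and le: "\<And>c L. 0 < L \<Longrightarrow> R L \<Longrightarrow> osc c L \<le> \<epsilon>" for R \<epsilon> L0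
  proof -
    have mem: "gbox \<beta> 0 L0 \<in> {Q\<in>gamma_cubes \<beta>. R (side \<beta> Q)}"
      using R gbox_in_gamma_cubes[OF beta R(1)] by (simp add: side_gbox[OF beta(1)])
    have "(SUP Q\<in>{Q\<in>gamma_cubes \<beta>. R (side \<beta> Q)}. oscillation \<beta> \<alpha> \<nu> b Q) \<le> \<epsilon>"
      using mem le by (intro cSUP_least) (auto simp: cubes side_gbox[OF beta(1)] osc_def)
    moreover have "0 \<le> (SUP Q\<in>{Q\<in>gamma_cubes \<beta>. R (side \<beta> Q)}. oscillation \<beta> \<alpha> \<nu> b Q)"
      by (rule cSUP_upper2[OF bdd_above_mono[OF BMO] mem]) (use osc0 in \<open>auto simp: osc_def\<close>)
    ultimately show ?thesis by simp
  qed
  have small: "((\<lambda>r. SUP Q\<in>{Q\<in>gamma_cubes \<beta>. side \<beta> Q \<le> r}. oscillation \<beta> \<alpha> \<nu> b Q) \<longlongrightarrow> 0) (at_right 0)"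
  proof (rule tendstoI)
    fix e :: real assume e: "0 < e"
    \<comment> \<open>\<open>Suc\<close> matters: at n = 0 the quotient 1 / n is 0, and the stage L
      <= 0 would contain no cube.\<close>
    obtain n :: nat where n: "\<And>c L. 0 < L \<Longrightarrow> L \<le> 1 / real (Suc n) \<Longrightarrow> osc c L \<le> e / 2"
    proof (rule vanishes[of "\<lambda>n c L. L \<le> 1 / real (Suc n)" "e / 2"])
      fix h \<epsilon> assume "h \<in> Lp_space q \<kappa>" "0 < (\<epsilon>::real)"
      then obtain r where r: "0 < r" "\<And>c L. 0 < L \<Longrightarrow> L \<le> r \<Longrightarrow> K.dual_mean h c L < \<epsilon>"
        using K.dual_mean_small by metis
      obtain n0 :: nat where n0: "N / r \<le> real n0" using real_arch_simple by blast
      have "K.dual_mean h c (N * L) < \<epsilon>" if "n0 \<le> n" "0 < L" "L \<le> 1 / real (Suc n)" for n c L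
      proof (rule r(2))
        show "0 < N * L" using N that by simp
        have "N * L \<le> N * (1 / real (Suc n))" using N that by (intro mult_left_mono) auto
        also have "\<dots> \<le> r"
        proof -
          have "N \<le> r * real n0" using n0 r(1) by (simp add: field_simps)
          also have "\<dots> \<le> r * real (Suc n)" using r(1) that by (intro mult_left_mono) auto
          finally show ?thesis by (simp add: field_simps)
        qed
        finally show "N * L \<le> r" .
      qed
      then show "\<exists>n0. \<forall>n\<ge>n0. \<forall>c L. 0 < L \<longrightarrow> L \<le> 1 / real (Suc n) \<longrightarrow> K.dual_mean h c (N * L) < \<epsilon>" by blast
    qed (use e in auto)
    have "dist (SUP Q\<in>{Q\<in>gamma_cubes \<beta>. side \<beta> Q \<le> r}. oscillation \<beta> \<alpha> \<nu> b Q) 0 < e"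
      if "0 < r" "r < 1 / real (Suc n)" for r
    proof -
      have "\<bar>SUP Q\<in>{Q\<in>gamma_cubes \<beta>. side \<beta> Q \<le> r}. oscillation \<beta> \<alpha> \<nu> b Q\<bar> \<le> e / 2"
        by (rule SUP[of r "\<lambda>l. l \<le> r"]) (use that n in auto)
      then show ?thesis using e by (simp add: dist_real_def)
    qed
    then show "\<forall>\<^sub>F r in at_right 0. dist (SUP Q\<in>{Q\<in>gamma_cubes \<beta>. side \<beta> Q \<le> r}. oscillation \<beta> \<alpha> \<nu> b Q) 0 < e"
      unfolding eventually_at_right_field by (intro exI[of _ "1 / real (Suc n)"]) auto
  qed
  have large: "((\<lambda>r. SUP Q\<in>{Q\<in>gamma_cubes \<beta>. r \<le> side \<beta> Q}. oscillation \<beta> \<alpha> \<nu> b Q) \<longlongrightarrow> 0) at_top"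
  proof (rule tendstoI)
    fix e :: real assume e: "0 < e"
    obtain n :: nat where n: "\<And>c L. 0 < L \<Longrightarrow> real n \<le> L \<Longrightarrow> osc c L \<le> e / 2"
    proof (rule vanishes[of "\<lambda>n c L. real n \<le> L" "e / 2"])
      fix h \<epsilon> assume "h \<in> Lp_space q \<kappa>" "0 < (\<epsilon>::real)"
      then obtain r where r: "0 < r" "\<And>c L. r \<le> L \<Longrightarrow> K.dual_mean h c L < \<epsilon>"
        using K.dual_mean_large by metis
      obtain n0 :: nat where n0: "r \<le> real n0" using real_arch_simple by blast
      have "K.dual_mean h c (N * L) < \<epsilon>" if "n0 \<le> n" "0 < L" "real n \<le> L" for n c L
      proof (rule r(2))
        have "r \<le> 1 * L" using n0 that by simp
        also have "\<dots> \<le> N * L" using N that by (intro mult_right_mono) auto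
        finally show "r \<le> N * L" .
      qed
      then show "\<exists>n0. \<forall>n\<ge>n0. \<forall>c L. 0 < L \<longrightarrow> real n \<le> L \<longrightarrow> K.dual_mean h c (N * L) < \<epsilon>" by blast
    qed (use e in auto)
    \<comment> \<open>r >= n + 1 is positive and can itself be the side of the witness cube.\<close>
    have "dist (SUP Q\<in>{Q\<in>gamma_cubes \<beta>. r \<le> side \<beta> Q}. oscillation \<beta> \<alpha> \<nu> b Q) 0 < e"
      if "real (Suc n) \<le> r" for r
    proof -
      have "\<bar>SUP Q\<in>{Q\<in>gamma_cubes \<beta>. r \<le> side \<beta> Q}. oscillation \<beta> \<alpha> \<nu> b Q\<bar> \<le> e / 2"
        by (rule SUP[of r "\<lambda>l. r \<le> l"]) (use that n in auto)
      then show ?thesis using e by (simp add: dist_real_def)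
    qed
    then show "\<forall>\<^sub>F r in at_top. dist (SUP Q\<in>{Q\<in>gamma_cubes \<beta>. r \<le> side \<beta> Q}. oscillation \<beta> \<alpha> \<nu> b Q) 0 < e"
      unfolding eventually_at_top_linorder by blast
  qed
  have far: "((\<lambda>x. oscillation \<beta> \<alpha> \<nu> b ((+) x ` Q)) \<longlongrightarrow> 0) at_infinity" if Q: "Q \<in> gamma_cubes \<beta>" for Q
  proof (rule tendstoI)
    fix e :: real assume e: "0 < e"
    obtain c0 L0 where L0: "0 < L0" and Q: "Q = gbox \<beta> c0 L0" using Q by (auto simp: cubes)
    obtain n :: nat where n: "\<And>c L. 0 < L \<Longrightarrow> L = L0 \<and> real n \<le> norm c \<Longrightarrow> osc c L \<le> e / 2"
    proof (rule vanishes[of "\<lambda>n c L. L = L0 \<and> real n \<le> norm c" "e / 2"])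
      fix h \<epsilon> assume h: "h \<in> Lp_space q \<kappa>" "0 < (\<epsilon>::real)"
      have NL0: "0 < N * L0" using N L0 by simp
      obtain r where r: "\<And>c. r \<le> norm c \<Longrightarrow> K.dual_mean h c (N * L0) < \<epsilon>"
        using K.dual_mean_far[OF h NL0] by metis
      obtain n0 :: nat where n0: "r \<le> real n0" using real_arch_simple by blast
      show "\<exists>n0. \<forall>n\<ge>n0. \<forall>c L. 0 < L \<longrightarrow> L = L0 \<and> real n \<le> norm c \<longrightarrow> K.dual_mean h c (N * L) < \<epsilon>"
        using r n0 by (intro exI[of _ n0]) (auto intro: order_trans)
    qed (use e in auto)
    \<comment> \<open>The translate by x has centre x + c0, so the threshold is raised by the norm
      of c0.\<close>
    have "dist (oscillation \<beta> \<alpha> \<nu> b ((+) x ` Q)) 0 < e" if "real n + norm c0 \<le> norm x" for x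
    proof -
      have "norm x \<le> norm (x + c0) + norm c0" using norm_triangle_ineq4[of "x + c0" c0] by simp
      then have "osc (x + c0) L0 \<le> e / 2" using n[OF L0, of "x + c0"] that by simp
      then show ?thesis using e osc0[of "x + c0" L0] by (simp add: Q translate_gbox dist_real_def osc_def)
    qed
    then show "\<forall>\<^sub>F x in at_infinity. dist (oscillation \<beta> \<alpha> \<nu> b ((+) x ` Q)) 0 < e"
      unfolding eventually_at_infinity by blast
  qed
  show ?thesis
    unfolding VMO_def BMO_def using assms(8) BMO small large far by blast
qed

end
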